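(* Let $\Omega=(a,b)\subseteq\mathbb{R}$ be a bounded open interval, $f\in L^\infty(\Omega)\cap\mathrm{BV}(\Omega)$ and $\alpha>0$. For $\beta>0$ let $$(u_{\beta,\alpha},w_{\beta,\alpha})\in\operatorname*{argmin}_{u\in\mathrm{BV}(\Omega),\ w\in\mathrm{BV}(\Omega)}\ \frac12\|f-u\|_{L^2(\Omega)}^2+\alpha\|Du-w\|_{\mathcal M}+\beta\|Dw\|_{\mathcal M}.$$ Then there exists a threshold $\beta^\ast>0$ such that for every $0<\beta<\beta^\ast$ $$\|D^su_{\beta,\alpha}\|_{\mathcal M}=0\qquad\text{and}\qquad w_{\beta,\alpha}=\nabla u_{\beta,\alpha}.$$ In particular, for $0<\beta<\beta^\ast$, $$u_{\beta,\alpha}=\operatorname*{argmin}_{u\in\mathrm{BV}(\Omega)}\ \frac12\|f-u\|_{L^2(\Omega)}^2+\beta\|D^2u\|_{\mathcal M}.$$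
   Context: For a distribution $\mathcal T$ on $\Omega$, the Radon norm is $\|\mathcal T\|_{\mathcal M}=\sup\{\langle \mathcal T,v\rangle: v\in C_c^\infty(\Omega),\ \|v\|_\infty\le 1\}$, possibly $+\infty$. $\mathrm{BV}(\Omega)$ is the space of $u\in L^1(\Omega)$ whose distributional derivative $Du$ is a finite Radon measure. In $\|Du-w\|_{\mathcal M}$, $w$ is identified with the measure $w\mathcal{L}^1$. For $u\in \mathrm{BV}(\Omega)$, $Du=\nabla u\,\mathcal{L}^1+D^su$ is the Lebesgue decomposition of $Du$ into its absolutely continuous part (with density $\nabla u$) and its singular part $D^su$. $D^2u$ is the second distributional derivative. *)

theory Defs
  imports "HOL-Analysis.Analysis"
begin

text \<open>
  Functions on an open set \<open>\<Omega>\<close> of reals are total functions whose values outside \<open>\<Omega>\<close> are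
  irrelevant; almost-everywhere classes are represented by arbitrary Lebesgue measurable
  representatives.
\<close>

text \<open>A test function on \<open>\<Omega>\<close> is identified with its extension by zero to the whole line.\<close>

definition test_functions :: "real set \<Rightarrow> (real \<Rightarrow> real) set" where
  "test_functions \<Omega> =
     {v. (\<forall>n. (deriv ^^ n) v differentiable_on UNIV) \<and>
         compact (closure {x. v x \<noteq> 0}) \<and> closure {x. v x \<noteq> 0} \<subseteq> \<Omega>}"

text \<open>
  Distributions are represented by functionals; only their values on test functions matter.
\<close>

type_synonym distribution = "(real \<Rightarrow> real) \<Rightarrow> real"

definition dist_of :: "real set \<Rightarrow> (real \<Rightarrow> real) \<Rightarrow> distribution" where
  "dist_of \<Omega> u = (\<lambda>v. \<integral>x. u x * v x \<partial>lebesgue_on \<Omega>)"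

definition dist_deriv :: "distribution \<Rightarrow> distribution" where
  "dist_deriv T = (\<lambda>v. - T (deriv v))"

definition dist_diff :: "distribution \<Rightarrow> distribution \<Rightarrow> distribution" where
  "dist_diff S T = (\<lambda>v. S v - T v)"

definition weak_deriv :: "real set \<Rightarrow> (real \<Rightarrow> real) \<Rightarrow> distribution" where
  "weak_deriv \<Omega> u = dist_deriv (dist_of \<Omega> u)"

definition radon_norm :: "real set \<Rightarrow> distribution \<Rightarrow> ereal" where
  "radon_norm \<Omega> T = (SUP v \<in> {v \<in> test_functions \<Omega>. \<forall>x\<in>\<Omega>. \<bar>v x\<bar> \<le> 1}. ereal (T v))"

text \<open>
  A finite signed Radon measure is given as a difference of two finite positive Borel measures on
  \<open>\<Omega>\<close> (Jordan decomposition; on an open set of reals every finite Borel measure is Radon).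
\<close>

definition finite_borel_on :: "real set \<Rightarrow> real measure \<Rightarrow> bool" where
  "finite_borel_on \<Omega> \<mu> \<longleftrightarrow> finite_measure \<mu> \<and> sets \<mu> = sets (restrict_space borel \<Omega>)"

definition represented_by :: "real set \<Rightarrow> distribution \<Rightarrow> real measure \<Rightarrow> real measure \<Rightarrow> bool" where
  "represented_by \<Omega> T \<mu> \<nu> \<longleftrightarrow>
     finite_borel_on \<Omega> \<mu> \<and> finite_borel_on \<Omega> \<nu> \<and>
     (\<forall>v\<in>test_functions \<Omega>. T v = (\<integral>x. v x \<partial>\<mu>) - (\<integral>x. v x \<partial>\<nu>))"

definition is_finite_radon :: "real set \<Rightarrow> distribution \<Rightarrow> bool" where
  "is_finite_radon \<Omega> T \<longleftrightarrow> (\<exists>\<mu> \<nu>. represented_by \<Omega> T \<mu> \<nu>)"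

text \<open>Finite Radon measures concentrated on a Lebesgue null set.\<close>

definition is_singular_radon :: "real set \<Rightarrow> distribution \<Rightarrow> bool" where
  "is_singular_radon \<Omega> T \<longleftrightarrow>
     (\<exists>\<mu> \<nu>. represented_by \<Omega> T \<mu> \<nu> \<and>
        (\<exists>N\<in>null_sets lborel. emeasure \<mu> (\<Omega> - N) = 0 \<and> emeasure \<nu> (\<Omega> - N) = 0))"

definition BV :: "real set \<Rightarrow> (real \<Rightarrow> real) set" where
  "BV \<Omega> = {u. integrable (lebesgue_on \<Omega>) u \<and> is_finite_radon \<Omega> (weak_deriv \<Omega> u)}"

definition L_infty :: "real set \<Rightarrow> (real \<Rightarrow> real) set" where
  "L_infty \<Omega> = {f \<in> borel_measurable (lebesgue_on \<Omega>).
     \<exists>C. AE x in lebesgue_on \<Omega>. \<bar>f x\<bar> \<le> C}"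

text \<open>
  The Lebesgue decomposition of the weak derivative. For \<open>u\<close> of bounded variation a density as
  below exists by Lebesgue's decomposition theorem, and it is unique up to null sets, so
  the singular part does not depend on the choice.
\<close>

definition ac_density :: "real set \<Rightarrow> (real \<Rightarrow> real) \<Rightarrow> real \<Rightarrow> real" where
  "ac_density \<Omega> u = (SOME g. integrable (lebesgue_on \<Omega>) g \<and>
     is_singular_radon \<Omega> (dist_diff (weak_deriv \<Omega> u) (dist_of \<Omega> g)))"

definition singular_part :: "real set \<Rightarrow> (real \<Rightarrow> real) \<Rightarrow> distribution" where
  "singular_part \<Omega> u = dist_diff (weak_deriv \<Omega> u) (dist_of \<Omega> (ac_density \<Omega> u))"

definition sq_L2_norm :: "real set \<Rightarrow> (real \<Rightarrow> real) \<Rightarrow> ereal" where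
  "sq_L2_norm \<Omega> h = enn2ereal (\<integral>\<^sup>+x. ennreal ((h x)\<^sup>2) \<partial>lebesgue_on \<Omega>)"

definition TGV_energy ::
  "real set \<Rightarrow> (real \<Rightarrow> real) \<Rightarrow> real \<Rightarrow> real \<Rightarrow> (real \<Rightarrow> real) \<times> (real \<Rightarrow> real) \<Rightarrow> ereal" where
  "TGV_energy \<Omega> f \<alpha> \<beta> = (\<lambda>(u, w).
     ereal (1 / 2) * sq_L2_norm \<Omega> (\<lambda>x. f x - u x)
     + ereal \<alpha> * radon_norm \<Omega> (dist_diff (weak_deriv \<Omega> u) (dist_of \<Omega> w))
     + ereal \<beta> * radon_norm \<Omega> (weak_deriv \<Omega> w))"

definition TV2_energy ::
  "real set \<Rightarrow> (real \<Rightarrow> real) \<Rightarrow> real \<Rightarrow> (real \<Rightarrow> real) \<Rightarrow> ereal" where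
  "TV2_energy \<Omega> f \<beta> u =
     ereal (1 / 2) * sq_L2_norm \<Omega> (\<lambda>x. f x - u x)
     + ereal \<beta> * radon_norm \<Omega> (dist_deriv (weak_deriv \<Omega> u))"

end

(*
Write g = f - u for a minimiser (u, w). Comparing the energy at (u, w) with the energy at
(u + t phi, w + t psi) shows that the function V with V'' = g and V = V' = 0 at both end points
satisfies |V| <= beta: take psi a unit step and phi its primitive. As g is bounded in L^2 by
the energy of (0, 0), interpolation gives |V'| <= alpha / 2 once beta is small. Moving u towards
the primitive of w then costs at most half of alpha * |Du - w| in the fidelity term and gains all of
it in the penalty, so Du = w. For the last claim, pairing g with a competitor v gives at
most beta * |D^2 v| because |V| <= beta, with equality at v = u by scaling (u, w), so u minimises
the strictly convex second-order energy. No representing measure for D^2 v is needed.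
*)

theory Submission
  imports Defs "HOL-Real_Asymp.Real_Asymp"
begin

subsection \<open>Test functions\<close>

text \<open>All norms are suprema over smooth functions with compact support in the open interval,
  but the dual pair \<open>V\<close>, \<open>G = V'\<close> is only C^1, respectively continuous,
  and may live up to the end points. So each duality estimate passes through test functions that
  nearly keep both sup bounds and whose derivatives converge pointwise to \<open>G\<close>. A BV
  function is almost everywhere a constant plus a difference of distribution functions, so Fubini
  turns its pairing with g into integrals of \<open>G\<close> against two measures, where dominated
  convergence applies. That \<open>V\<close> vanishes to first order at both ends is itself an
  optimality condition: the variations (1, 0) and (x - a, 1) leave both penalties unchanged, so g
  has zero mean and zero first moment. The threshold is \<alpha>^3 / (128 (S + 1)) with S the
  integral of f^2: if |G| exceeded \<alpha>/2 at a point, it would stay at least \<alpha>/4 along a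
  step of length \<alpha>^2 / (16 (S + 1)), and V would have to move by more than 2 \<beta>. Since
  \<open>ac_density\<close> is an arbitrary choice, identifying it with w rests on uniqueness of the
  Lebesgue decomposition.\<close>

definition smooth :: "(real \<Rightarrow> real) \<Rightarrow> bool" where
  "smooth f \<longleftrightarrow> (\<forall>n. (deriv ^^ n) f differentiable_on UNIV)"

text \<open>A set of functions closed under differentiation contains every iterated derivative of
  its members, so smoothness can be shown without a formula for the \<open>n\<close>-th
  derivative.\<close>

lemma smooth_coinduct:
  assumes "f \<in> S"
    and step: "\<And>g. g \<in> S \<Longrightarrow> \<exists>h\<in>S. \<forall>x. (g has_real_derivative h x) (at x)"
  shows "smooth f"
proof -
  have der: "deriv g \<in> S \<and> g differentiable_on UNIV" if g: "g \<in> S" for g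
  proof -
    obtain h where h: "h \<in> S" "\<And>x. (g has_real_derivative h x) (at x)"
      using step[OF g] by blast
    have "deriv g = h" using h(2) by (intro ext DERIV_imp_deriv)
    moreover have "g differentiable_on UNIV"
      unfolding differentiable_on_def using h(2)
      by (auto simp: real_differentiable_def)
    ultimately show ?thesis using h(1) by simp
  qed
  have "(deriv ^^ n) f \<in> S" for n
    by (induction n) (use \<open>f \<in> S\<close> der in auto)
  then show ?thesis unfolding smooth_def using der by blast
qed

lemma smooth_has_deriv: "smooth f \<Longrightarrow> (f has_real_derivative deriv f x) (at x)"
proof -
  assume "smooth f"
  then have "f differentiable_on UNIV" unfolding smooth_def by (metis funpow_0)
  then have "f differentiable (at x)" by (auto simp: differentiable_on_def)
  then show ?thesis by (metis DERIV_imp_deriv real_differentiable_def)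
qed

lemma smooth_deriv: "smooth f \<Longrightarrow> smooth (deriv f)"
  unfolding smooth_def by (metis funpow_Suc_right comp_def)

lemma smooth_antideriv:
  assumes "smooth g" "\<And>x. (f has_real_derivative g x) (at x)"
  shows "smooth f"
proof (rule smooth_coinduct[where S = "insert f (Collect smooth)"])
  fix h assume "h \<in> insert f (Collect smooth)"
  then show "\<exists>k\<in>insert f (Collect smooth). \<forall>x. (h has_real_derivative k x) (at x)"
    using assms smooth_has_deriv smooth_deriv by blast
qed simp

lemma smooth_lincomb:
  assumes "smooth f" "smooth g"
  shows "smooth (\<lambda>x. c * f x + d * g x)"
proof (rule smooth_coinduct[where S = "{\<lambda>x. c * f x + d * g x |f g. smooth f \<and> smooth g}"])
  fix h assume "h \<in> {\<lambda>x. c * f x + d * g x |f g. smooth f \<and> smooth g}"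
  then obtain f g where h: "h = (\<lambda>x. c * f x + d * g x)" and s: "smooth f" "smooth g" by blast
  show "\<exists>k\<in>{\<lambda>x. c * f x + d * g x |f g. smooth f \<and> smooth g}.
      \<forall>x. (h has_real_derivative k x) (at x)"
    by (rule bexI[where x = "\<lambda>x. c * deriv f x + d * deriv g x"])
       (use s smooth_deriv in \<open>auto simp: h intro!: derivative_eq_intros smooth_has_deriv\<close>)
qed (use assms in auto)

text \<open>The classical flat function \<open>exp (- 1 / s)\<close>, cut off where
  \<open>s \<le> 0\<close>. The factor \<open>p / s ^ k\<close> makes the family closed under
  differentiation, and a polynomial \<open>s\<close> with chosen roots places the support.\<close>

definition bump :: "real poly \<Rightarrow> real poly \<Rightarrow> nat \<Rightarrow> real \<Rightarrow> real" where
  "bump s p k x =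
     (if poly s x > 0 then poly p x / poly s x ^ k * exp (- (1 / poly s x)) else 0)"

text \<open>The inequality \<open>(1 + y / n) ^ n \<le> exp y\<close> with \<open>y = 1 / s\<close>
  and \<open>n = k + 2\<close> beats the pole of order \<open>k\<close> with two powers of
  \<open>s\<close> to spare. At a zero of \<open>s\<close> a difference quotient consumes one of
  them and the other sends it to 0.\<close>

lemma exp_neg_inverse_bound:
  fixes s :: real
  assumes "s > 0"
  shows "exp (- (1 / s)) / s ^ k \<le> real (k + 2) ^ (k + 2) * s\<^sup>2"
proof -
  let ?n = "k + 2"
  have "(1 / s / ?n) ^ ?n \<le> (1 + 1 / s / ?n) ^ ?n"
    using assms by (intro power_mono) auto
  also have "\<dots> \<le> exp (1 / s)"
    using assms by (intro exp_ge_one_plus_x_over_n_power_n) (auto simp: field_simps intro: order_trans[of _ 0])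
  finally have "1 / (s ^ ?n * real ?n ^ ?n) \<le> exp (1 / s)"
    by (simp only: power_divide power_one divide_divide_eq_left power_mult_distrib)
  then have "1 \<le> exp (1 / s) * (s ^ ?n * real ?n ^ ?n)"
    using assms by (subst (asm) pos_divide_le_eq) auto
  then have "exp (- (1 / s)) \<le> s ^ ?n * real ?n ^ ?n"
    by (simp add: exp_minus field_simps)
  then have "exp (- (1 / s)) / s ^ k \<le> s ^ ?n * real ?n ^ ?n / s ^ k"
    using assms by (intro divide_right_mono) auto
  also have "\<dots> = real ?n ^ ?n * s\<^sup>2"
    using assms by (simp add: power_add power2_eq_square)
  finally show ?thesis .
qed

text \<open>The polynomial is the numerator of the derivative over the common denominator
  \<open>s ^ (k + 2)\<close>. The rules of calculus cover \<open>s > 0\<close>, and where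
  \<open>s < 0\<close> the function is locally zero; the delicate points are the roots of
  \<open>s\<close>.\<close>

lemma bump_has_deriv:
  "(bump s p k has_real_derivative
     bump s (pderiv p * s * s - smult (real k) (p * pderiv s * s) + p * pderiv s) (k + 2) x) (at x)"
    (is "(_ has_real_derivative bump s ?q _ x) _")
proof -
  have cont: "open {y. poly s y > 0}" "open {y. poly s y < 0}"
    by (auto intro!: open_Collect_less continuous_intros)
  consider "poly s x > 0" | "poly s x < 0" | "poly s x = 0" by linarith
  then show ?thesis
  proof cases
    case 1
    let ?f = "\<lambda>x. poly p x / poly s x ^ k * exp (- (1 / poly s x))"
    have "(?f has_real_derivative bump s ?q (k + 2) x) (at x)"
    proof (cases k)
      case 0
      then show ?thesis using 1
        by (auto intro!: derivative_eq_intros simp: bump_def field_simps power2_eq_square)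
    next
      case (Suc m)
      have "(?f has_real_derivative
          (poly (pderiv p) x * poly s x ^ k - poly p x * (real k * poly s x ^ m * poly (pderiv s) x))
              / (poly s x ^ k * poly s x ^ k) * exp (- (1 / poly s x))
          + poly p x / poly s x ^ k * (exp (- (1 / poly s x)) * (poly (pderiv s) x / (poly s x)\<^sup>2))) (at x)"
      proof -
        have pw: "((\<lambda>x. poly s x ^ k) has_real_derivative real k * poly s x ^ m * poly (pderiv s) x) (at x)"
          unfolding Suc using DERIV_power_Suc[OF poly_DERIV[of s x], of m] by (simp add: mult_ac)
        have ex: "((\<lambda>x. exp (- (1 / poly s x))) has_real_derivative
            exp (- (1 / poly s x)) * (poly (pderiv s) x / (poly s x)\<^sup>2)) (at x)"
          using 1 by (auto intro!: derivative_eq_intros simp: power2_eq_square)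
        show ?thesis
          using 1 DERIV_mult[OF DERIV_divide[OF poly_DERIV[of p x] pw] ex] by (simp add: mult_ac)
      qed
      also have "(poly (pderiv p) x * poly s x ^ k - poly p x * (real k * poly s x ^ m * poly (pderiv s) x))
              / (poly s x ^ k * poly s x ^ k) * exp (- (1 / poly s x))
          + poly p x / poly s x ^ k * (exp (- (1 / poly s x)) * (poly (pderiv s) x / (poly s x)\<^sup>2))
          = bump s ?q (k + 2) x"
        using 1 Suc by (simp add: bump_def field_simps power2_eq_square)
      finally show ?thesis .
    qed
    then show ?thesis
      by (rule has_field_derivative_transform_within_open[OF _ cont(1)]) (use 1 in \<open>auto simp: bump_def\<close>)
  next
    case 2
    have "((\<lambda>_. 0) has_real_derivative 0) (at x)" by simp
    then have "(bump s p k has_real_derivative 0) (at x)"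
      by (rule has_field_derivative_transform_within_open[OF _ cont(2)]) (use 2 in \<open>auto simp: bump_def\<close>)
    then show ?thesis using 2 by (simp add: bump_def)
  next
    case 3
    \<comment> \<open>Splitting off the linear factor turns the bound by \<open>s ^ 2\<close> into
      one by \<open>(y - x) ^ 2\<close>, which still tends to 0 after division by
      \<open>y - x\<close>.\<close>
    obtain r where r: "s = [:- x, 1:] * r" using 3 by (metis dvdE poly_eq_0_iff_dvd)
    define C where "C = real (k + 2) ^ (k + 2)"
    have bnd: "\<bar>bump s p k y\<bar> \<le> \<bar>poly p y\<bar> * (C * (poly s y)\<^sup>2)" for y
    proof (cases "poly s y > 0")
      case True
      then have "\<bar>bump s p k y\<bar> = \<bar>poly p y\<bar> * (exp (- (1 / poly s y)) / poly s y ^ k)"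
        by (simp add: bump_def abs_mult)
      also have "\<dots> \<le> \<bar>poly p y\<bar> * (C * (poly s y)\<^sup>2)"
        unfolding C_def by (intro mult_left_mono exp_neg_inverse_bound True) simp
      finally show ?thesis .
    qed (simp add: bump_def C_def)
    have lim: "((\<lambda>y. \<bar>poly p y\<bar> * (C * (\<bar>y - x\<bar> * (poly r y)\<^sup>2))) \<longlongrightarrow> 0) (at x)"
      by (rule tendsto_eq_intros refl | simp)+
    have "((\<lambda>y. (bump s p k y - bump s p k x) / (y - x)) \<longlongrightarrow> 0) (at x)"
    proof (rule Lim_null_comparison[OF _ lim], rule always_eventually, intro allI)
      fix y
      have "\<bar>bump s p k y\<bar> / \<bar>y - x\<bar> \<le> \<bar>poly p y\<bar> * (C * (poly s y)\<^sup>2) / \<bar>y - x\<bar>"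
        by (intro divide_right_mono bnd) simp
      also have "\<dots> = \<bar>poly p y\<bar> * (C * (\<bar>y - x\<bar> * (poly r y)\<^sup>2))"
      proof -
        have "poly s y = (y - x) * poly r y" by (simp add: r algebra_simps)
        then have "(poly s y)\<^sup>2 = \<bar>y - x\<bar> * \<bar>y - x\<bar> * (poly r y)\<^sup>2"
          by (simp only: power_mult_distrib abs_mult_self_eq power2_eq_square mult_ac)
        moreover have "A * A * B / A = A * B" for A B :: real by simp
        ultimately have "(poly s y)\<^sup>2 / \<bar>y - x\<bar> = \<bar>y - x\<bar> * (poly r y)\<^sup>2"
          by (simp only:)
        then show ?thesis by (simp only: times_divide_eq_right [symmetric])
      qed
      finally show "norm ((bump s p k y - bump s p k x) / (y - x)) \<le> \<bar>poly p y\<bar> * (C * (\<bar>y - x\<bar> * (poly r y)\<^sup>2))"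
        using 3 by (simp add: bump_def)
    qed
    then show ?thesis using 3 by (simp add: has_field_derivative_iff bump_def)
  qed
qed

lemma smooth_bump: "smooth (bump s p k)"
  by (rule smooth_coinduct[where S = "range (\<lambda>(p, k). bump s p k)"])
     (use bump_has_deriv in \<open>fastforce+\<close>)

section \<open>Test functions on a bounded open interval\<close>

locale open_interval =
  fixes a b :: real and \<Omega> :: "real set"
  assumes ab: "a < b" and \<Omega>: "\<Omega> = {a<..<b}"
begin

abbreviation L where "L \<equiv> lebesgue_on \<Omega>"

lemma test_functions_iff:
  "v \<in> test_functions \<Omega> \<longleftrightarrow>
     smooth v \<and> (\<exists>c d. a < c \<and> c < d \<and> d < b \<and> (\<forall>x. x \<notin> {c..d} \<longrightarrow> v x = 0))"
proof
  let ?K = "closure {x. v x \<noteq> 0}"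
  assume v: "v \<in> test_functions \<Omega>"
  then have s: "smooth v" and K: "compact ?K" "?K \<subseteq> {a<..<b}"
    by (auto simp: test_functions_def smooth_def \<Omega>)
  have "\<exists>c d. a < c \<and> c < d \<and> d < b \<and> ?K \<subseteq> {c..d}"
  proof (cases "?K = {}")
    case True
    have "a < (2 * a + b) / 3" "(2 * a + b) / 3 < (a + 2 * b) / 3" "(a + 2 * b) / 3 < b"
      using ab by auto
    then show ?thesis unfolding True by blast
  next
    case False
    obtain c where c: "c \<in> ?K" "\<And>x. x \<in> ?K \<Longrightarrow> c \<le> x"
      using compact_attains_inf[OF K(1) False] by metis
    obtain d where d: "d \<in> ?K" "\<And>x. x \<in> ?K \<Longrightarrow> x \<le> d"
      using compact_attains_sup[OF K(1) False] by metis
    have cd: "a < c" "c \<le> d" "d < b" using subsetD[OF K(2) c(1)] subsetD[OF K(2) d(1)] c(2)[OF d(1)]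
      by (simp_all only: greaterThanLessThan_iff)
    \<comment> \<open>The extrema only give \<open>c \<le> d\<close>; the midpoint of
      \<open>d\<close> and \<open>b\<close> as right end makes the interval nondegenerate and keeps
      it inside.\<close>
    have "?K \<subseteq> {c..(d + b) / 2}"
    proof
      fix x assume "x \<in> ?K"
      then have "c \<le> x" "x \<le> d" using c(2) d(2) by blast+
      with cd show "x \<in> {c..(d + b) / 2}" by simp
    qed
    then show ?thesis using cd by (intro exI[of _ c] exI[of _ "(d + b) / 2"]) auto
  qed
  then obtain c d where cd: "a < c" "c < d" "d < b" "?K \<subseteq> {c..d}" by blast
  have "v x = 0" if "x \<notin> {c..d}" for x
    using that cd(4) closure_subset[of "{x. v x \<noteq> 0}"] by blast
  with s cd show "smooth v \<and> (\<exists>c d. a < c \<and> c < d \<and> d < b \<and> (\<forall>x. x \<notin> {c..d} \<longrightarrow> v x = 0))"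
    by blast
next
  assume "smooth v \<and> (\<exists>c d. a < c \<and> c < d \<and> d < b \<and> (\<forall>x. x \<notin> {c..d} \<longrightarrow> v x = 0))"
  then obtain c d where s: "smooth v" and cd: "a < c" "c < d" "d < b" "\<And>x. x \<notin> {c..d} \<Longrightarrow> v x = 0"
    by blast
  have sub: "closure {x. v x \<noteq> 0} \<subseteq> {c..d}"
  proof (rule closure_minimal)
    show "{x. v x \<noteq> 0} \<subseteq> {c..d}" using cd(4) by blast
  qed simp
  then have "compact (closure {x. v x \<noteq> 0})"
    by (metis closed_closure compact_Icc compact_Int_closed inf.absorb_iff2)
  moreover have "{c..d} \<subseteq> \<Omega>" using cd by (auto simp: \<Omega>)
  ultimately show "v \<in> test_functions \<Omega>"
    using s sub unfolding test_functions_def smooth_def by blast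
qed

lemma test_lincomb:
  assumes "v \<in> test_functions \<Omega>" "w \<in> test_functions \<Omega>"
  shows "(\<lambda>x. r * v x + t * w x) \<in> test_functions \<Omega>"
proof -
  obtain c d where 1: "smooth v" "a < c" "c < d" "d < b" "\<And>x. x \<notin> {c..d} \<Longrightarrow> v x = 0"
    using assms(1) by (auto simp: test_functions_iff)
  obtain c' d' where 2: "smooth w" "a < c'" "c' < d'" "d' < b" "\<And>x. x \<notin> {c'..d'} \<Longrightarrow> w x = 0"
    using assms(2) by (auto simp: test_functions_iff)
  have "r * v x + t * w x = 0" if "x \<notin> {min c c'..max d d'}" for x
    using that 1(5)[of x] 2(5)[of x] by (auto simp: min_def max_def split: if_splits)
  moreover have "a < min c c'" "min c c' < max d d'" "max d d' < b" using 1 2 by auto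
  ultimately show ?thesis
    unfolding test_functions_iff using smooth_lincomb[OF 1(1) 2(1)] by blast
qed

lemma test_scale: "v \<in> test_functions \<Omega> \<Longrightarrow> (\<lambda>x. r * v x) \<in> test_functions \<Omega>"
  using test_lincomb[of v v r 0] by simp

lemma test_zero: "(\<lambda>x. 0) \<in> test_functions \<Omega>"
proof -
  have "smooth (\<lambda>x. 0)" by (rule smooth_coinduct[where S = "{\<lambda>x. 0}"]) auto
  moreover have "a < (2 * a + b) / 3" "(2 * a + b) / 3 < (a + 2 * b) / 3" "(a + 2 * b) / 3 < b"
    using ab by auto
  ultimately show ?thesis unfolding test_functions_iff by blast
qed

lemma test_has_deriv: "v \<in> test_functions \<Omega> \<Longrightarrow> (v has_real_derivative deriv v x) (at x)"
  using smooth_has_deriv test_functions_iff by blast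

lemma test_deriv:
  assumes "v \<in> test_functions \<Omega>"
  shows "deriv v \<in> test_functions \<Omega>"
proof -
  obtain c d where cd: "smooth v" "a < c" "c < d" "d < b" "\<And>x. x \<notin> {c..d} \<Longrightarrow> v x = 0"
    using assms by (auto simp: test_functions_iff)
  have "deriv v x = 0" if "x \<notin> {c..d}" for x
  proof (rule DERIV_imp_deriv)
    have "((\<lambda>_. 0) has_real_derivative 0) (at x)" by simp
    then show "(v has_real_derivative 0) (at x)"
      by (rule has_field_derivative_transform_within_open[of _ _ _ "- {c..d}"])
         (use that cd(5) in auto)
  qed
  then show ?thesis unfolding test_functions_iff using cd smooth_deriv by blast
qed

lemma test_continuous: "v \<in> test_functions \<Omega> \<Longrightarrow> continuous_on S v"
  by (meson DERIV_isCont continuous_at_imp_continuous_on test_has_deriv)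

lemma test_measurable[measurable]: "v \<in> test_functions \<Omega> \<Longrightarrow> v \<in> borel_measurable borel"
  using test_continuous borel_measurable_continuous_onI by blast

lemma test_bounded:
  assumes "v \<in> test_functions \<Omega>"
  obtains C where "C > 0" "\<And>x. \<bar>v x\<bar> \<le> C"
proof -
  obtain c d where cd: "c < d" "\<And>x. x \<notin> {c..d} \<Longrightarrow> v x = 0"
    using assms by (auto simp: test_functions_iff)
  have "bounded (v ` {c..d})"
    using assms by (intro compact_imp_bounded compact_continuous_image test_continuous) auto
  then obtain C where C: "C > 0" "\<And>x. x \<in> {c..d} \<Longrightarrow> \<bar>v x\<bar> \<le> C"
    unfolding bounded_pos by auto
  have "\<bar>v x\<bar> \<le> C" for x using C cd(2)[of x] by (cases "x \<in> {c..d}") auto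
  with C(1) that show ?thesis by blast
qed

lemma test_outside: "v \<in> test_functions \<Omega> \<Longrightarrow> x \<notin> \<Omega> \<Longrightarrow> v x = 0"
proof -
  assume "v \<in> test_functions \<Omega>" "x \<notin> \<Omega>"
  then obtain c d where "a < c" "d < b" "\<And>x. x \<notin> {c..d} \<Longrightarrow> v x = 0"
    by (auto simp: test_functions_iff)
  then show ?thesis using \<open>x \<notin> \<Omega>\<close> by (auto simp: \<Omega>)
qed

text \<open>Since \<open>(y - c) (d - y) > 0\<close> only between \<open>c\<close> and \<open>d\<close>, the bump is supported there.\<close>

lemma bump_test:
  assumes "a < c" "c < d" "d < b" "t > 0"
  shows "bump (smult t ([:- c, 1:] * [:d, - 1:])) p k \<in> test_functions \<Omega>"
proof -
  have "bump (smult t ([:- c, 1:] * [:d, - 1:])) p k x = 0" if "x \<notin> {c..d}" for x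
  proof -
    have "(x - c) * (d - x) \<le> 0" using that assms by (auto simp: mult_le_0_iff)
    then have "t * ((x - c) * (d - x)) \<le> 0" using assms(4) by (simp add: mult_le_0_iff)
    then show ?thesis by (simp add: bump_def algebra_simps)
  qed
  with assms smooth_bump show ?thesis unfolding test_functions_iff by blast
qed

text \<open>With \<open>q = (y - c n) * (d n - y)\<close> the bump is
  \<open>exp (- 1 / ((n + 1) * q))\<close>, which tends to 1 as long as \<open>q\<close> stays away
  from 0. The ends \<open>c n\<close> and \<open>d n\<close> approach \<open>x\<close> and
  \<open>b\<close> from inside, so points \<open>y \<le> x\<close> are never reached, whence the
  strict half-line.\<close>

lemma indicator_approx:
  assumes "a \<le> x" "x < b"
  obtains v :: "nat \<Rightarrow> real \<Rightarrow> real" where "\<And>n. v n \<in> test_functions \<Omega>" "\<And>n y. \<bar>v n y\<bar> \<le> 1"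
    "\<And>y. y \<in> \<Omega> \<Longrightarrow> (\<lambda>n. v n y) \<longlonglongrightarrow> indicator {x<..} y"
proof
  \<comment> \<open>The summand 3 keeps each margin at most a third of the length, so
    \<open>c n < d n\<close> from \<open>n = 0\<close> on.\<close>
  define c where "c n = x + (b - x) / (real n + 3)" for n
  define d where "d n = b - (b - x) / (real n + 3)" for n
  define v where "v n = bump (smult (real n + 1) ([:- c n, 1:] * [:d n, - 1:])) 1 0" for n
  have e: "(b - x) / (real n + 3) > 0" "(b - x) / (real n + 3) \<le> (b - x) / 3" for n
  proof -
    show "(b - x) / (real n + 3) \<le> (b - x) / 3"
      using assms by (intro divide_left_mono) auto
  qed (use assms in auto)
  have cd: "x < c n" "c n < d n" "d n < b" for n
  proof -
    define q where "q = (b - x) / (real n + 3)"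
    have q: "q > 0" "q * 3 \<le> b - x" using e(1)[of n] e(2)[of n] unfolding q_def[symmetric] by simp_all
    show "x < c n" "d n < b" using q unfolding c_def d_def q_def[symmetric] by simp_all
    show "c n < d n" using q assms unfolding c_def d_def q_def[symmetric] by linarith
  qed
  show "v n \<in> test_functions \<Omega>" for n
    unfolding v_def using cd assms by (intro bump_test) (auto intro: le_less_trans)
  show "\<bar>v n y\<bar> \<le> 1" for n y by (simp add: v_def bump_def)
  have v: "v n y = (if (real n + 1) * ((y - c n) * (d n - y)) > 0
      then exp (- (1 / ((real n + 1) * ((y - c n) * (d n - y))))) else 0)" for n y
    by (simp add: v_def bump_def algebra_simps)
  have lc: "c \<longlonglongrightarrow> x" and ld: "d \<longlonglongrightarrow> b" unfolding c_def d_def by real_asymp+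
  fix y assume y: "y \<in> \<Omega>"
  show "(\<lambda>n. v n y) \<longlonglongrightarrow> indicator {x<..} y"
  proof (cases "x < y")
    case True
    have l: "(\<lambda>n. (y - c n) * (d n - y)) \<longlonglongrightarrow> (y - x) * (b - y)"
      by (intro tendsto_intros lc ld)
    have pos: "(y - x) * (b - y) > 0" using True y by (simp add: \<Omega>)
    have "filterlim (\<lambda>n. real n + 1) at_top sequentially" by real_asymp
    then have top: "filterlim (\<lambda>n. (real n + 1) * ((y - c n) * (d n - y))) at_top sequentially"
      using filterlim_tendsto_pos_mult_at_top[OF l pos] by (simp add: mult.commute)
    then have "(\<lambda>n. inverse ((real n + 1) * ((y - c n) * (d n - y)))) \<longlonglongrightarrow> 0"
      by (rule tendsto_inverse_0_at_top)
    then have l1: "(\<lambda>n. exp (- inverse ((real n + 1) * ((y - c n) * (d n - y))))) \<longlonglongrightarrow> exp (- 0)"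
      by (intro tendsto_intros)
    have "\<forall>\<^sub>F n in sequentially. 0 < (real n + 1) * ((y - c n) * (d n - y))"
      using top unfolding filterlim_at_top_dense by blast
    then have l2: "\<forall>\<^sub>F n in sequentially. exp (- inverse ((real n + 1) * ((y - c n) * (d n - y)))) = v n y"
      by eventually_elim (simp add: v inverse_eq_divide)
    have "(\<lambda>n. v n y) \<longlonglongrightarrow> exp (- 0)"
      by (rule Lim_transform_eventually[OF l1 l2])
    then show ?thesis using True by simp
  next
    case False
    have "v n y = 0" for n
    proof -
      have "(y - c n) * (d n - y) \<le> 0" using False cd[of n] by (auto simp: mult_le_0_iff)
      then have "\<not> 0 < (real n + 1) * ((y - c n) * (d n - y))"
        by (simp add: mult_le_0_iff not_less)
      then show ?thesis by (simp only: v if_False)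
    qed
    then show ?thesis using False by simp
  qed
qed

end

subsection \<open>Linear combinations of measures and of functions of bounded variation\<close>

text \<open>\<open>ennreal\<close> truncates negative coefficients to 0, so this combines positive
  measures with nonnegative weights; signed combinations arise as differences of two such
  measures.\<close>

definition lincomb_measure :: "real \<Rightarrow> 'a measure \<Rightarrow> real \<Rightarrow> 'a measure \<Rightarrow> 'a measure" where
  "lincomb_measure r M t N =
     measure_of (space M) (sets M) (\<lambda>A. ennreal r * emeasure M A + ennreal t * emeasure N A)"

lemma space_lincomb_measure[simp]: "space (lincomb_measure r M t N) = space M"
  and sets_lincomb_measure[simp, measurable_cong]: "sets (lincomb_measure r M t N) = sets M"
  by (simp_all add: lincomb_measure_def)

lemma emeasure_lincomb_measure:
  assumes "sets N = sets M" "A \<in> sets M"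
  shows "emeasure (lincomb_measure r M t N) A = ennreal r * emeasure M A + ennreal t * emeasure N A"
  unfolding lincomb_measure_def
proof (rule emeasure_measure_of_sigma)
  show "sigma_algebra (space M) (sets M)" ..
  show "positive (sets M) (\<lambda>A. ennreal r * emeasure M A + ennreal t * emeasure N A)"
    by (simp add: positive_def)
  show "countably_additive (sets M) (\<lambda>A. ennreal r * emeasure M A + ennreal t * emeasure N A)"
    unfolding countably_additive_def
  proof (intro allI impI)
    fix A :: "nat \<Rightarrow> _"
    assume A: "range A \<subseteq> sets M" "disjoint_family A" "\<Union> (range A) \<in> sets M"
    have "(\<Sum>i. ennreal r * emeasure M (A i) + ennreal t * emeasure N (A i))
        = (\<Sum>i. ennreal r * emeasure M (A i)) + (\<Sum>i. ennreal t * emeasure N (A i))"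
      by (intro suminf_add[symmetric] summableI)
    also have "\<dots> = ennreal r * (\<Sum>i. emeasure M (A i)) + ennreal t * (\<Sum>i. emeasure N (A i))"
      by simp
    also have "(\<Sum>i. emeasure M (A i)) = emeasure M (\<Union> (range A))"
      using A by (intro suminf_emeasure) auto
    also have "(\<Sum>i. emeasure N (A i)) = emeasure N (\<Union> (range A))"
      using A assms(1) by (intro suminf_emeasure) auto
    finally show "(\<Sum>i. ennreal r * emeasure M (A i) + ennreal t * emeasure N (A i))
        = ennreal r * emeasure M (\<Union> (range A)) + ennreal t * emeasure N (\<Union> (range A))" .
  qed
qed fact

lemma nn_integral_lincomb_measure:
  assumes sets: "sets N = sets M" and "f \<in> borel_measurable M"
  shows "(\<integral>\<^sup>+x. f x \<partial>lincomb_measure r M t N)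
       = ennreal r * (\<integral>\<^sup>+x. f x \<partial>M) + ennreal t * (\<integral>\<^sup>+x. f x \<partial>N)"
proof -
  have N: "g \<in> borel_measurable N" if "g \<in> borel_measurable M" for g :: "_ \<Rightarrow> ennreal"
    using that measurable_cong_sets[OF sets refl] by blast
  have K: "g \<in> borel_measurable (lincomb_measure r M t N)" if "g \<in> borel_measurable M" for g :: "_ \<Rightarrow> ennreal"
    using that by simp
  have sp: "space N = space M" using sets by (rule sets_eq_imp_space_eq)
  from assms(2) show ?thesis
  proof (induct rule: borel_measurable_induct)
    case (cong f g)
    then show ?case
      using nn_integral_cong[of M f g] nn_integral_cong[of N f g]
        nn_integral_cong[of "lincomb_measure r M t N" f g] sp by simp
  next
    case (set A)
    then show ?case using sets by (simp add: emeasure_lincomb_measure)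
  next
    case (mult u c)
    then show ?case
      by (simp add: nn_integral_cmult N K algebra_simps)
  next
    case (add u v)
    then show ?case
      by (simp add: nn_integral_add N K algebra_simps)
  next
    case (seq U)
    have inc: "incseq (\<lambda>i. nn_integral M (U i))" "incseq (\<lambda>i. nn_integral N (U i))"
      using \<open>incseq U\<close> by (auto simp: incseq_def le_fun_def intro!: nn_integral_mono)
    have mono: "(\<integral>\<^sup>+x. (SUP i. U i) x \<partial>K) = (SUP i. nn_integral K (U i))"
      if "\<And>i. U i \<in> borel_measurable K" for K
      unfolding SUP_apply using nn_integral_monotone_convergence_SUP[OF \<open>incseq U\<close> that] .
    have "(\<integral>\<^sup>+x. (SUP i. U i) x \<partial>lincomb_measure r M t N)
        = (SUP i. nn_integral (lincomb_measure r M t N) (U i))"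
      by (rule mono[OF K[OF seq(1)]])
    also have "\<dots> = (SUP i. ennreal r * nn_integral M (U i) + ennreal t * nn_integral N (U i))"
      by (simp add: seq(3))
    also have "\<dots> = (SUP i. ennreal r * nn_integral M (U i)) + (SUP i. ennreal t * nn_integral N (U i))"
      using inc by (intro ennreal_SUP_add) (auto simp: incseq_def intro!: mult_left_mono)
    also have "\<dots> = ennreal r * (SUP i. nn_integral M (U i)) + ennreal t * (SUP i. nn_integral N (U i))"
      by (simp add: SUP_mult_left_ennreal)
    finally show ?case
      by (simp only: mono[OF seq(1)] mono[OF N[OF seq(1)]])
  qed
qed

lemma
  fixes f :: "'a \<Rightarrow> real"
  assumes sets: "sets N = sets M" and "r \<ge> 0" "t \<ge> 0"
    and f: "integrable M f" "integrable N f"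
  shows integrable_lincomb_measure: "integrable (lincomb_measure r M t N) f"
    and integral_lincomb_measure:
      "(\<integral>x. f x \<partial>lincomb_measure r M t N) = r * (\<integral>x. f x \<partial>M) + t * (\<integral>x. f x \<partial>N)"
proof -
  have mf: "f \<in> borel_measurable M" using f by auto
  have nn: "(\<integral>\<^sup>+x. ennreal (g x) \<partial>lincomb_measure r M t N)
      = ennreal r * (\<integral>\<^sup>+x. ennreal (g x) \<partial>M) + ennreal t * (\<integral>\<^sup>+x. ennreal (g x) \<partial>N)"
    if "g \<in> borel_measurable M" for g
    using that by (intro nn_integral_lincomb_measure sets) auto
  have fin: "(\<integral>\<^sup>+x. ennreal (h x) \<partial>K) < \<infinity>" if "integrable K h" for h and K :: "'a measure"
    using that by (auto simp: real_integrable_def top.not_eq_extremum)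
  show i: "integrable (lincomb_measure r M t N) f"
    unfolding real_integrable_def
    using mf nn[OF mf] nn[of "\<lambda>x. - f x"] fin[OF f(1)] fin[OF f(2)]
      fin[of M "\<lambda>x. - f x"] fin[of N "\<lambda>x. - f x"] f
    by (auto simp: ennreal_mult_eq_top_iff)
  have e: "enn2real (ennreal r * x + ennreal t * y) = r * enn2real x + t * enn2real y"
    if "x < \<infinity>" "y < \<infinity>" for x y
    using that assms(2,3) by (simp add: enn2real_plus ennreal_mult_less_top enn2real_mult)
  show "(\<integral>x. f x \<partial>lincomb_measure r M t N) = r * (\<integral>x. f x \<partial>M) + t * (\<integral>x. f x \<partial>N)"
    unfolding real_lebesgue_integral_def[OF i] real_lebesgue_integral_def[OF f(1)]
      real_lebesgue_integral_def[OF f(2)]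
    using mf fin[OF f(1)] fin[OF f(2)] fin[of M "\<lambda>x. - f x"] fin[of N "\<lambda>x. - f x"] f
    by (simp add: nn e algebra_simps)
qed

lemma integrable_mult_bounded:
  fixes u v :: "'a \<Rightarrow> real"
  assumes u: "integrable M u" and v: "v \<in> borel_measurable M" "AE x in M. \<bar>v x\<bar> \<le> C"
  shows "integrable M (\<lambda>x. u x * v x)"
proof (rule Bochner_Integration.integrable_bound)
  show "integrable M (\<lambda>x. C * u x)" using u by simp
  show "(\<lambda>x. u x * v x) \<in> borel_measurable M" using u v by simp
  show "AE x in M. norm (u x * v x) \<le> norm (C * u x)"
    using v(2)
  proof eventually_elim
    case (elim x)
    then have "\<bar>u x\<bar> * \<bar>v x\<bar> \<le> \<bar>u x\<bar> * \<bar>C\<bar>" by (intro mult_left_mono) auto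
    then show ?case by (simp add: abs_mult mult.commute)
  qed
qed

section \<open>Finite measures and BV functions on the interval\<close>

context open_interval
begin

lemma space_L[simp]: "space L = \<Omega>" by (simp add: space_restrict_space)

lemma \<Omega>_sets[simp, measurable]: "\<Omega> \<in> sets lebesgue" "\<Omega> \<in> sets borel" by (auto simp: \<Omega>)

lemma borel_measurable_L[measurable (raw)]: "v \<in> borel_measurable borel \<Longrightarrow> v \<in> borel_measurable L"
  by (intro measurable_restrict_space1) (simp add: measurable_completion)

sublocale L: finite_measure L
  by (rule finite_measure_lebesgue_on) (auto simp: \<Omega>)

lemma finite_borel_onD:
  assumes "finite_borel_on \<Omega> \<mu>"
  shows "finite_measure \<mu>" "sets \<mu> = sets (restrict_space borel \<Omega>)" "space \<mu> = \<Omega>"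
    and "v \<in> borel_measurable borel \<Longrightarrow> v \<in> borel_measurable \<mu>"
proof -
  show s: "finite_measure \<mu>" "sets \<mu> = sets (restrict_space borel \<Omega>)"
    using assms by (auto simp: finite_borel_on_def)
  then show "space \<mu> = \<Omega>"
    by (metis inf_top.right_neutral sets_eq_imp_space_eq space_borel space_restrict_space)
  show "v \<in> borel_measurable \<mu>" if "v \<in> borel_measurable borel"
    using measurable_restrict_space1[OF that, of \<Omega>] measurable_cong_sets[OF s(2) refl] by blast
qed

lemma bounded_integrable:
  assumes "finite_measure M" "v \<in> borel_measurable M" "\<And>x. \<bar>v x\<bar> \<le> C"
  shows "integrable M (v :: real \<Rightarrow> real)"
  using finite_measure.integrable_const_bound[OF assms(1), of v C] assms by auto

lemma test_integrable:
  assumes "finite_borel_on \<Omega> \<mu>" "v \<in> test_functions \<Omega>"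
  shows "integrable \<mu> v"
proof -
  obtain C where "\<And>x. \<bar>v x\<bar> \<le> C" using test_bounded[OF assms(2)] by blast
  then show ?thesis
    by (rule bounded_integrable[OF finite_borel_onD(1)[OF assms(1)]
          finite_borel_onD(4)[OF assms(1) test_measurable[OF assms(2)]]])
qed

lemma integrable_mult_test:
  assumes "integrable L u" "v \<in> test_functions \<Omega>"
  shows "integrable L (\<lambda>x. u x * v x)"
proof -
  obtain C where "\<And>x. \<bar>v x\<bar> \<le> C" using test_bounded[OF assms(2)] by blast
  with assms show ?thesis
    by (intro integrable_mult_bounded[of _ _ _ C]) auto
qed

lemma finite_borel_on_lincomb:
  assumes "finite_borel_on \<Omega> \<mu>" "finite_borel_on \<Omega> \<nu>"
  shows "finite_borel_on \<Omega> (lincomb_measure r \<mu> t \<nu>)"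
proof -
  note \<mu> = finite_borel_onD[OF assms(1)] and \<nu> = finite_borel_onD[OF assms(2)]
  have "emeasure (lincomb_measure r \<mu> t \<nu>) \<Omega> \<noteq> \<infinity>"
    using \<mu>(2,3) \<nu>(2,3) finite_measure.emeasure_finite[OF \<mu>(1), of \<Omega>]
      finite_measure.emeasure_finite[OF \<nu>(1), of \<Omega>]
    by (subst emeasure_lincomb_measure) (auto simp: sets_restrict_space ennreal_mult_eq_top_iff)
  then have "finite_measure (lincomb_measure r \<mu> t \<nu>)"
    using \<mu>(3) by (intro finite_measureI) simp
  then show ?thesis using \<mu>(2) by (simp add: finite_borel_on_def)
qed

lemma is_finite_radon_lincomb:
  assumes "is_finite_radon \<Omega> S" "is_finite_radon \<Omega> T"
  shows "is_finite_radon \<Omega> (\<lambda>v. c * S v + d * T v)"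
proof -
  obtain \<mu> \<nu> where S: "finite_borel_on \<Omega> \<mu>" "finite_borel_on \<Omega> \<nu>"
    "\<And>v. v \<in> test_functions \<Omega> \<Longrightarrow> S v = (\<integral>x. v x \<partial>\<mu>) - (\<integral>x. v x \<partial>\<nu>)"
    using assms(1) by (auto simp: is_finite_radon_def represented_by_def)
  obtain \<mu>' \<nu>' where T: "finite_borel_on \<Omega> \<mu>'" "finite_borel_on \<Omega> \<nu>'"
    "\<And>v. v \<in> test_functions \<Omega> \<Longrightarrow> T v = (\<integral>x. v x \<partial>\<mu>') - (\<integral>x. v x \<partial>\<nu>')"
    using assms(2) by (auto simp: is_finite_radon_def represented_by_def)
  have sets: "sets \<nu> = sets \<mu>" "sets \<mu>' = sets \<mu>" "sets \<nu>' = sets \<mu>"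
    using finite_borel_onD(2) S T by simp_all
  \<comment> \<open>\<open>\<sigma> c d\<close> collects the positive contributions to
    \<open>c * S + d * T\<close>: \<mu> weighted by the positive part of \<open>c\<close>, \<nu> by
    the negative part, and likewise for \<open>d\<close>. Flipping both signs gives the negative
    contributions.\<close>
  define \<sigma> where "\<sigma> r t = lincomb_measure 1 (lincomb_measure (max 0 r) \<mu> (max 0 (- r)) \<nu>)
       1 (lincomb_measure (max 0 t) \<mu>' (max 0 (- t)) \<nu>')" for r t
  have fin: "finite_borel_on \<Omega> (\<sigma> r t)" for r t
    unfolding \<sigma>_def using S T by (intro finite_borel_on_lincomb)
  have int: "(\<integral>x. v x \<partial>\<sigma> r t) = max 0 r * (\<integral>x. v x \<partial>\<mu>) + max 0 (- r) * (\<integral>x. v x \<partial>\<nu>)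
      + (max 0 t * (\<integral>x. v x \<partial>\<mu>') + max 0 (- t) * (\<integral>x. v x \<partial>\<nu>'))"
    if v: "v \<in> test_functions \<Omega>" for v r t
  proof -
    note i = test_integrable[OF S(1) v] test_integrable[OF S(2) v]
      test_integrable[OF T(1) v] test_integrable[OF T(2) v]
    show ?thesis
      unfolding \<sigma>_def
      by (subst integral_lincomb_measure integrable_lincomb_measure;
          (simp add: sets integrable_lincomb_measure integral_lincomb_measure i)?)+
  qed
  have "c * S v + d * T v = (\<integral>x. v x \<partial>\<sigma> c d) - (\<integral>x. v x \<partial>\<sigma> (- c) (- d))"
    if "v \<in> test_functions \<Omega>" for v
    unfolding int[OF that] S(3)[OF that] T(3)[OF that]
    by (cases "c \<ge> 0"; cases "d \<ge> 0") (simp_all add: max_def algebra_simps)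
  then show ?thesis
    unfolding is_finite_radon_def represented_by_def using fin by blast
qed

lemma is_finite_radon_cong:
  "\<lbrakk>is_finite_radon \<Omega> S; \<And>v. v \<in> test_functions \<Omega> \<Longrightarrow> T v = S v\<rbrakk> \<Longrightarrow> is_finite_radon \<Omega> T"
  unfolding is_finite_radon_def represented_by_def by simp

lemma dist_of_lincomb:
  assumes "integrable L u" "integrable L w" "v \<in> test_functions \<Omega>"
  shows "dist_of \<Omega> (\<lambda>x. c * u x + d * w x) v = c * dist_of \<Omega> u v + d * dist_of \<Omega> w v"
  using integrable_mult_test[OF assms(1,3)] integrable_mult_test[OF assms(2,3)]
  by (simp add: dist_of_def distrib_right mult.assoc)

lemma weak_deriv_lincomb:
  assumes "integrable L u" "integrable L w" "v \<in> test_functions \<Omega>"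
  shows "weak_deriv \<Omega> (\<lambda>x. c * u x + d * w x) v = c * weak_deriv \<Omega> u v + d * weak_deriv \<Omega> w v"
  using dist_of_lincomb[OF assms(1,2) test_deriv[OF assms(3)]]
  by (simp add: weak_deriv_def dist_deriv_def)

lemma BV_integrable: "u \<in> BV \<Omega> \<Longrightarrow> integrable L u"
  by (simp add: BV_def)

lemma BV_lincomb:
  assumes "u \<in> BV \<Omega>" "w \<in> BV \<Omega>"
  shows "(\<lambda>x. c * u x + d * w x) \<in> BV \<Omega>"
proof -
  have "is_finite_radon \<Omega> (weak_deriv \<Omega> (\<lambda>x. c * u x + d * w x))"
  proof (rule is_finite_radon_cong)
    show "is_finite_radon \<Omega> (\<lambda>v. c * weak_deriv \<Omega> u v + d * weak_deriv \<Omega> w v)"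
      using assms by (intro is_finite_radon_lincomb) (auto simp: BV_def)
  qed (intro weak_deriv_lincomb BV_integrable assms)
  then show ?thesis using assms by (simp add: BV_def)
qed

end

subsection \<open>Primitives and the determination of measures by test functions\<close>

text \<open>Both sides integrate \<open>g x * h y\<close> over \<open>y \<le> x\<close>; the closed
  half-lines \<open>{..x}\<close> and \<open>{y..}\<close> treat atoms on the diagonal alike. Two
  independent measures are kept because either may be Lebesgue measure or a measure representing a
  derivative.\<close>

lemma
  fixes M N :: "real measure" and g h :: "real \<Rightarrow> real"
  assumes "finite_measure M" "finite_measure N"
    and id[measurable]: "(\<lambda>x. x) \<in> borel_measurable M" "(\<lambda>x. x) \<in> borel_measurable N"
    and g: "integrable M g" and h: "integrable N h"
  shows primitive_measurable: "(\<lambda>x. \<integral>y. h y * indicator {..x} y \<partial>N) \<in> borel_measurable M"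
    and primitive_Fubini:
      "(\<integral>x. g x * (\<integral>y. h y * indicator {..x} y \<partial>N) \<partial>M)
        = (\<integral>y. h y * (\<integral>x. g x * indicator {y..} x \<partial>M) \<partial>N)"
proof -
  interpret M: finite_measure M by fact
  interpret N: finite_measure N by fact
  interpret pair_sigma_finite M N ..
  have [measurable]: "g \<in> borel_measurable M" "h \<in> borel_measurable N" using g h by auto
  \<comment> \<open>As a case distinction on \<open>y \<le> x\<close> the kernel is visibly
    measurable jointly in both variables.\<close>
  have ind: "indicator {..x} y = (if y \<le> x then 1 else 0 :: real)"
    "indicator {y..} x = (if y \<le> x then 1 else 0 :: real)" for x y :: real
    by auto
  show meas[measurable]: "(\<lambda>x. \<integral>y. h y * indicator {..x} y \<partial>N) \<in> borel_measurable M"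
    unfolding ind by measurable
  let ?f = "\<lambda>x y. g x * h y * (if y \<le> x then 1 else 0)"
  have int: "integrable (M \<Otimes>\<^sub>M N) (\<lambda>(x, y). ?f x y)"
  proof (rule Fubini_integrable)
    show "(\<lambda>(x, y). ?f x y) \<in> borel_measurable (M \<Otimes>\<^sub>M N)" by measurable
    have hi: "integrable N (\<lambda>y. h y * (if y \<le> x then 1 else 0))" for x
      by (rule Bochner_Integration.integrable_bound[OF h]) auto
    show "AE x in M. integrable N (\<lambda>y. case (x, y) of (x, y) \<Rightarrow> ?f x y)"
      using hi by (simp add: mult.assoc)
    show "integrable M (\<lambda>x. \<integral>y. norm (case (x, y) of (x, y) \<Rightarrow> ?f x y) \<partial>N)"
    proof (rule Bochner_Integration.integrable_bound)
      show "integrable M (\<lambda>x. g x * (\<integral>y. \<bar>h y\<bar> \<partial>N))" using g by simp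
      show "(\<lambda>x. \<integral>y. norm (case (x, y) of (x, y) \<Rightarrow> ?f x y) \<partial>N) \<in> borel_measurable M"
        by measurable
      show "AE x in M. norm (\<integral>y. norm (case (x, y) of (x, y) \<Rightarrow> ?f x y) \<partial>N)
          \<le> norm (g x * (\<integral>y. \<bar>h y\<bar> \<partial>N))"
      proof (intro always_eventually allI)
        fix x
        have "(\<integral>y. \<bar>h y * (if y \<le> x then 1 else 0)\<bar> \<partial>N) \<le> (\<integral>y. \<bar>h y\<bar> \<partial>N)"
          using hi h by (intro integral_mono) auto
        then have "\<bar>g x\<bar> * (\<integral>y. \<bar>h y * (if y \<le> x then 1 else 0)\<bar> \<partial>N) \<le> \<bar>g x\<bar> * (\<integral>y. \<bar>h y\<bar> \<partial>N)"
          by (intro mult_left_mono) auto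
        moreover have "(\<integral>y. norm (case (x, y) of (x, y) \<Rightarrow> ?f x y) \<partial>N)
            = \<bar>g x\<bar> * (\<integral>y. \<bar>h y * (if y \<le> x then 1 else 0)\<bar> \<partial>N)"
          by (simp add: abs_mult mult.assoc)
        moreover have "(\<integral>y. \<bar>h y * (if y \<le> x then 1 else 0)\<bar> \<partial>N) \<ge> 0" "(\<integral>y. \<bar>h y\<bar> \<partial>N) \<ge> 0"
          by simp_all
        ultimately show "norm (\<integral>y. norm (case (x, y) of (x, y) \<Rightarrow> ?f x y) \<partial>N)
          \<le> norm (g x * (\<integral>y. \<bar>h y\<bar> \<partial>N))"
          by (simp add: abs_mult)
      qed
    qed
  qed
  have "(\<integral>x. g x * (\<integral>y. h y * indicator {..x} y \<partial>N) \<partial>M) = (\<integral>x. (\<integral>y. ?f x y \<partial>N) \<partial>M)"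
    by (simp add: ind mult.assoc)
  also have "\<dots> = (\<integral>y. (\<integral>x. ?f x y \<partial>M) \<partial>N)"
    using Fubini_integral[OF int] by simp
  also have "\<dots> = (\<integral>y. h y * (\<integral>x. g x * indicator {y..} x \<partial>M) \<partial>N)"
  proof (rule Bochner_Integration.integral_cong)
    fix y
    have "(\<integral>x. ?f x y \<partial>M) = (\<integral>x. h y * (g x * indicator {y..} x) \<partial>M)"
      by (simp add: ind mult_ac)
    then show "(\<integral>x. ?f x y \<partial>M) = h y * (\<integral>x. g x * indicator {y..} x \<partial>M)" by simp
  qed simp
  finally show "(\<integral>x. g x * (\<integral>y. h y * indicator {..x} y \<partial>N) \<partial>M)
        = (\<integral>y. h y * (\<integral>x. g x * indicator {y..} x \<partial>M) \<partial>N)" .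
qed

context open_interval
begin

lemma test_L_integrable: "v \<in> test_functions \<Omega> \<Longrightarrow> integrable L v"
  using integrable_mult_test[of "\<lambda>_. 1" v] by simp

lemma integral_eq_UNIV:
  fixes k :: "real \<Rightarrow> real"
  assumes "\<And>x. x \<notin> S \<Longrightarrow> k x = 0"
  shows "integral S k = integral UNIV k"
proof -
  have "integral S k = integral UNIV (\<lambda>x. if x \<in> S then k x else 0)"
    by (simp add: integral_restrict_UNIV)
  also have "(\<lambda>x. if x \<in> S then k x else 0) = k" using assms by auto
  finally show ?thesis .
qed

text \<open>The fundamental theorem on \<open>[y, b]\<close>, where \<open>v b = 0\<close>. It
  evaluates the inner integral after Fubini.\<close>

lemma test_tail:
  assumes v: "v \<in> test_functions \<Omega>" and y: "y \<in> \<Omega>"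
  shows "(\<integral>x. deriv v x * indicator {y..} x \<partial>L) = - v y"
proof -
  let ?k = "\<lambda>x. deriv v x * indicator {y..} x :: real"
  note dv = test_deriv[OF v]
  have "integrable L ?k"
    using test_L_integrable[OF dv]
    by (intro integrable_mult_bounded[of _ _ _ 1] borel_measurable_L) (auto simp: indicator_def)
  then have "(\<integral>x. ?k x \<partial>L) = integral \<Omega> ?k"
    by (rule lebesgue_integral_eq_integral) simp
  also have "\<dots> = integral UNIV ?k"
    using test_outside[OF dv] by (intro integral_eq_UNIV) auto
  also have "\<dots> = integral {y..b} ?k"
    using test_outside[OF dv]
    by (intro integral_eq_UNIV[symmetric]) (auto simp: \<Omega> indicator_def)
  also have "\<dots> = integral {y..b} (deriv v)"
    by (intro Henstock_Kurzweil_Integration.integral_cong) (auto simp: indicator_def)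
  also have "\<dots> = v b - v y"
    using y test_has_deriv[OF v]
    by (intro integral_unique fundamental_theorem_of_calculus)
       (auto simp: \<Omega> has_real_derivative_iff_has_vector_derivative[symmetric] intro: has_field_derivative_at_within)
  also have "v b = 0" using test_outside[OF v] by (auto simp: \<Omega>)
  finally show ?thesis by simp
qed

text \<open>One formula for two objects: \<open>N = L\<close> gives the antiderivative of
  \<open>h\<close> that vanishes at \<open>a\<close>, and \<open>h = 1\<close> the distribution
  function of a measure.\<close>

definition primitive :: "real measure \<Rightarrow> (real \<Rightarrow> real) \<Rightarrow> real \<Rightarrow> real" where
  "primitive N h x = (\<integral>y. h y * indicator {..x} y \<partial>N)"

lemma primitive_integrable:
  assumes "finite_measure N" "(\<lambda>x. x) \<in> borel_measurable N" "integrable N h"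
  shows "integrable L (primitive N h)" "\<bar>primitive N h x\<bar> \<le> (\<integral>y. \<bar>h y\<bar> \<partial>N)"
proof -
  have m: "primitive N h \<in> borel_measurable L"
    unfolding primitive_def[abs_def]
    using primitive_measurable[OF L.finite_measure_axioms assms(1) _ assms(2) integrable_zero assms(3)]
    by simp
  show bnd: "\<bar>primitive N h x\<bar> \<le> (\<integral>y. \<bar>h y\<bar> \<partial>N)" for x
  proof -
    have [measurable]: "(\<lambda>x. x) \<in> borel_measurable N" by fact
    have i: "integrable N (\<lambda>y. h y * indicator {..x} y)"
      using assms(3)
      by (rule Bochner_Integration.integrable_bound) (use assms(3) in \<open>auto simp: indicator_def\<close>)
    have "\<bar>primitive N h x\<bar> \<le> (\<integral>y. \<bar>h y * indicator {..x} y\<bar> \<partial>N)"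
      unfolding primitive_def by (rule integral_abs_bound)
    also have "\<dots> \<le> (\<integral>y. \<bar>h y\<bar> \<partial>N)"
      using i assms(3) by (intro integral_mono) (auto simp: indicator_def)
    finally show ?thesis .
  qed
  show "integrable L (primitive N h)"
    by (rule bounded_integrable[OF L.finite_measure_axioms m bnd])
qed

text \<open>Fubini moves the integration onto the tail of \<open>deriv v\<close>, which is
  \<open>- v\<close> by \<open>test_tail\<close>; the sign cancels that of the distributional
  derivative.\<close>

lemma primitive_weak_deriv:
  assumes "finite_measure N" "(\<lambda>x. x) \<in> borel_measurable N" "integrable N h" "space N = \<Omega>"
    and v: "v \<in> test_functions \<Omega>"
  shows "weak_deriv \<Omega> (primitive N h) v = (\<integral>y. h y * v y \<partial>N)"
proof -
  have "(\<integral>x. primitive N h x * deriv v x \<partial>L)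
      = (\<integral>x. deriv v x * (\<integral>y. h y * indicator {..x} y \<partial>N) \<partial>L)"
    by (simp add: primitive_def mult.commute)
  also have "\<dots> = (\<integral>y. h y * (\<integral>x. deriv v x * indicator {y..} x \<partial>L) \<partial>N)"
    using assms test_L_integrable[OF test_deriv[OF v]]
    by (intro primitive_Fubini L.finite_measure_axioms) auto
  also have "\<dots> = (\<integral>y. h y * (- v y) \<partial>N)"
    using assms(4) test_tail[OF v] by (intro Bochner_Integration.integral_cong) auto
  finally show ?thesis
    by (simp add: weak_deriv_def dist_deriv_def dist_of_def)
qed

lemma id_measurable_L: "(\<lambda>x. x) \<in> borel_measurable L"
  by (intro borel_measurable_L) simp

definition cumulative :: "real measure \<Rightarrow> real \<Rightarrow> real" where
  "cumulative \<mu> = primitive \<mu> (\<lambda>_. 1)"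

lemma
  assumes \<mu>: "finite_borel_on \<Omega> \<mu>"
  shows cumulative_integrable: "integrable L (cumulative \<mu>)"
    and cumulative_bounded: "\<bar>cumulative \<mu> x\<bar> \<le> measure \<mu> \<Omega>"
    and cumulative_weak_deriv:
      "v \<in> test_functions \<Omega> \<Longrightarrow> weak_deriv \<Omega> (cumulative \<mu>) v = (\<integral>y. v y \<partial>\<mu>)"
proof -
  note f = finite_borel_onD[OF \<mu>]
  interpret \<mu>: finite_measure \<mu> by (rule f)
  have id: "(\<lambda>x. x) \<in> borel_measurable \<mu>" by (rule f(4)) simp
  show "integrable L (cumulative \<mu>)"
    unfolding cumulative_def by (rule primitive_integrable) (simp_all add: f id)
  show "\<bar>cumulative \<mu> x\<bar> \<le> measure \<mu> \<Omega>"
    using primitive_integrable(2)[OF f(1) id, of "\<lambda>_. 1" x] f(3) by (simp add: cumulative_def)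
  show "weak_deriv \<Omega> (cumulative \<mu>) v = (\<integral>y. v y \<partial>\<mu>)" if "v \<in> test_functions \<Omega>"
    unfolding cumulative_def using primitive_weak_deriv[OF f(1) id _ f(3) that, of "\<lambda>_. 1"] by simp
qed

text \<open>Open half-lines determine a finite Borel measure, and by dominated convergence their
  masses are limits of integrals of test functions.\<close>

lemma measure_eqI_tests:
  assumes M: "finite_measure M" "sets M = sets borel" "AE x in M. x \<in> \<Omega>"
    and N: "finite_measure N" "sets N = sets borel" "AE x in N. x \<in> \<Omega>"
    and eq: "\<And>v. v \<in> test_functions \<Omega> \<Longrightarrow> (\<integral>x. v x \<partial>M) = (\<integral>x. v x \<partial>N)"
  shows "M = N"
proof (rule measure_eqI_lessThan)
  fix x :: real
  have fin: "emeasure K S < \<infinity>" if "finite_measure K" for K :: "real measure" and S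
    using finite_measure.emeasure_finite[OF that, of S] by (simp add: top.not_eq_extremum)
  then show "emeasure M {x<..} < \<infinity>" using M by blast
  \<comment> \<open>No mass lies at or below \<open>a\<close>, so the half-line may be cut there,
    where \<open>indicator_approx\<close> applies.\<close>
  define x' where "x' = max x a"
  have AE: "emeasure K {x<..} = emeasure K {x'<..}" if "sets K = sets borel" "AE x in K. x \<in> \<Omega>" for K
    using that(2) by (intro emeasure_eq_AE) (auto simp: \<Omega> x'_def that)
  show "emeasure M {x<..} = emeasure N {x<..}"
  proof (cases "x' < b")
    case False
    have "emeasure K {x'<..} = emeasure K {}" if "sets K = sets borel" "AE x in K. x \<in> \<Omega>" for K
      using that(2) False by (intro emeasure_eq_AE) (auto simp: \<Omega> that)
    then show ?thesis using AE M N by simp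
  next
    case True
    obtain v :: "nat \<Rightarrow> real \<Rightarrow> real" where v: "\<And>n. v n \<in> test_functions \<Omega>" "\<And>n y. \<bar>v n y\<bar> \<le> 1"
      "\<And>y. y \<in> \<Omega> \<Longrightarrow> (\<lambda>n. v n y) \<longlonglongrightarrow> indicator {x'<..} y"
      using indicator_approx[OF _ True] x'_def by (metis max.cobounded2)
    have lim: "(\<lambda>n. \<integral>y. v n y \<partial>K) \<longlonglongrightarrow> measure K {x'<..}"
      if K: "finite_measure K" "sets K = sets borel" "AE x in K. x \<in> \<Omega>" for K
    proof -
      interpret finite_measure K by fact
      have "(\<lambda>n. \<integral>y. v n y \<partial>K) \<longlonglongrightarrow> (\<integral>y. indicator {x'<..} y \<partial>K)"
      proof (rule integral_dominated_convergence[where w = "\<lambda>_. 1"])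
        show "AE y in K. (\<lambda>n. v n y) \<longlonglongrightarrow> indicator {x'<..} y"
          using K(3) v(3) by auto
        show "v n \<in> borel_measurable K" for n
          using test_measurable[OF v(1)] measurable_cong_sets[OF K(2) refl] by blast
      qed (use v(2) K(2) in \<open>auto simp: measurable_cong_sets[OF K(2) refl]\<close>)
      moreover have "{x'<..} \<inter> space K = {x'<..}" using sets_eq_imp_space_eq[OF K(2)] by simp
      ultimately show ?thesis by simp
    qed
    have "measure M {x'<..} = measure N {x'<..}"
      using LIMSEQ_unique[OF lim[OF M]] lim[OF N] eq[OF v(1)] by simp
    then have "emeasure M {x'<..} = emeasure N {x'<..}"
      using finite_measure.emeasure_eq_measure M(1) N(1) by metis
    then show ?thesis using AE M N by simp
  qed
qed (use assms in auto)

subsection \<open>Structure of functions of bounded variation\<close>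

text \<open>A measure on \<Omega> carries the trace sigma-algebra; its image on the line can be
  added to measures with Borel sets and compared with them.\<close>

lemma
  fixes v :: "real \<Rightarrow> real"
  assumes \<mu>: "finite_borel_on \<Omega> \<mu>"
  shows distr_integral: "v \<in> borel_measurable borel \<Longrightarrow> (\<integral>x. v x \<partial>distr \<mu> borel (\<lambda>x. x)) = (\<integral>x. v x \<partial>\<mu>)"
    and distr_integrable: "v \<in> borel_measurable borel \<Longrightarrow> integrable \<mu> v \<Longrightarrow> integrable (distr \<mu> borel (\<lambda>x. x)) v"
    and distr_emeasure: "S \<in> sets borel \<Longrightarrow> emeasure (distr \<mu> borel (\<lambda>x. x)) S = emeasure \<mu> (S \<inter> \<Omega>)"
proof -
  note f = finite_borel_onD[OF \<mu>]
  have [measurable]: "(\<lambda>x. x) \<in> \<mu> \<rightarrow>\<^sub>M borel" by (rule f(4)) simp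
  show "v \<in> borel_measurable borel \<Longrightarrow> (\<integral>x. v x \<partial>distr \<mu> borel (\<lambda>x. x)) = (\<integral>x. v x \<partial>\<mu>)"
    by (rule integral_distr) simp_all
  show "v \<in> borel_measurable borel \<Longrightarrow> integrable \<mu> v \<Longrightarrow> integrable (distr \<mu> borel (\<lambda>x. x)) v"
    by (subst integrable_distr_eq) simp_all
  show "S \<in> sets borel \<Longrightarrow> emeasure (distr \<mu> borel (\<lambda>x. x)) S = emeasure \<mu> (S \<inter> \<Omega>)"
    by (subst emeasure_distr) (simp_all add: f(3))
qed

section \<open>Uniqueness of the Lebesgue decomposition\<close>

lemma AE_L_iff: "(AE x in L. P x) \<longleftrightarrow> (AE x in lebesgue. x \<in> \<Omega> \<longrightarrow> P x)"
  by (rule AE_restrict_space_iff) simp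

text \<open>Lebesgue measure is the completion of \<open>lborel\<close>, so \<open>h\<close>
  extended by 0 agrees almost everywhere with a Borel function. The representing measures live on
  Borel sets and take Borel densities.\<close>

lemma borel_representative:
  fixes h :: "real \<Rightarrow> real"
  assumes "integrable L h"
  obtains g where "g \<in> borel_measurable borel" "integrable lborel g" "\<And>x. x \<notin> \<Omega> \<Longrightarrow> g x = 0"
    "AE x in L. h x = g x"
    "\<And>v. v \<in> borel_measurable borel \<Longrightarrow> (\<integral>x. h x * v x \<partial>L) = (\<integral>x. g x * v x \<partial>lborel)"
proof -
  let ?h = "\<lambda>x. indicator \<Omega> x * h x"
  have h: "integrable lebesgue ?h"
    using assms integrable_restrict_space[of \<Omega> lebesgue h] by simp
  then have "?h \<in> borel_measurable lebesgue" by simp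
  then obtain g0 where g0[measurable]: "g0 \<in> borel_measurable lborel" and AE: "AE x in lborel. ?h x = g0 x"
    using completion_ex_borel_measurable_real[of ?h lborel] by auto
  define g where "g = (\<lambda>x. indicator \<Omega> x * g0 x)"
  have gm: "g \<in> borel_measurable lborel" unfolding g_def by (intro borel_measurable_times) auto
  have AEg: "AE x in lebesgue. ?h x = g x"
    using AE_completion[OF AE] by eventually_elim (auto simp: g_def indicator_def)
  have "integrable lebesgue g"
    using h by (rule integrable_cong_AE_imp) (use gm AEg in \<open>auto simp: measurable_completion\<close>)
  then have gi: "integrable lborel g" using gm by (simp add: integrable_completion)
  show thesis
  proof
    show "g \<in> borel_measurable borel" using gm by simp
    show "integrable lborel g" by fact
    show "g x = 0" if "x \<notin> \<Omega>" for x using that by (simp add: g_def)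
    show "AE x in L. h x = g x"
      unfolding AE_L_iff using AEg by eventually_elim auto
    fix v :: "real \<Rightarrow> real" assume v: "v \<in> borel_measurable borel"
    have "(\<integral>x. h x * v x \<partial>L) = (\<integral>x. indicator \<Omega> x * (h x * v x) \<partial>lebesgue)"
      by (subst integral_restrict_space) auto
    also have "\<dots> = (\<integral>x. g x * v x \<partial>lebesgue)"
    proof (rule integral_cong_AE)
      have v': "v \<in> borel_measurable lebesgue" using v by (simp add: measurable_completion)
      show "(\<lambda>x. indicator \<Omega> x * (h x * v x)) \<in> borel_measurable lebesgue"
        using borel_measurable_times[OF \<open>?h \<in> borel_measurable lebesgue\<close> v'] by (simp add: mult.assoc)
      show "(\<lambda>x. g x * v x) \<in> borel_measurable lebesgue"
        using gm v' by (intro borel_measurable_times) (auto simp: measurable_completion)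
      show "AE x in lebesgue. indicator \<Omega> x * (h x * v x) = g x * v x"
        using AEg by eventually_elim (simp add: mult.assoc[symmetric])
    qed
    also have "\<dots> = (\<integral>x. g x * v x \<partial>lborel)"
      using gm v by (intro integral_completion) auto
    finally show "(\<integral>x. h x * v x \<partial>L) = (\<integral>x. g x * v x \<partial>lborel)" .
  qed
qed

text \<open>A measure that is both absolutely continuous and singular is zero. With nonnegative
  terms on both sides, the positive part of the density plus \<nu> equals the negative part plus
  \<mu>; removing the null set \<open>N\<close> leaves the two parts equal.\<close>

lemma singular_density_zero:
  assumes h: "integrable L h"
    and rep: "represented_by \<Omega> (dist_of \<Omega> h) \<mu> \<nu>"
    and N: "N \<in> null_sets lborel" "emeasure \<mu> (\<Omega> - N) = 0" "emeasure \<nu> (\<Omega> - N) = 0"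
  shows "AE x in L. h x = 0"
proof -
  obtain g where g: "g \<in> borel_measurable borel" "integrable lborel g" "\<And>x. x \<notin> \<Omega> \<Longrightarrow> g x = 0"
    "AE x in L. h x = g x"
    "\<And>v. v \<in> borel_measurable borel \<Longrightarrow> (\<integral>x. h x * v x \<partial>L) = (\<integral>x. g x * v x \<partial>lborel)"
    using borel_representative[OF h] by blast
  note [measurable] = g(1)
  have \<mu>: "finite_borel_on \<Omega> \<mu>" and \<nu>: "finite_borel_on \<Omega> \<nu>"
    and eq: "\<And>v. v \<in> test_functions \<Omega> \<Longrightarrow> dist_of \<Omega> h v = (\<integral>x. v x \<partial>\<mu>) - (\<integral>x. v x \<partial>\<nu>)"
    using rep by (auto simp: represented_by_def)
  \<comment> \<open>\<open>P 1\<close> and \<open>P (- 1)\<close> have the positive and the negative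
    part of \<open>g\<close> as densities.\<close>
  define P where "P r = density lborel (\<lambda>x. ennreal (max 0 (r * g x)))" for r
  define K where "K r \<sigma> = lincomb_measure 1 (P r) 1 (distr \<sigma> borel (\<lambda>x. x))" for r \<sigma>
  have sP[simp]: "sets (P r) = sets borel" for r by (simp add: P_def)
  have sK[simp]: "sets (K r \<sigma>) = sets borel" for r \<sigma> by (simp add: K_def)
  have maxi: "integrable lborel (\<lambda>x. max 0 (r * g x))" for r
    using g(2) by (intro integrable_max) auto
  have finP: "finite_measure (P r)" for r
  proof (rule finite_measureI)
    have "emeasure (P r) (space (P r)) = (\<integral>\<^sup>+x. ennreal (max 0 (r * g x)) \<partial>lborel)"
      by (simp add: P_def emeasure_density)
    also have "\<dots> = ennreal (\<integral>x. max 0 (r * g x) \<partial>lborel)"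
      by (rule nn_integral_eq_integral[OF maxi]) simp
    finally show "emeasure (P r) (space (P r)) \<noteq> \<infinity>" by simp
  qed
  have AEP: "AE x in P r. x \<in> \<Omega>" for r
    unfolding P_def proof (subst AE_density)
    show "AE x in lborel. 0 < ennreal (max 0 (r * g x)) \<longrightarrow> x \<in> \<Omega>"
    proof (intro AE_I2 impI)
      fix x assume "0 < ennreal (max 0 (r * g x))"
      then have "g x \<noteq> 0" by auto
      then show "x \<in> \<Omega>" using g(3) by blast
    qed
  qed simp
  have em: "emeasure (K r \<sigma>) S = emeasure (P r) S + emeasure \<sigma> (S \<inter> \<Omega>)"
    if "finite_borel_on \<Omega> \<sigma>" "S \<in> sets borel" for r \<sigma> S
    unfolding K_def using that by (subst emeasure_lincomb_measure) (auto simp: distr_emeasure)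
  have finK: "finite_measure (K r \<sigma>)" if "finite_borel_on \<Omega> \<sigma>" for r \<sigma>
  proof (rule finite_measureI)
    have "space (K r \<sigma>) = UNIV" by (simp add: K_def P_def)
    then show "emeasure (K r \<sigma>) (space (K r \<sigma>)) \<noteq> \<infinity>"
      using that finite_measure.emeasure_finite[OF finP] finite_measure.emeasure_finite[OF finite_borel_onD(1)[OF that]]
      by (simp add: em)
  qed
  have AEK: "AE x in K r \<sigma>. x \<in> \<Omega>" if "finite_borel_on \<Omega> \<sigma>" for r \<sigma>
  proof (rule AE_I)
    show "{x \<in> space (K r \<sigma>). x \<notin> \<Omega>} \<subseteq> - \<Omega>" by auto
    have "emeasure (P r) (- \<Omega>) = 0"
      using AEP[of r] by (subst (asm) AE_iff_measurable[of "- \<Omega>"]) (auto simp: P_def)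
    then show "emeasure (K r \<sigma>) (- \<Omega>) = 0" using that by (simp add: em)
    show "- \<Omega> \<in> sets (K r \<sigma>)" by simp
  qed
  have intK: "(\<integral>x. v x \<partial>K r \<sigma>) = (\<integral>x. max 0 (r * g x) * v x \<partial>lborel) + (\<integral>x. v x \<partial>\<sigma>)"
    if \<sigma>: "finite_borel_on \<Omega> \<sigma>" and v: "v \<in> test_functions \<Omega>" for r \<sigma> v
  proof -
    note [measurable] = test_measurable[OF v]
    obtain C where C: "\<And>x. \<bar>v x\<bar> \<le> C" using test_bounded[OF v] by blast
    have "integrable (P r) v"
      by (rule bounded_integrable[OF finP _ C]) (simp add: P_def)
    moreover have "integrable (distr \<sigma> borel (\<lambda>x. x)) v"
      using \<sigma> v by (intro distr_integrable test_integrable) auto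
    moreover have "(\<integral>x. v x \<partial>P r) = (\<integral>x. max 0 (r * g x) * v x \<partial>lborel)"
      unfolding P_def by (subst integral_density) auto
    ultimately show ?thesis
      unfolding K_def using \<sigma> by (subst integral_lincomb_measure) (auto simp: distr_integral)
  qed
  have K: "K 1 \<nu> = K (- 1) \<mu>"
  proof (rule measure_eqI_tests)
    fix v assume v: "v \<in> test_functions \<Omega>"
    note [measurable] = test_measurable[OF v]
    obtain C where C: "\<And>x. \<bar>v x\<bar> \<le> C" using test_bounded[OF v] by blast
    have i: "integrable lborel (\<lambda>x. max 0 (r * g x) * v x)" for r
      using C by (intro integrable_mult_bounded[of _ _ _ C] maxi) auto
    have "(\<integral>x. max 0 (1 * g x) * v x \<partial>lborel) - (\<integral>x. max 0 (- 1 * g x) * v x \<partial>lborel)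
        = (\<integral>x. max 0 (1 * g x) * v x - max 0 (- 1 * g x) * v x \<partial>lborel)"
      by (rule Bochner_Integration.integral_diff[symmetric, OF i i])
    also have "\<dots> = (\<integral>x. g x * v x \<partial>lborel)"
      by (intro Bochner_Integration.integral_cong) (auto simp: max_def)
    also have "\<dots> = (\<integral>x. v x \<partial>\<mu>) - (\<integral>x. v x \<partial>\<nu>)"
      using eq[OF v] g(5)[of v] by (simp add: dist_of_def)
    finally show "(\<integral>x. v x \<partial>K 1 \<nu>) = (\<integral>x. v x \<partial>K (- 1) \<mu>)"
      using v \<mu> \<nu> by (simp add: intK)
  qed (use \<mu> \<nu> finK AEK in auto)
  have "P 1 = P (- 1)"
  proof (rule measure_eqI)
    fix S assume "S \<in> sets (P 1)"
    then have S[measurable]: "S \<in> sets borel" by simp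
    have [measurable]: "N \<in> sets borel" using N(1) by auto
    \<comment> \<open>Deleting \<open>N\<close> costs \<open>P r\<close> nothing and removes all of
      \<sigma>.\<close>
    have "emeasure (P r) S = emeasure (K r \<sigma>) (S - N)"
      if \<sigma>: "finite_borel_on \<Omega> \<sigma>" "emeasure \<sigma> (\<Omega> - N) = 0" for r \<sigma>
    proof -
      have "N \<in> null_sets (P r)"
        unfolding P_def using N(1)
        by (subst null_sets_density_iff) (auto intro: AE_not_in elim: eventually_mono[OF AE_not_in])
      then have "emeasure (P r) S = emeasure (P r) (S - N)"
        by (intro emeasure_Diff_null_set[symmetric]) auto
      moreover have "emeasure \<sigma> ((S - N) \<inter> \<Omega>) \<le> emeasure \<sigma> (\<Omega> - N)"
        using finite_borel_onD(2)[OF \<sigma>(1)]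
        by (intro emeasure_mono) (auto simp: sets_restrict_space)
      ultimately show ?thesis using \<sigma> by (simp add: em)
    qed
    then show "emeasure (P 1) S = emeasure (P (- 1)) S" using \<mu> \<nu> N K by metis
  qed simp
  then have "AE x in lborel. ennreal (max 0 (1 * g x)) = ennreal (max 0 (- 1 * g x))"
    unfolding P_def by (intro sigma_finite_measure.density_unique) (auto intro: sigma_finite_lborel)
  then have "AE x in lborel. g x = 0"
    by eventually_elim (auto simp: max_def split: if_splits)
  then have "AE x in lebesgue. g x = 0" by (rule AE_completion)
  then have "AE x in L. g x = 0" unfolding AE_L_iff by eventually_elim simp
  with g(4) show ?thesis by eventually_elim simp
qed

lemma finite_borel_null: "finite_borel_on \<Omega> (null_measure (restrict_space borel \<Omega>))"
  unfolding finite_borel_on_def by (auto intro!: finite_measureI)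

text \<open>The fundamental lemma of the calculus of variations, as the case of zero measures and
  the empty null set.\<close>

lemma dist_of_zero_AE:
  assumes "integrable L h" "\<And>v. v \<in> test_functions \<Omega> \<Longrightarrow> dist_of \<Omega> h v = 0"
  shows "AE x in L. h x = 0"
proof (rule singular_density_zero[OF assms(1)])
  let ?Z = "null_measure (restrict_space borel \<Omega>)"
  show "represented_by \<Omega> (dist_of \<Omega> h) ?Z ?Z"
    using assms(2) finite_borel_null by (simp add: represented_by_def)
  show "{} \<in> null_sets lborel" by simp
qed simp_all

text \<open>The density \<open>w\<close> with zero singular part is admissible, so the choice in
  \<open>ac_density\<close> meets its specification; the difference of the two densities is then
  singular, hence zero.\<close>

lemma
  assumes w: "integrable L w" and eq: "\<And>v. v \<in> test_functions \<Omega> \<Longrightarrow> weak_deriv \<Omega> u v = dist_of \<Omega> w v"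
  shows ac_density_AE: "AE x in L. w x = ac_density \<Omega> u x"
    and singular_part_zero: "v \<in> test_functions \<Omega> \<Longrightarrow> singular_part \<Omega> u v = 0"
proof -
  let ?Z = "null_measure (restrict_space borel \<Omega>)"
  let ?P = "\<lambda>g. integrable L g \<and> is_singular_radon \<Omega> (dist_diff (weak_deriv \<Omega> u) (dist_of \<Omega> g))"
  have "represented_by \<Omega> (dist_diff (weak_deriv \<Omega> u) (dist_of \<Omega> w)) ?Z ?Z"
    using eq finite_borel_null by (simp add: represented_by_def dist_diff_def)
  then have "is_singular_radon \<Omega> (dist_diff (weak_deriv \<Omega> u) (dist_of \<Omega> w))"
    unfolding is_singular_radon_def by (intro exI[of _ ?Z] conjI bexI[of _ "{}"]) auto
  then have "?P (ac_density \<Omega> u)"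
    unfolding ac_density_def using w by (intro someI[of ?P w]) simp
  then obtain \<mu> \<nu> N where g: "integrable L (ac_density \<Omega> u)"
    and rep: "represented_by \<Omega> (dist_diff (weak_deriv \<Omega> u) (dist_of \<Omega> (ac_density \<Omega> u))) \<mu> \<nu>"
    and N: "N \<in> null_sets lborel" "emeasure \<mu> (\<Omega> - N) = 0" "emeasure \<nu> (\<Omega> - N) = 0"
    by (auto simp: is_singular_radon_def)
  have "represented_by \<Omega> (dist_of \<Omega> (\<lambda>x. 1 * w x + (- 1) * ac_density \<Omega> u x)) \<mu> \<nu>"
    using rep eq dist_of_lincomb[OF w g, of _ 1 "- 1"]
    by (simp add: represented_by_def dist_diff_def)
  then have "AE x in L. 1 * w x + (- 1) * ac_density \<Omega> u x = 0"
    by (intro singular_density_zero[OF _ _ N]) (use w g in auto)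
  then show AE: "AE x in L. w x = ac_density \<Omega> u x" by eventually_elim simp
  show "singular_part \<Omega> u v = 0" if v: "v \<in> test_functions \<Omega>"
  proof -
    have "dist_of \<Omega> w v = dist_of \<Omega> (ac_density \<Omega> u) v"
      unfolding dist_of_def
    proof (rule integral_cong_AE)
      show "AE x in L. w x * v x = ac_density \<Omega> u x * v x" using AE by eventually_elim simp
    qed (use integrable_mult_test[OF w v] integrable_mult_test[OF g v] in auto)
    then show ?thesis using eq[OF v] by (simp add: singular_part_def dist_diff_def)
  qed
qed

text \<open>To the right of the support of \<open>z\<close> its antiderivative equals the full
  integral, so zero mean is what makes the antiderivative compactly supported.\<close>

lemma test_antiderivative:
  assumes z: "z \<in> test_functions \<Omega>" and 0: "(\<integral>x. z x \<partial>L) = 0"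
  obtains v where "v \<in> test_functions \<Omega>" "deriv v = z"
proof -
  obtain c d where cd: "smooth z" "a < c" "c < d" "d < b" "\<And>x. x \<notin> {c..d} \<Longrightarrow> z x = 0"
    using z by (auto simp: test_functions_iff)
  define v where "v x = integral {a..x} z" for x
  have outl: "v x = 0" if "x < c" for x
  proof -
    have "integral {a..x} z = integral {a..x} (\<lambda>_. 0)"
      using that cd by (intro Henstock_Kurzweil_Integration.integral_cong) auto
    then show ?thesis by (simp add: v_def)
  qed
  have der: "(v has_real_derivative z x) (at x)" for x
  proof (cases "x < c")
    case True
    have "((\<lambda>_. 0) has_real_derivative 0) (at x)" by simp
    then have "(v has_real_derivative 0) (at x)"
      by (rule has_field_derivative_transform_within_open[of _ _ _ "{..<c}"]) (use True outl in auto)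
    then show ?thesis using cd(5)[of x] True by simp
  next
    case False
    then have x: "a < x" using cd by simp
    have "((\<lambda>u. integral {a..u} z) has_vector_derivative z x) (at x within {a..x + 1})"
      using x by (intro integral_has_vector_derivative test_continuous[OF z]) auto
    then have "(v has_real_derivative z x) (at x within {a..x + 1})"
      by (simp add: v_def[abs_def] has_real_derivative_iff_has_vector_derivative)
    moreover have "x \<in> interior {a..x + 1}" using x by simp
    ultimately show ?thesis by (metis at_within_interior)
  qed
  have "v x = 0" if "x > d" for x
  proof -
    have "integral {a..x} z = integral UNIV z"
      using cd that by (intro integral_eq_UNIV) auto
    also have "\<dots> = integral \<Omega> z"
      using test_outside[OF z] by (intro integral_eq_UNIV[symmetric]) auto
    also have "\<dots> = (\<integral>x. z x \<partial>L)"
      by (rule lebesgue_integral_eq_integral[symmetric, OF test_L_integrable[OF z]]) simp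
    finally show ?thesis using 0 by (simp add: v_def)
  qed
  then have "v x = 0" if "x \<notin> {c..d}" for x using that outl by (cases "x < c") auto
  then have "v \<in> test_functions \<Omega>"
    unfolding test_functions_iff using smooth_antideriv[OF cd(1) der] cd by blast
  moreover have "deriv v = z" using der by (intro ext DERIV_imp_deriv)
  ultimately show thesis by (rule that)
qed

lemma test_nonzero_integral: "\<exists>v\<in>test_functions \<Omega>. (\<integral>x. v x \<partial>L) \<noteq> 0"
proof (rule ccontr)
  assume "\<not> ?thesis"
  then have "AE x in L. (1::real) = 0"
    by (intro dist_of_zero_AE) (auto simp: dist_of_def)
  then have "emeasure L (space L) = 0"
    by (simp add: AE_iff_null null_sets_def)
  then have "emeasure lebesgue \<Omega> = 0" by (simp add: emeasure_restrict_space)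
  then show False using ab by (simp add: \<Omega> )
qed

text \<open>The lemma of du Bois-Reymond: a test function minus the multiple of a fixed
  \<open>B\<close> with the same integral is a derivative, against which \<open>h\<close> integrates
  to 0. The constant is therefore the mean of \<open>h\<close> with weight \<open>B\<close>.\<close>

lemma weak_deriv_zero_AE_const:
  assumes h: "integrable L h" and 0: "\<And>v. v \<in> test_functions \<Omega> \<Longrightarrow> weak_deriv \<Omega> h v = 0"
  obtains c where "AE x in L. h x = c"
proof -
  obtain B where B: "B \<in> test_functions \<Omega>" "(\<integral>x. B x \<partial>L) \<noteq> 0"
    using test_nonzero_integral by blast
  define c where "c = (\<integral>x. h x * B x \<partial>L) / (\<integral>x. B x \<partial>L)"
  have "AE x in L. 1 * h x + (- c) * 1 = 0"
  proof (rule dist_of_zero_AE)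
    show "integrable L (\<lambda>x. 1 * h x + - c * 1)" using h by simp
    fix z assume z: "z \<in> test_functions \<Omega>"
    define r where "r = (\<integral>x. z x \<partial>L) / (\<integral>x. B x \<partial>L)"
    have t: "(\<lambda>x. 1 * z x + (- r) * B x) \<in> test_functions \<Omega>" by (rule test_lincomb[OF z B(1)])
    have "(\<integral>x. 1 * z x + (- r) * B x \<partial>L) = 0"
      using test_L_integrable[OF z] test_L_integrable[OF B(1)] B(2) by (simp add: r_def)
    then obtain v where v: "v \<in> test_functions \<Omega>" "deriv v = (\<lambda>x. 1 * z x + (- r) * B x)"
      by (rule test_antiderivative[OF t])
    have "0 = (\<integral>x. h x * (1 * z x + (- r) * B x) \<partial>L)"
      using 0[OF v(1)] by (simp add: weak_deriv_def dist_deriv_def dist_of_def v(2))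
    also have "\<dots> = (\<integral>x. h x * z x - r * (h x * B x) \<partial>L)"
      by (simp add: algebra_simps)
    also have "\<dots> = (\<integral>x. h x * z x \<partial>L) - r * (\<integral>x. h x * B x \<partial>L)"
      using integrable_mult_test[OF h z] integrable_mult_test[OF h B(1)] by simp
    also have "r * (\<integral>x. h x * B x \<partial>L) = c * (\<integral>x. z x \<partial>L)"
      by (simp add: r_def c_def)
    finally have e: "(\<integral>x. h x * z x \<partial>L) = c * (\<integral>x. z x \<partial>L)" by simp
    have "dist_of \<Omega> (\<lambda>x. 1 * h x + (- c) * 1) z = 1 * dist_of \<Omega> h z + (- c) * dist_of \<Omega> (\<lambda>_. 1) z"
      by (rule dist_of_lincomb[OF h _ z]) simp
    also have "\<dots> = 0" using e by (simp add: dist_of_def)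
    finally show "dist_of \<Omega> (\<lambda>x. 1 * h x + - c * 1) z = 0" .
  qed
  then have "AE x in L. h x = c" by eventually_elim simp
  then show thesis by (rule that)
qed

text \<open>Both sides of the equation have the same weak derivative, so they differ by a constant.
  This reduces pairings with \<open>u\<close> to integrals against its measures.\<close>

lemma BV_structure:
  assumes "u \<in> BV \<Omega>"
  obtains \<mu> \<nu> c where "represented_by \<Omega> (weak_deriv \<Omega> u) \<mu> \<nu>"
    "AE x in L. u x = c + cumulative \<mu> x - cumulative \<nu> x"
proof -
  obtain \<mu> \<nu> where \<mu>: "finite_borel_on \<Omega> \<mu>" and \<nu>: "finite_borel_on \<Omega> \<nu>" and
    rep: "\<And>v. v \<in> test_functions \<Omega> \<Longrightarrow> weak_deriv \<Omega> u v = (\<integral>x. v x \<partial>\<mu>) - (\<integral>x. v x \<partial>\<nu>)"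
    using assms by (auto simp: BV_def is_finite_radon_def represented_by_def)
  note i = BV_integrable[OF assms] cumulative_integrable[OF \<mu>] cumulative_integrable[OF \<nu>]
  let ?F = "\<lambda>x. 1 * cumulative \<mu> x + (- 1) * cumulative \<nu> x"
  have iF: "integrable L ?F" using i by simp
  obtain c where "AE x in L. 1 * u x + (- 1) * ?F x = c"
  proof (rule weak_deriv_zero_AE_const)
    show "integrable L (\<lambda>x. 1 * u x + (- 1) * ?F x)" using i by simp
    show "weak_deriv \<Omega> (\<lambda>x. 1 * u x + (- 1) * ?F x) v = 0" if v: "v \<in> test_functions \<Omega>" for v
      unfolding weak_deriv_lincomb[OF i(1) iF v] weak_deriv_lincomb[OF i(2,3) v]
      using rep[OF v] cumulative_weak_deriv[OF \<mu> v] cumulative_weak_deriv[OF \<nu> v] by simp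
  qed
  then have "AE x in L. u x = c + cumulative \<mu> x - cumulative \<nu> x" by eventually_elim simp
  moreover have "represented_by \<Omega> (weak_deriv \<Omega> u) \<mu> \<nu>"
    using \<mu> \<nu> rep by (simp add: represented_by_def)
  ultimately show thesis by (rule that[rotated])
qed

text \<open>Distribution functions are bounded by the total mass. This makes the squares and
  products in the energy integrable.\<close>

lemma BV_bounded:
  assumes "u \<in> BV \<Omega>"
  obtains C where "C > 0" "AE x in L. \<bar>u x\<bar> \<le> C"
proof -
  obtain \<mu> \<nu> c where rep: "represented_by \<Omega> (weak_deriv \<Omega> u) \<mu> \<nu>"
    and AE: "AE x in L. u x = c + cumulative \<mu> x - cumulative \<nu> x"
    using BV_structure[OF assms] by blast
  have s: "finite_borel_on \<Omega> \<mu>" "finite_borel_on \<Omega> \<nu>"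
    using rep by (auto simp: represented_by_def)
  have "AE x in L. \<bar>u x\<bar> \<le> 1 + \<bar>c\<bar> + measure \<mu> \<Omega> + measure \<nu> \<Omega>"
    using AE
  proof eventually_elim
    case (elim x)
    then show ?case using cumulative_bounded[OF s(1), of x] cumulative_bounded[OF s(2), of x] by linarith
  qed
  moreover have "0 < 1 + \<bar>c\<bar> + measure \<mu> \<Omega> + measure \<nu> \<Omega>"
    using measure_nonneg[of \<mu> \<Omega>] measure_nonneg[of \<nu> \<Omega>] by linarith
  ultimately show thesis using that by blast
qed

end

subsection \<open>Approximation of dual functions by test functions\<close>

lemma poly_antideriv:
  fixes p :: "real poly"
  shows "\<exists>P. pderiv P = p"
proof (induction p)
  case (pCons a p)
  define P where "P = (\<Sum>i\<le>degree (pCons a p). monom (coeff (pCons a p) i / real (Suc i)) (Suc i))"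
  have "pderiv P = (\<Sum>i\<le>degree (pCons a p). monom (coeff (pCons a p) i) i)"
    by (simp add: P_def higher_pderiv_sum[where n = 1, simplified] pderiv_monom)
  also have "\<dots> = pCons a p" by (rule poly_as_sum_of_monoms)
  finally show ?case by blast
qed (intro exI[of _ 0], simp)

lemma polynomial_approx:
  fixes f :: "real \<Rightarrow> real"
  assumes "continuous_on {c..d} f" "e > 0"
  obtains p where "\<And>x. x \<in> {c..d} \<Longrightarrow> \<bar>f x - poly p x\<bar> < e"
proof -
  obtain g where g: "real_polynomial_function g" "\<And>x. x \<in> {c..d} \<Longrightarrow> \<bar>f x - g x\<bar> < e"
    using Stone_Weierstrass_real_polynomial_function[OF _ assms] by auto
  obtain k n where k: "g = (\<lambda>x. \<Sum>i\<le>n. k i * x ^ i)"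
    using g(1) real_polynomial_function_iff_sum by blast
  have "poly (\<Sum>i\<le>n. monom (k i) i) x = g x" for x
    by (simp add: k poly_sum poly_monom)
  with g(2) that show thesis by metis
qed

context open_interval
begin

text \<open>A counterpart of mollification. Divide \<open>V\<close> by a bump \<eta> that is
  positive on a larger interval; the quotient \<open>Q\<close> is C^1, a polynomial \<open>P\<close>
  approximates it together with its derivative, and \<eta> times \<open>P\<close> is again a
  bump.\<close>

lemma test_approx_compact:
  assumes c: "a < c'" "c' < c" "c < d" "d < d'" "d' < b"
    and V: "\<And>x. (V has_real_derivative G x) (at x)" and G: "continuous_on UNIV G"
    and out: "\<And>x. x \<notin> {c..d} \<Longrightarrow> V x = 0"
    and e: "e > 0"
  obtains v where "v \<in> test_functions \<Omega>" "\<And>x. \<bar>v x - V x\<bar> \<le> e" "\<And>x. \<bar>deriv v x - G x\<bar> \<le> e"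
proof -
  define s where "s = [:- c', 1:] * [:d', - 1:]"
  have ps: "poly s x = (x - c') * (d' - x)" for x by (simp add: s_def algebra_simps)
  have pos: "poly s x > 0" if "x \<in> {c'<..<d'}" for x using that by (simp add: ps)
  have neg: "poly s x < 0" if "x \<notin> {c'..d'}" for x
    using that c by (auto simp: ps mult_less_0_iff)
  have b: "bump s p k \<in> test_functions \<Omega>" for p k
    using bump_test[of c' d' 1 p k] c by (simp add: s_def)
  define \<eta> where "\<eta> = bump s 1 0"
  have \<eta>t: "\<eta> \<in> test_functions \<Omega>" unfolding \<eta>_def by (rule b)
  obtain H where H: "H > 0" "\<And>x. \<bar>deriv \<eta> x\<bar> \<le> H" using test_bounded[OF test_deriv[OF \<eta>t]] by blast
  have \<eta>1: "\<bar>\<eta> x\<bar> \<le> 1" for x by (simp add: \<eta>_def bump_def)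
  have outo: "open (- {c..d})" by (simp add: open_Compl)
  have G0: "G x = 0" if "x \<notin> {c..d}" for x
  proof (rule DERIV_unique[OF V])
    have "((\<lambda>_. 0) has_real_derivative 0) (at x)" by simp
    then show "(V has_real_derivative 0) (at x)"
      by (rule has_field_derivative_transform_within_open[OF _ outo]) (use that out in auto)
  qed
  define Q where "Q x = V x * exp (1 / poly s x)" for x
  define Q' where "Q' x = G x * exp (1 / poly s x)
      + V x * (exp (1 / poly s x) * (- (poly (pderiv s) x / (poly s x)\<^sup>2)))" for x
  have dQ: "(Q has_real_derivative Q' x) (at x)" for x
  proof (cases "x \<in> {c'<..<d'}")
    case True
    then have "poly s x \<noteq> 0" using pos by force
    then show ?thesis unfolding Q_def[abs_def] Q'_def
      by (auto intro!: derivative_eq_intros V simp: power2_eq_square field_simps)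
  next
    case False
    then have x: "x \<notin> {c..d}" using c by auto
    have "((\<lambda>_. 0) has_real_derivative 0) (at x)" by simp
    then have "(Q has_real_derivative 0) (at x)"
      by (rule has_field_derivative_transform_within_open[OF _ outo]) (use x out in \<open>auto simp: Q_def\<close>)
    then show ?thesis using x out G0 by (simp add: Q'_def)
  qed
  have cV: "continuous_on S V" for S
    by (intro continuous_at_imp_continuous_on ballI DERIV_isCont[OF V])
  \<comment> \<open>\<open>exp (1 / s)\<close> blows up towards \<open>c'\<close> and
    \<open>d'\<close>, but \<open>V\<close> is already 0 near them. The set where
    \<open>s > 0\<close> and the complement of \<open>{c..d}\<close> are open and together cover the
    closed interval.\<close>
  have "continuous_on {c'<..<d'} Q'"
    unfolding Q'_def using pos
    by (intro continuous_intros continuous_on_subset[OF G] cV) force+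
  moreover have "continuous_on (- {c..d}) Q'"
  proof (rule continuous_on_eq)
    show "continuous_on (- {c..d}) (\<lambda>_. 0 :: real)" by simp
    show "0 = Q' x" if "x \<in> - {c..d}" for x using that out G0 by (simp add: Q'_def)
  qed
  ultimately have "continuous_on ({c'<..<d'} \<union> - {c..d}) Q'"
    by (intro continuous_on_open_Un) auto
  then have cQ: "continuous_on {c'..d'} Q'"
    by (rule continuous_on_subset) (use c in auto)
  define D where "D = d' - c'"
  have D: "D > 0" using c by (simp add: D_def)
  \<comment> \<open>Chosen so that \<open>\<delta> * D\<close> bounds the error of the values and
    \<open>H * (\<delta> * D) + \<delta>\<close> that of the derivative of the product, both at most
    \<open>e\<close>.\<close>
  define \<delta> where "\<delta> = e / (1 + D + H * D)"
  have den: "1 + D + H * D > 0" using D H by (simp add: add_pos_pos)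
  have \<delta>: "\<delta> > 0" unfolding \<delta>_def using e den by simp
  have \<delta>D: "\<delta> * D \<le> e" "H * (\<delta> * D) + \<delta> \<le> e"
  proof -
    have "\<delta> * (1 + D + H * D) = e" using den by (simp add: \<delta>_def)
    then have "\<delta> + \<delta> * D + H * (\<delta> * D) = e" by (simp add: algebra_simps)
    moreover have "\<delta> * D > 0" "H * (\<delta> * D) > 0" using \<delta> D H by auto
    ultimately show "\<delta> * D \<le> e" "H * (\<delta> * D) + \<delta> \<le> e" using \<delta> by linarith+
  qed
  obtain p where p: "\<And>x. x \<in> {c'..d'} \<Longrightarrow> \<bar>Q' x - poly p x\<bar> < \<delta>"
    using polynomial_approx[OF cQ \<delta>] by blast
  obtain P0 where P0: "pderiv P0 = p" using poly_antideriv by blast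
  \<comment> \<open>The constant makes \<open>P\<close> and \<open>Q\<close> agree at
    \<open>c'\<close>, so the bound on the derivatives carries over to the values.\<close>
  define P where "P = P0 - [:poly P0 c':]"
  have P: "(poly P has_real_derivative poly p x) (at x)" for x
  proof -
    have "pderiv P = p" by (simp add: P_def P0 pderiv_diff pderiv_pCons)
    then show ?thesis using poly_DERIV[of P x] by simp
  qed
  have PQ: "\<bar>poly P x - Q x\<bar> \<le> \<delta> * D" if x: "x \<in> {c'..d'}" for x
  proof (cases "x = c'")
    case True
    then show ?thesis using \<delta> D out c by (simp add: P_def Q_def)
  next
    case False
    then have "c' < x" using x by simp
    then obtain z where z: "c' < z" "z < x"
      "(poly P x - Q x) - (poly P c' - Q c') = (x - c') * (poly p z - Q' z)"
      using MVT2[of c' x "\<lambda>x. poly P x - Q x" "\<lambda>x. poly p x - Q' x"] DERIV_diff[OF P dQ] by blast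
    have "poly P c' - Q c' = 0" using out c by (simp add: P_def Q_def)
    then have "\<bar>poly P x - Q x\<bar> = (x - c') * \<bar>poly p z - Q' z\<bar>"
      using z x by (simp add: abs_mult)
    also have "\<dots> \<le> D * \<delta>"
      using z x p[of z] by (intro mult_mono) (auto simp: D_def)
    finally show ?thesis by (simp add: mult.commute)
  qed
  define v where "v = bump s P 0"
  have v: "v x = \<eta> x * poly P x" for x by (simp add: v_def \<eta>_def bump_def)
  have Ve: "V x = \<eta> x * Q x" for x
  proof (cases "x \<in> {c'<..<d'}")
    case True
    then show ?thesis using pos[OF True]
      by (simp add: \<eta>_def bump_def Q_def exp_minus field_simps)
  next
    case False
    then have "V x = 0" using out[of x] c by auto
    then show ?thesis by (simp add: Q_def)
  qed
  note d\<eta> = test_has_deriv[OF \<eta>t]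
  have dv: "deriv v x = deriv \<eta> x * poly P x + poly p x * \<eta> x" for x
    unfolding v[abs_def] by (intro DERIV_imp_deriv DERIV_mult d\<eta> P)
  have GV: "G x = deriv \<eta> x * Q x + Q' x * \<eta> x" for x
  proof (rule DERIV_unique[OF V])
    show "(V has_real_derivative deriv \<eta> x * Q x + Q' x * \<eta> x) (at x)"
      unfolding Ve[abs_def] by (intro DERIV_mult d\<eta> dQ)
  qed
  have est: "\<bar>v x - V x\<bar> \<le> e \<and> \<bar>deriv v x - G x\<bar> \<le> e" for x
  proof (cases "x \<in> {c'..d'}")
    case True
    have "\<bar>v x - V x\<bar> = \<bar>\<eta> x\<bar> * \<bar>poly P x - Q x\<bar>"
      by (simp add: v Ve right_diff_distrib flip: abs_mult)
    also have "\<dots> \<le> 1 * (\<delta> * D)" using \<eta>1 PQ[OF True] by (intro mult_mono) auto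
    also have "\<dots> \<le> e" using \<delta>D by simp
    finally have 1: "\<bar>v x - V x\<bar> \<le> e" .
    have "deriv v x - G x = deriv \<eta> x * (poly P x - Q x) + \<eta> x * (poly p x - Q' x)"
      by (simp add: dv GV algebra_simps)
    then have "\<bar>deriv v x - G x\<bar> \<le> \<bar>deriv \<eta> x\<bar> * \<bar>poly P x - Q x\<bar> + \<bar>\<eta> x\<bar> * \<bar>poly p x - Q' x\<bar>"
      by (simp add: abs_triangle_ineq flip: abs_mult)
    also have "\<dots> \<le> H * (\<delta> * D) + 1 * \<delta>"
      using H \<eta>1 PQ[OF True] p[OF True] by (intro add_mono mult_mono) auto
    also have "\<dots> \<le> e" using \<delta>D by simp
    finally show ?thesis using 1 by simp
  next
    case False
    have "v y = 0" if "y \<notin> {c'..d'}" for y using neg[OF that] by (simp add: v_def bump_def)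
    then have v0: "0 = v y" if "y \<in> - {c'..d'}" for y using that by simp
    have "((\<lambda>_. 0) has_real_derivative 0) (at x)" by simp
    then have "(v has_real_derivative 0) (at x)"
      by (rule has_field_derivative_transform_within_open[where S = "- {c'..d'}", OF _ _ _ v0])
         (use False in \<open>auto simp: open_Compl\<close>)
    then have "deriv v x = 0" by (rule DERIV_imp_deriv)
    moreover have "v x = 0" using neg[OF False] by (simp add: v_def bump_def)
    moreover have "x \<notin> {c..d}" using False c by auto
    ultimately show ?thesis using e by (simp add: G0 out)
  qed
  show thesis
    by (rule that[of v]) (use est b in \<open>auto simp: v_def\<close>)
qed

text \<open>The function is contracted towards the midpoint of the interval to make its support compact.\<close>

lemma test_approx:
  assumes V: "\<And>x. (V has_real_derivative G x) (at x)" and G: "continuous_on UNIV G"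
    and out: "\<And>x. x \<notin> \<Omega> \<Longrightarrow> V x = 0"
    and M: "\<And>x. \<bar>V x\<bar> \<le> M" and K: "\<And>x. \<bar>G x\<bar> \<le> K"
  obtains v :: "nat \<Rightarrow> real \<Rightarrow> real" where "\<And>n. v n \<in> test_functions \<Omega>"
    "\<And>n x. \<bar>v n x\<bar> \<le> M + 1 / (real n + 1)"
    "\<And>n x. \<bar>deriv (v n) x\<bar> \<le> K + (K + 1) / (real n + 1)"
    "\<And>x. (\<lambda>n. deriv (v n) x) \<longlonglongrightarrow> G x"
proof -
  define m where "m = (a + b) / 2"
  define l where "l = (b - a) / 2"
  have l: "l > 0" "a = m - l" "b = m + l" using ab by (simp_all add: l_def m_def field_simps)
  \<comment> \<open>The factor exceeds 1, so the support shrinks to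
    \<open>[m - l / \<kappa> n, m + l / \<kappa> n]\<close>. The bound \<open>M\<close> is untouched
    and \<open>K\<close> grows to \<open>K * \<kappa> n\<close>; the rest of each error term is the
    smoothing error \<open>1 / (n + 1)\<close>.\<close>
  define \<kappa> where "\<kappa> n = 1 + 1 / (real n + 1)" for n
  have "\<exists>v. v \<in> test_functions \<Omega> \<and> (\<forall>x. \<bar>v x - V (m + \<kappa> n * (x - m))\<bar> \<le> 1 / (real n + 1))
      \<and> (\<forall>x. \<bar>deriv v x - G (m + \<kappa> n * (x - m)) * \<kappa> n\<bar> \<le> 1 / (real n + 1))" for n
  proof -
    have \<kappa>1: "\<kappa> n > 1" by (simp add: \<kappa>_def)
    define q where "q = l / \<kappa> n"
    have q: "0 < q" "q < l" "\<kappa> n * q = l" using l \<kappa>1 by (simp_all add: q_def field_simps)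
    show ?thesis
    proof (rule test_approx_compact[where c' = "m - (q + l) / 2" and c = "m - q" and d = "m + q"
          and d' = "m + (q + l) / 2" and V = "\<lambda>x. V (m + \<kappa> n * (x - m))"
          and G = "\<lambda>x. G (m + \<kappa> n * (x - m)) * \<kappa> n" and e = "1 / (real n + 1)"])
      show "a < m - (q + l) / 2" "m - (q + l) / 2 < m - q" "m - q < m + q"
        "m + q < m + (q + l) / 2" "m + (q + l) / 2 < b"
        using q l by (simp_all add: field_simps)
      show "((\<lambda>x. V (m + \<kappa> n * (x - m))) has_real_derivative G (m + \<kappa> n * (x - m)) * \<kappa> n) (at x)" for x
        by (rule DERIV_chain2[OF V]) (auto intro!: derivative_eq_intros)
      show "continuous_on UNIV (\<lambda>x. G (m + \<kappa> n * (x - m)) * \<kappa> n)"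
        by (intro continuous_intros continuous_on_compose2[OF G]) auto
      show "V (m + \<kappa> n * (x - m)) = 0" if "x \<notin> {m - q..m + q}" for x
      proof (rule out)
        have "\<bar>x - m\<bar> > q" using that by auto
        then have "\<kappa> n * \<bar>x - m\<bar> > l" using \<kappa>1 q by (metis mult_less_cancel_left_pos order_less_trans zero_less_one)
        then have "\<bar>\<kappa> n * (x - m)\<bar> > l" using \<kappa>1 by (simp add: abs_mult)
        then show "m + \<kappa> n * (x - m) \<notin> \<Omega>" using l by (auto simp: \<Omega>)
      qed
    qed auto
  qed
  then obtain v where v: "\<And>n. v n \<in> test_functions \<Omega>"
    "\<And>n x. \<bar>v n x - V (m + \<kappa> n * (x - m))\<bar> \<le> 1 / (real n + 1)"
    "\<And>n x. \<bar>deriv (v n) x - G (m + \<kappa> n * (x - m)) * \<kappa> n\<bar> \<le> 1 / (real n + 1)"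
    by metis
  have lim\<kappa>: "\<kappa> \<longlonglongrightarrow> 1" unfolding \<kappa>_def by real_asymp
  show thesis
  proof (rule that[of v])
    show "\<bar>v n x\<bar> \<le> M + 1 / (real n + 1)" for n x
      using v(2)[of n x] M[of "m + \<kappa> n * (x - m)"] by linarith
    show "\<bar>deriv (v n) x\<bar> \<le> K + (K + 1) / (real n + 1)" for n x
    proof -
      have "\<bar>G (m + \<kappa> n * (x - m)) * \<kappa> n\<bar> \<le> K * \<kappa> n"
        using K[of "m + \<kappa> n * (x - m)"] by (simp add: abs_mult \<kappa>_def mult_right_mono)
      also have "\<dots> = K + K / (real n + 1)" by (simp add: \<kappa>_def algebra_simps)
      finally show ?thesis using v(3)[of n x] by (simp add: add_divide_distrib)
    qed
    show "(\<lambda>n. deriv (v n) x) \<longlonglongrightarrow> G x" for x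
    proof -
      have "(\<lambda>n. m + \<kappa> n * (x - m)) \<longlonglongrightarrow> m + 1 * (x - m)" by (intro tendsto_intros lim\<kappa>)
      then have "(\<lambda>n. G (m + \<kappa> n * (x - m))) \<longlonglongrightarrow> G (m + 1 * (x - m))"
        by (rule continuous_on_tendsto_compose[OF G]) auto
      then have "(\<lambda>n. G (m + \<kappa> n * (x - m)) * \<kappa> n) \<longlonglongrightarrow> G (m + 1 * (x - m)) * 1"
        by (intro tendsto_mult lim\<kappa>)
      then have l1: "(\<lambda>n. G (m + \<kappa> n * (x - m)) * \<kappa> n) \<longlonglongrightarrow> G x" by simp
      have "(\<lambda>n. deriv (v n) x - G (m + \<kappa> n * (x - m)) * \<kappa> n) \<longlonglongrightarrow> 0"
      proof (rule Lim_null_comparison)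
        show "\<forall>\<^sub>F n in sequentially. norm (deriv (v n) x - G (m + \<kappa> n * (x - m)) * \<kappa> n) \<le> 1 / (real n + 1)"
          using v(3) by simp
        show "(\<lambda>n. 1 / (real n + 1)) \<longlonglongrightarrow> 0" by real_asymp
      qed
      from tendsto_add[OF this l1] show ?thesis by simp
    qed
  qed (rule v(1))
qed

text \<open>Integration by parts via Fubini. The zero mean of \<open>g\<close> removes the constant
  \<open>c\<close> and turns the tail integral of \<open>g\<close> into minus its primitive, so no
  boundary terms appear.\<close>

lemma BV_pairing:
  assumes u: "represented_by \<Omega> (weak_deriv \<Omega> u) \<mu> \<nu>"
      "AE x in L. u x = c + cumulative \<mu> x - cumulative \<nu> x"
    and g: "integrable L g" "(\<integral>x. g x \<partial>L) = 0" and ui: "integrable L u"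
  shows "(\<integral>x. g x * u x \<partial>L) = (\<integral>y. primitive L g y \<partial>\<nu>) - (\<integral>y. primitive L g y \<partial>\<mu>)"
proof -
  have \<mu>: "finite_borel_on \<Omega> \<mu>" and \<nu>: "finite_borel_on \<Omega> \<nu>"
    using u by (auto simp: represented_by_def)
  have tail: "(\<integral>x. g x * indicator {y..} x \<partial>L) = - primitive L g y" for y
  proof -
    have i: "integrable L (\<lambda>x. g x * indicator S x)" if "S \<in> sets borel" for S
      using that by (intro integrable_mult_bounded[OF g(1), of _ 1] borel_measurable_L) (auto simp: indicator_def)
    \<comment> \<open>The half-lines \<open>{y..}\<close> and \<open>{..y}\<close> overlap in one
      point, which has no Lebesgue mass.\<close>
    have "AE x in lebesgue. x \<noteq> y" by (rule AE_completion) (rule AE_lborel_singleton)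
    then have "AE x in L. x \<noteq> y" unfolding AE_L_iff by eventually_elim simp
    then have "AE x in L. g x * indicator {y..} x = g x - g x * indicator {..y} x"
      by eventually_elim (auto simp: indicator_def)
    then have "(\<integral>x. g x * indicator {y..} x \<partial>L) = (\<integral>x. g x - g x * indicator {..y} x \<partial>L)"
      using i[of "{y..}"] i[of "{..y}"] g(1) by (intro integral_cong_AE) auto
    also have "\<dots> = - primitive L g y"
      using i[of "{..y}"] g by (simp add: primitive_def)
    finally show ?thesis .
  qed
  have F: "(\<integral>x. g x * cumulative \<sigma> x \<partial>L) = - (\<integral>y. primitive L g y \<partial>\<sigma>)"
    "integrable L (\<lambda>x. g x * cumulative \<sigma> x)"
    if \<sigma>: "finite_borel_on \<Omega> \<sigma>" for \<sigma>
  proof -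
    note f = finite_borel_onD[OF \<sigma>]
    interpret \<sigma>: finite_measure \<sigma> by (rule f)
    have "(\<integral>x. g x * (\<integral>y. 1 * indicator {..x} y \<partial>\<sigma>) \<partial>L)
        = (\<integral>y. 1 * (\<integral>x. g x * indicator {y..} x \<partial>L) \<partial>\<sigma>)"
      by (intro primitive_Fubini L.finite_measure_axioms f(1) id_measurable_L f(4) g(1)) simp_all
    then show "(\<integral>x. g x * cumulative \<sigma> x \<partial>L) = - (\<integral>y. primitive L g y \<partial>\<sigma>)"
      by (simp add: cumulative_def primitive_def tail[unfolded primitive_def])
    show "integrable L (\<lambda>x. g x * cumulative \<sigma> x)"
      using cumulative_integrable[OF \<sigma>] cumulative_bounded[OF \<sigma>]
      by (intro integrable_mult_bounded[OF g(1), of _ "measure \<sigma> \<Omega>"]) auto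
  qed
  have "(\<integral>x. g x * u x \<partial>L) = (\<integral>x. c * g x + g x * cumulative \<mu> x - g x * cumulative \<nu> x \<partial>L)"
  proof (rule integral_cong_AE)
    show "AE x in L. g x * u x = c * g x + g x * cumulative \<mu> x - g x * cumulative \<nu> x"
      using u(2)
    proof eventually_elim
      case (elim x)
      show ?case unfolding elim by (simp add: algebra_simps)
    qed
  qed (use g ui F(2)[OF \<mu>] F(2)[OF \<nu>] in auto)
  also have "\<dots> = c * (\<integral>x. g x \<partial>L) + (\<integral>x. g x * cumulative \<mu> x \<partial>L) - (\<integral>x. g x * cumulative \<nu> x \<partial>L)"
    using g(1) F(2)[OF \<mu>] F(2)[OF \<nu>] by simp
  finally show ?thesis using F(1)[OF \<mu>] F(1)[OF \<nu>] g(2) by simp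
qed

text \<open>Dominated convergence against the two representing measures. Convergence is asked at
  every point, since these measures may have atoms.\<close>

lemma BV_pairing_limit:
  assumes u: "u \<in> BV \<Omega>" and g: "integrable L g" "(\<integral>x. g x \<partial>L) = 0"
    and z: "\<And>n. z n \<in> test_functions \<Omega>" "\<And>n x. \<bar>z n x\<bar> \<le> C"
      "\<And>x. (\<lambda>n. z n x) \<longlonglongrightarrow> primitive L g x"
  shows "(\<lambda>n. weak_deriv \<Omega> u (z n)) \<longlonglongrightarrow> - (\<integral>x. g x * u x \<partial>L)"
proof -
  obtain \<mu> \<nu> c where rep: "represented_by \<Omega> (weak_deriv \<Omega> u) \<mu> \<nu>"
    and AE: "AE x in L. u x = c + cumulative \<mu> x - cumulative \<nu> x"
    using BV_structure[OF u] by blast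
  have \<mu>: "finite_borel_on \<Omega> \<mu>" and \<nu>: "finite_borel_on \<Omega> \<nu>"
    using rep by (auto simp: represented_by_def)
  have lim: "(\<lambda>n. \<integral>x. z n x \<partial>\<sigma>) \<longlonglongrightarrow> (\<integral>x. primitive L g x \<partial>\<sigma>)"
    if \<sigma>: "finite_borel_on \<Omega> \<sigma>" for \<sigma>
  proof (rule integral_dominated_convergence[where w = "\<lambda>_. C"])
    note f = finite_borel_onD[OF \<sigma>]
    interpret \<sigma>: finite_measure \<sigma> by (rule f)
    show "primitive L g \<in> borel_measurable \<sigma>"
      unfolding primitive_def[abs_def]
      by (rule primitive_measurable[OF f(1) L.finite_measure_axioms f(4) id_measurable_L integrable_zero g(1)]) simp
    show "z n \<in> borel_measurable \<sigma>" for n by (rule f(4)[OF test_measurable[OF z(1)]])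
    show "integrable \<sigma> (\<lambda>_. C)" by simp
    show "AE x in \<sigma>. (\<lambda>n. z n x) \<longlonglongrightarrow> primitive L g x" using z(3) by simp
    show "AE x in \<sigma>. norm (z n x) \<le> C" for n using z(2) by simp
  qed
  have "(\<lambda>n. (\<integral>x. z n x \<partial>\<mu>) - (\<integral>x. z n x \<partial>\<nu>))
      \<longlonglongrightarrow> (\<integral>x. primitive L g x \<partial>\<mu>) - (\<integral>x. primitive L g x \<partial>\<nu>)"
    by (intro tendsto_diff lim \<mu> \<nu>)
  moreover have "weak_deriv \<Omega> u (z n) = (\<integral>x. z n x \<partial>\<mu>) - (\<integral>x. z n x \<partial>\<nu>)" for n
    using rep z(1) by (simp add: represented_by_def)
  ultimately show ?thesis
    using BV_pairing[OF rep AE g BV_integrable[OF u]] by simp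
qed

subsection \<open>Radon norms and bounded functions\<close>

text \<open>The positive and negative parts of a Borel version serve as densities, taken on the
  restricted space because \<open>finite_borel_on\<close> demands the trace sigma-algebra.\<close>

lemma dist_of_finite_radon:
  assumes h: "integrable L h"
  shows "is_finite_radon \<Omega> (dist_of \<Omega> h)"
proof -
  obtain g where g: "g \<in> borel_measurable borel" "integrable lborel g" "\<And>x. x \<notin> \<Omega> \<Longrightarrow> g x = 0"
    "AE x in L. h x = g x"
    "\<And>v. v \<in> borel_measurable borel \<Longrightarrow> (\<integral>x. h x * v x \<partial>L) = (\<integral>x. g x * v x \<partial>lborel)"
    using borel_representative[OF h] by blast
  note [measurable] = g(1)
  let ?B = "restrict_space lborel \<Omega>"
  define P where "P r = density ?B (\<lambda>x. ennreal (max 0 (r * g x)))" for r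
  have maxi: "integrable lborel (\<lambda>x. max 0 (r * g x))" for r
    using g(2) by (intro integrable_max) auto
  have maxB: "integrable ?B (\<lambda>x. max 0 (r * g x))" for r
    using integrable_mult_indicator[OF _ maxi[of r], of \<Omega>]
    by (subst integrable_restrict_space) auto
  have fin: "finite_borel_on \<Omega> (P r)" for r
    unfolding finite_borel_on_def
  proof
    show "finite_measure (P r)"
    proof (rule finite_measureI)
      have "emeasure (P r) (space (P r)) = (\<integral>\<^sup>+x. ennreal (max 0 (r * g x)) * indicator (space ?B) x \<partial>?B)"
        unfolding P_def space_density by (rule emeasure_density[OF _ sets.top]) (use maxB[of r] in auto)
      also have "\<dots> = (\<integral>\<^sup>+x. ennreal (max 0 (r * g x)) \<partial>?B)"
        by (intro nn_integral_cong) (simp add: space_restrict_space)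
      also have "\<dots> = ennreal (\<integral>x. max 0 (r * g x) \<partial>?B)"
        by (rule nn_integral_eq_integral[OF maxB]) simp
      finally show "emeasure (P r) (space (P r)) \<noteq> \<infinity>" by simp
    qed
    show "sets (P r) = sets (restrict_space borel \<Omega>)"
      unfolding P_def sets_density by (intro sets_restrict_space_cong) simp
  qed
  have int: "(\<integral>x. v x \<partial>P r) = (\<integral>x. max 0 (r * g x) * v x \<partial>lborel)"
    if v: "v \<in> test_functions \<Omega>" for v r
  proof -
    note [measurable] = test_measurable[OF v]
    have "(\<integral>x. v x \<partial>P r) = (\<integral>x. max 0 (r * g x) *\<^sub>R v x \<partial>?B)"
      unfolding P_def by (rule integral_density) (auto intro!: measurable_restrict_space1)
    also have "\<dots> = (\<integral>x. indicator \<Omega> x *\<^sub>R (max 0 (r * g x) *\<^sub>R v x) \<partial>lborel)"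
      by (rule integral_restrict_space) simp
    also have "\<dots> = (\<integral>x. max 0 (r * g x) * v x \<partial>lborel)"
      using g(3) by (intro Bochner_Integration.integral_cong) (auto simp: indicator_def)
    finally show ?thesis .
  qed
  have "dist_of \<Omega> h v = (\<integral>x. v x \<partial>P 1) - (\<integral>x. v x \<partial>P (- 1))"
    if v: "v \<in> test_functions \<Omega>" for v
  proof -
    note [measurable] = test_measurable[OF v]
    obtain C where C: "\<And>x. \<bar>v x\<bar> \<le> C" using test_bounded[OF v] by blast
    have i: "integrable lborel (\<lambda>x. max 0 (r * g x) * v x)" for r
      using C by (intro integrable_mult_bounded[of _ _ _ C] maxi) auto
    have "(\<integral>x. v x \<partial>P 1) - (\<integral>x. v x \<partial>P (- 1))
        = (\<integral>x. max 0 (1 * g x) * v x - max 0 (- 1 * g x) * v x \<partial>lborel)"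
      unfolding int[OF v] by (rule Bochner_Integration.integral_diff[symmetric, OF i i])
    also have "\<dots> = (\<integral>x. g x * v x \<partial>lborel)"
      by (intro Bochner_Integration.integral_cong) (auto simp: max_def)
    finally show ?thesis using g(5)[of v] by (simp add: dist_of_def)
  qed
  then show ?thesis
    unfolding is_finite_radon_def represented_by_def using fin by blast
qed

lemma
  assumes "integrable L w"
  shows primitive_BV: "primitive L w \<in> BV \<Omega>"
    and primitive_L_weak_deriv:
      "v \<in> test_functions \<Omega> \<Longrightarrow> weak_deriv \<Omega> (primitive L w) v = dist_of \<Omega> w v"
proof -
  show *: "v \<in> test_functions \<Omega> \<Longrightarrow> weak_deriv \<Omega> (primitive L w) v = dist_of \<Omega> w v" for v
    unfolding dist_of_def
    by (rule primitive_weak_deriv[OF L.finite_measure_axioms id_measurable_L assms]) simp_all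
  show "primitive L w \<in> BV \<Omega>"
    using is_finite_radon_cong[OF dist_of_finite_radon[OF assms] *]
      primitive_integrable(1)[OF L.finite_measure_axioms id_measurable_L assms]
    by (simp add: BV_def)
qed

lemma
  assumes "c \<in> \<Omega>"
  shows step_weak_deriv: "v \<in> test_functions \<Omega> \<Longrightarrow> weak_deriv \<Omega> (indicator {c..}) v = v c"
    and step_BV: "indicator {c..} \<in> BV \<Omega>"
proof -
  show *: "weak_deriv \<Omega> (indicator {c..}) v = v c" if "v \<in> test_functions \<Omega>" for v
    using test_tail[OF that assms] by (simp add: weak_deriv_def dist_deriv_def dist_of_def mult.commute)
  \<comment> \<open>The Dirac mass at \<open>c\<close>, as the image of the counting measure of one
    point.\<close>
  define \<delta> where "\<delta> = distr (count_space {c}) (restrict_space borel \<Omega>) (\<lambda>x. x)"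
  have m: "(\<lambda>x. x) \<in> count_space {c} \<rightarrow>\<^sub>M restrict_space borel \<Omega>"
    using assms by (simp add: space_restrict_space)
  have "finite_measure \<delta>"
    unfolding \<delta>_def by (rule finite_measure.finite_measure_distr[OF finite_measure_count_space m]) simp
  then have fin: "finite_borel_on \<Omega> \<delta>" by (simp add: finite_borel_on_def \<delta>_def)
  have int: "(\<integral>x. v x \<partial>\<delta>) = v c" if v: "v \<in> test_functions \<Omega>" for v
    unfolding \<delta>_def
    by (subst integral_distr[OF m])
       (auto intro!: measurable_restrict_space1 test_measurable[OF v] simp: lebesgue_integral_count_space_finite)
  have "represented_by \<Omega> (weak_deriv \<Omega> (indicator {c..})) \<delta> (null_measure (restrict_space borel \<Omega>))"
    using fin finite_borel_null int * by (simp add: represented_by_def)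
  moreover have "integrable L (indicator {c..} :: real \<Rightarrow> real)"
    by (rule bounded_integrable[OF L.finite_measure_axioms borel_measurable_L, of _ 1])
       (auto simp: indicator_def)
  ultimately show "indicator {c..} \<in> BV \<Omega>"
    unfolding BV_def is_finite_radon_def by blast
qed

lemma const_weak_deriv:
  assumes "v \<in> test_functions \<Omega>"
  shows "weak_deriv \<Omega> (\<lambda>_. c) v = 0"
proof -
  have "integral UNIV (deriv v) = integral {a..b} (deriv v)"
    using test_outside[OF test_deriv[OF assms]] by (intro integral_eq_UNIV[symmetric]) (auto simp: \<Omega>)
  also have "\<dots> = v b - v a"
    using ab test_has_deriv[OF assms]
    by (intro integral_unique fundamental_theorem_of_calculus)
       (auto simp: has_real_derivative_iff_has_vector_derivative[symmetric] intro: has_field_derivative_at_within)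
  also have "\<dots> = 0" using test_outside[OF assms] by (simp add: \<Omega>)
  finally have "integral UNIV (deriv v) = 0" .
  then have "(\<integral>x. deriv v x \<partial>L) = 0"
    using lebesgue_integral_eq_integral[OF test_L_integrable[OF test_deriv[OF assms]]]
      integral_eq_UNIV[of \<Omega> "deriv v"] test_outside[OF test_deriv[OF assms]] by simp
  then show ?thesis by (simp add: weak_deriv_def dist_deriv_def dist_of_def)
qed

lemma const_BV: "(\<lambda>_. c) \<in> BV \<Omega>"
  using finite_borel_null const_weak_deriv
  by (auto simp: BV_def is_finite_radon_def represented_by_def
      intro!: exI[of _ "null_measure (restrict_space borel \<Omega>)"])

lemma primitive_const: "x \<in> \<Omega> \<Longrightarrow> primitive L (\<lambda>_. 1) x = x - a"
proof -
  assume x: "x \<in> \<Omega>"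
  have "{a<..x} \<inter> \<Omega> = {a<..x}" using x by (auto simp: \<Omega>)
  moreover have "primitive L (\<lambda>_. 1) x = (\<integral>y. indicator {a<..x} y \<partial>L)"
    unfolding primitive_def
    by (intro Bochner_Integration.integral_cong) (auto simp: \<Omega> indicator_def)
  ultimately have "primitive L (\<lambda>_. 1) x = measure L {a<..x}" by simp
  also have "\<dots> = x - a"
    using x by (subst measure_restrict_space) (auto simp: \<Omega>)
  finally show ?thesis .
qed

lemma primitive_step: "x \<in> \<Omega> \<Longrightarrow> c \<in> \<Omega> \<Longrightarrow> primitive L (indicator {c..}) x = max 0 (x - c)"
proof -
  assume x: "x \<in> \<Omega>" and c: "c \<in> \<Omega>"
  have "{c..x} \<inter> \<Omega> = {c..x}" using x c by (auto simp: \<Omega>)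
  moreover have "primitive L (indicator {c..}) x = (\<integral>y. indicator {c..x} y \<partial>L)"
    unfolding primitive_def
    by (intro Bochner_Integration.integral_cong) (auto simp: indicator_def)
  ultimately have "primitive L (indicator {c..}) x = measure L {c..x}" by simp
  also have "\<dots> = max 0 (x - c)"
    using x c by (subst measure_restrict_space) (auto simp: \<Omega>)
  finally show ?thesis .
qed

section \<open>Scaling in the Radon norm\<close>

lemma radon_le_iff:
  "radon_norm \<Omega> T \<le> ereal r \<longleftrightarrow>
     (\<forall>v\<in>test_functions \<Omega>. (\<forall>x\<in>\<Omega>. \<bar>v x\<bar> \<le> 1) \<longrightarrow> T v \<le> r)"
  unfolding radon_norm_def by (auto simp: SUP_le_iff)

lemma radon_nonneg: "T (\<lambda>x. 0) = 0 \<Longrightarrow> 0 \<le> radon_norm \<Omega> T"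
  unfolding radon_norm_def using test_zero
  by (intro SUP_upper2[of "\<lambda>x. 0"]) auto

text \<open>A \<open>distribution\<close> is an arbitrary functional; homogeneity is what carries a
  bound from test functions of sup norm at most 1 to all of them.\<close>

definition homog :: "distribution \<Rightarrow> bool" where
  "homog T \<longleftrightarrow> (\<forall>v\<in>test_functions \<Omega>. \<forall>c. T (\<lambda>x. c * v x) = c * T v)"

lemma radon_bound:
  assumes T: "homog T" "radon_norm \<Omega> T \<le> ereal r"
    and v: "v \<in> test_functions \<Omega>" "\<And>x. \<bar>v x\<bar> \<le> C" "C > 0"
  shows "\<bar>T v\<bar> \<le> C * r"
proof -
  \<comment> \<open>\<open>s = 1\<close> and \<open>s = - 1\<close> give the two signs of the
    absolute value.\<close>
  have 1: "s / C * T v \<le> r" if "\<bar>s\<bar> = 1" for s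
  proof -
    have "T (\<lambda>x. s / C * v x) \<le> r"
      using T(2)[unfolded radon_le_iff] test_scale[OF v(1), of "s / C"] v(2,3) that
      by (simp add: abs_mult)
    moreover have "T (\<lambda>x. s / C * v x) = s / C * T v"
      using T(1) v(1) unfolding homog_def by blast
    ultimately show ?thesis by simp
  qed
  then show ?thesis using 1[of 1] 1[of "- 1"] v(3) by (simp add: field_simps abs_le_iff)
qed

lemma deriv_scale: "v \<in> test_functions \<Omega> \<Longrightarrow> deriv (\<lambda>x. c * v x) = (\<lambda>x. c * deriv v x)"
  by (intro ext DERIV_imp_deriv DERIV_cmult test_has_deriv)

lemma homog_dist_of: "homog (dist_of \<Omega> u)"
  unfolding homog_def dist_of_def by (simp add: mult.left_commute)

lemma homog_dist_deriv: "homog T \<Longrightarrow> homog (dist_deriv T)"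
  unfolding homog_def dist_deriv_def by (simp add: deriv_scale test_deriv)

lemma homog_weak_deriv: "homog (weak_deriv \<Omega> u)"
  unfolding weak_deriv_def by (intro homog_dist_deriv homog_dist_of)

lemma homog_dist_diff: "homog S \<Longrightarrow> homog T \<Longrightarrow> homog (dist_diff S T)"
  unfolding homog_def dist_diff_def by (simp add: right_diff_distrib)

lemma homog_zero: "homog T \<Longrightarrow> T (\<lambda>x. 0) = 0"
proof -
  assume "homog T"
  from spec[OF bspec[OF this[unfolded homog_def] test_zero], of 0] show ?thesis by simp
qed

text \<open>The common class of \<open>f\<close>, of all BV functions and of their differences; it
  keeps every square and product integrable on the finite measure space \<open>L\<close>.\<close>

definition ess_bounded :: "(real \<Rightarrow> real) \<Rightarrow> bool" where
  "ess_bounded h \<longleftrightarrow> h \<in> borel_measurable L \<and> (\<exists>C. AE x in L. \<bar>h x\<bar> \<le> C)"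

lemma ess_bounded_BV: "u \<in> BV \<Omega> \<Longrightarrow> ess_bounded u"
  unfolding ess_bounded_def using BV_bounded BV_integrable by (metis borel_measurable_integrable)

lemma ess_bounded_integrable: "ess_bounded h \<Longrightarrow> integrable L h"
  unfolding ess_bounded_def real_norm_def[symmetric] using L.integrable_const_bound by blast

lemma ess_bounded_lincomb:
  assumes "ess_bounded h" "ess_bounded k"
  shows "ess_bounded (\<lambda>x. c * h x + d * k x)"
proof -
  obtain C D where "AE x in L. \<bar>h x\<bar> \<le> C" "AE x in L. \<bar>k x\<bar> \<le> D"
    using assms by (auto simp: ess_bounded_def)
  then have "AE x in L. \<bar>c * h x + d * k x\<bar> \<le> \<bar>c\<bar> * C + \<bar>d\<bar> * D"
  proof eventually_elim
    case (elim x)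
    have "\<bar>c * h x + d * k x\<bar> \<le> \<bar>c\<bar> * \<bar>h x\<bar> + \<bar>d\<bar> * \<bar>k x\<bar>"
      by (simp add: abs_triangle_ineq flip: abs_mult)
    also have "\<dots> \<le> \<bar>c\<bar> * C + \<bar>d\<bar> * D" using elim by (intro add_mono mult_left_mono) auto
    finally show ?case .
  qed
  then show ?thesis using assms unfolding ess_bounded_def by auto
qed

lemma ess_bounded_diff: "ess_bounded h \<Longrightarrow> ess_bounded k \<Longrightarrow> ess_bounded (\<lambda>x. h x - k x)"
  using ess_bounded_lincomb[of h k 1 "- 1"] by simp

lemma ess_bounded_mult_integrable: "integrable L h \<Longrightarrow> ess_bounded k \<Longrightarrow> integrable L (\<lambda>x. h x * k x)"
  unfolding ess_bounded_def using integrable_mult_bounded by blast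

lemma sq_L2_norm_eq:
  assumes "ess_bounded h"
  shows "sq_L2_norm \<Omega> h = ereal (\<integral>x. (h x)\<^sup>2 \<partial>L)"
proof -
  have "integrable L (\<lambda>x. (h x)\<^sup>2)"
    using ess_bounded_mult_integrable[OF ess_bounded_integrable[OF assms] assms]
    by (simp add: power2_eq_square)
  then have "(\<integral>\<^sup>+x. ennreal ((h x)\<^sup>2) \<partial>L) = ennreal (\<integral>x. (h x)\<^sup>2 \<partial>L)"
    by (rule nn_integral_eq_integral) simp
  then show ?thesis by (simp add: sq_L2_norm_def)
qed

lemma integral_sq_expand:
  assumes g: "ess_bounded g" and k: "ess_bounded k"
  shows "(\<integral>x. (g x - t * k x)\<^sup>2 \<partial>L)
    = (\<integral>x. (g x)\<^sup>2 \<partial>L) - 2 * t * (\<integral>x. g x * k x \<partial>L) + t\<^sup>2 * (\<integral>x. (k x)\<^sup>2 \<partial>L)"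
proof -
  note i = ess_bounded_mult_integrable[OF ess_bounded_integrable[OF g] g]
    ess_bounded_mult_integrable[OF ess_bounded_integrable[OF g] k]
    ess_bounded_mult_integrable[OF ess_bounded_integrable[OF k] k]
  have "(\<integral>x. (g x - t * k x)\<^sup>2 \<partial>L)
      = (\<integral>x. g x * g x - 2 * t * (g x * k x) + t\<^sup>2 * (k x * k x) \<partial>L)"
    by (simp add: power2_eq_square algebra_simps)
  also have "\<dots> = (\<integral>x. g x * g x \<partial>L) - 2 * t * (\<integral>x. g x * k x \<partial>L) + t\<^sup>2 * (\<integral>x. k x * k x \<partial>L)"
    using i by simp
  finally show ?thesis by (simp add: power2_eq_square)
qed

subsection \<open>First-order optimality conditions\<close>

abbreviation residual :: "(real \<Rightarrow> real) \<Rightarrow> (real \<Rightarrow> real) \<Rightarrow> distribution" where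
  "residual u w \<equiv> dist_diff (weak_deriv \<Omega> u) (dist_of \<Omega> w)"

lemma homog_residual: "homog (residual u w)"
  by (intro homog_dist_diff homog_weak_deriv homog_dist_of)

text \<open>Competitors enter with upper bounds \<open>A\<close> and \<open>B\<close> for their
  penalties instead of exact values, which turns comparisons in \<open>ereal\<close> into real
  inequalities.\<close>

lemma TGV_energy_le:
  assumes "ess_bounded (\<lambda>x. f x - u x)" "\<alpha> > 0" "\<beta> > 0"
    and "radon_norm \<Omega> (residual u w) \<le> ereal A" "radon_norm \<Omega> (weak_deriv \<Omega> w) \<le> ereal B"
  shows "TGV_energy \<Omega> f \<alpha> \<beta> (u, w)
      \<le> ereal ((\<integral>x. (f x - u x)\<^sup>2 \<partial>L) / 2 + \<alpha> * A + \<beta> * B)"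
proof -
  have "ereal \<alpha> * radon_norm \<Omega> (residual u w) \<le> ereal (\<alpha> * A)"
    using ereal_mult_left_mono[OF assms(4), of "ereal \<alpha>"] assms(2) by simp
  moreover have "ereal \<beta> * radon_norm \<Omega> (weak_deriv \<Omega> w) \<le> ereal (\<beta> * B)"
    using ereal_mult_left_mono[OF assms(5), of "ereal \<beta>"] assms(3) by simp
  ultimately have "ereal (1 / 2) * sq_L2_norm \<Omega> (\<lambda>x. f x - u x) + ereal \<alpha> * radon_norm \<Omega> (residual u w)
      + ereal \<beta> * radon_norm \<Omega> (weak_deriv \<Omega> w)
      \<le> ereal ((\<integral>x. (f x - u x)\<^sup>2 \<partial>L) / 2) + ereal (\<alpha> * A) + ereal (\<beta> * B)"
    by (intro add_mono) (simp_all add: sq_L2_norm_eq[OF assms(1)])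
  then show ?thesis by (simp add: TGV_energy_def)
qed

lemma TGV_min_le:
  assumes f: "ess_bounded f" "\<alpha> > 0" "\<beta> > 0"
    and min: "is_arg_min (TGV_energy \<Omega> f \<alpha> \<beta>) (\<lambda>p. p \<in> BV \<Omega> \<times> BV \<Omega>) (u, w)"
  shows "TGV_energy \<Omega> f \<alpha> \<beta> (u, w) \<le> ereal ((\<integral>x. (f x)\<^sup>2 \<partial>L) / 2)"
proof -
  let ?Z = "\<lambda>_. 0 :: real"
  have "(?Z, ?Z) \<in> BV \<Omega> \<times> BV \<Omega>" using const_BV by simp
  then have "\<not> TGV_energy \<Omega> f \<alpha> \<beta> (?Z, ?Z) < TGV_energy \<Omega> f \<alpha> \<beta> (u, w)"
    using min unfolding is_arg_min_def by blast
  then have "TGV_energy \<Omega> f \<alpha> \<beta> (u, w) \<le> TGV_energy \<Omega> f \<alpha> \<beta> (?Z, ?Z)" by (simp only: not_less)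
  also have "\<dots> \<le> ereal ((\<integral>x. (f x - 0)\<^sup>2 \<partial>L) / 2 + \<alpha> * 0 + \<beta> * 0)"
  proof (rule TGV_energy_le)
    show "radon_norm \<Omega> (residual ?Z ?Z) \<le> ereal 0" "radon_norm \<Omega> (weak_deriv \<Omega> ?Z) \<le> ereal 0"
      unfolding radon_le_iff by (auto simp: dist_diff_def const_weak_deriv) (simp_all add: dist_of_def)
  qed (use f in simp_all)
  finally show ?thesis by simp
qed

text \<open>The energy is at most that of \<open>(0, 0)\<close> and its summands are nonnegative, so
  neither penalty is infinite; afterwards the argument can run in the reals.\<close>

lemma TGV_min_finite:
  assumes f: "ess_bounded f" "\<alpha> > 0" "\<beta> > 0"
    and min: "is_arg_min (TGV_energy \<Omega> f \<alpha> \<beta>) (\<lambda>p. p \<in> BV \<Omega> \<times> BV \<Omega>) (u, w)"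
  obtains A B where "radon_norm \<Omega> (residual u w) = ereal A" "radon_norm \<Omega> (weak_deriv \<Omega> w) = ereal B"
proof -
  have "u \<in> BV \<Omega>" using min by (auto simp: is_arg_min_def)
  then have sq: "sq_L2_norm \<Omega> (\<lambda>x. f x - u x) = ereal (\<integral>x. (f x - u x)\<^sup>2 \<partial>L)"
    by (rule sq_L2_norm_eq[OF ess_bounded_diff[OF f(1) ess_bounded_BV]])
  have nn: "radon_norm \<Omega> (residual u w) \<ge> 0" "radon_norm \<Omega> (weak_deriv \<Omega> w) \<ge> 0"
    using radon_nonneg[of "residual u w", OF homog_zero[OF homog_residual]]
      radon_nonneg[of "weak_deriv \<Omega> w", OF homog_zero[OF homog_weak_deriv]] by simp_all
  have "TGV_energy \<Omega> f \<alpha> \<beta> (u, w) \<noteq> \<infinity>" using TGV_min_le[OF assms] by auto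
  then show thesis
    using nn f that
    by (cases "radon_norm \<Omega> (residual u w)"; cases "radon_norm \<Omega> (weak_deriv \<Omega> w)")
       (auto simp: TGV_energy_def sq)
qed

lemma weak_deriv_uminus: "weak_deriv \<Omega> (\<lambda>x. - h x) v = - weak_deriv \<Omega> h v"
  by (simp add: weak_deriv_def dist_deriv_def dist_of_def)

lemma primitive_uminus: "primitive L (\<lambda>x. - h x) y = - primitive L h y"
  by (simp add: primitive_def)

lemma BV_uminus: "h \<in> BV \<Omega> \<Longrightarrow> (\<lambda>x. - h x) \<in> BV \<Omega>"
  using BV_lincomb[of h h "- 1" 0] by simp

lemma L_cong: "(\<And>x. x \<in> \<Omega> \<Longrightarrow> h x = k x) \<Longrightarrow> (\<integral>x. h x \<partial>L) = (\<integral>x. k x \<partial>L)"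
  by (intro Bochner_Integration.integral_cong) auto

end

section \<open>Variations around a fixed minimiser\<close>

locale minimiser = open_interval +
  fixes f u w :: "real \<Rightarrow> real" and \<alpha> \<beta> A B :: real
  assumes f: "ess_bounded f" and \<alpha>: "\<alpha> > 0" and \<beta>: "\<beta> > 0"
    and min: "is_arg_min (TGV_energy \<Omega> f \<alpha> \<beta>) (\<lambda>p. p \<in> BV \<Omega> \<times> BV \<Omega>) (u, w)"
    and A: "radon_norm \<Omega> (residual u w) = ereal A"
    and B: "radon_norm \<Omega> (weak_deriv \<Omega> w) = ereal B"
begin

lemma u: "u \<in> BV \<Omega>" and w: "w \<in> BV \<Omega>"
  using min by (auto simp: is_arg_min_def)

definition g where "g x = f x - u x"

lemma g: "ess_bounded g"
  unfolding g_def[abs_def] by (intro ess_bounded_diff f ess_bounded_BV u)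

lemma gi: "integrable L g" by (rule ess_bounded_integrable[OF g])

lemma A_nonneg: "A \<ge> 0"
  using radon_nonneg[of "residual u w", OF homog_zero[OF homog_residual]] A by simp

lemma TGV_energy_min:
  "TGV_energy \<Omega> f \<alpha> \<beta> (u, w) = ereal ((\<integral>x. (g x)\<^sup>2 \<partial>L) / 2 + \<alpha> * A + \<beta> * B)"
  using sq_L2_norm_eq[OF g] by (simp add: TGV_energy_def A B g_def[abs_def])

text \<open>Minimality against \<open>(u + t \<phi>, w + t \<psi>)\<close>, divided by
  \<open>t\<close>, in the limit \<open>t = 0\<close>. Instead of derivatives of the norms,
  \<open>p\<close> and \<open>q\<close> bound their growth per unit of \<open>t\<close>; they may be
  negative, and \<open>t < 1\<close> lets a direction that shrinks a measure act by the factor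
  \<open>1 - t\<close>.\<close>

lemma first_variation:
  assumes \<phi>: "\<phi> \<in> BV \<Omega>" and \<psi>: "\<psi> \<in> BV \<Omega>"
    and p: "\<And>t v. \<lbrakk>0 < t; t < 1; v \<in> test_functions \<Omega>; \<forall>x\<in>\<Omega>. \<bar>v x\<bar> \<le> 1\<rbrakk>
      \<Longrightarrow> residual u w v + t * residual \<phi> \<psi> v \<le> A + t * p"
    and q: "\<And>t v. \<lbrakk>0 < t; t < 1; v \<in> test_functions \<Omega>; \<forall>x\<in>\<Omega>. \<bar>v x\<bar> \<le> 1\<rbrakk>
      \<Longrightarrow> weak_deriv \<Omega> w v + t * weak_deriv \<Omega> \<psi> v \<le> B + t * q"
  shows "(\<integral>x. g x * \<phi> x \<partial>L) \<le> \<alpha> * p + \<beta> * q"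
proof -
  define I where "I = (\<integral>x. g x * \<phi> x \<partial>L)"
  define S where "S = (\<integral>x. (\<phi> x)\<^sup>2 \<partial>L)"
  have key: "I \<le> t / 2 * S + (\<alpha> * p + \<beta> * q)" if t: "0 < t" "t < 1" for t
  proof -
    let ?u = "\<lambda>x. 1 * u x + t * \<phi> x" and ?w = "\<lambda>x. 1 * w x + t * \<psi> x"
    have BV: "?u \<in> BV \<Omega>" "?w \<in> BV \<Omega>" by (rule BV_lincomb[OF u \<phi>], rule BV_lincomb[OF w \<psi>])
    have "radon_norm \<Omega> (residual ?u ?w) \<le> ereal (A + t * p)"
      unfolding radon_le_iff
    proof (intro ballI impI)
      fix v assume v: "v \<in> test_functions \<Omega>" "\<forall>x\<in>\<Omega>. \<bar>v x\<bar> \<le> 1"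
      have "residual ?u ?w v = residual u w v + t * residual \<phi> \<psi> v"
        unfolding dist_diff_def weak_deriv_lincomb[OF BV_integrable[OF u] BV_integrable[OF \<phi>] v(1)]
          dist_of_lincomb[OF BV_integrable[OF w] BV_integrable[OF \<psi>] v(1)]
        by (simp add: algebra_simps)
      then show "residual ?u ?w v \<le> A + t * p" using p[OF t v] by simp
    qed
    moreover have "radon_norm \<Omega> (weak_deriv \<Omega> ?w) \<le> ereal (B + t * q)"
      unfolding radon_le_iff
    proof (intro ballI impI)
      fix v assume v: "v \<in> test_functions \<Omega>" "\<forall>x\<in>\<Omega>. \<bar>v x\<bar> \<le> 1"
      show "weak_deriv \<Omega> ?w v \<le> B + t * q"
        unfolding weak_deriv_lincomb[OF BV_integrable[OF w] BV_integrable[OF \<psi>] v(1)]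
        using q[OF t v] by simp
    qed
    moreover have "ess_bounded (\<lambda>x. f x - ?u x)" by (intro ess_bounded_diff f ess_bounded_BV BV)
    ultimately have up: "TGV_energy \<Omega> f \<alpha> \<beta> (?u, ?w)
        \<le> ereal ((\<integral>x. (f x - ?u x)\<^sup>2 \<partial>L) / 2 + \<alpha> * (A + t * p) + \<beta> * (B + t * q))"
      using \<alpha> \<beta> by (intro TGV_energy_le)
    have lo: "TGV_energy \<Omega> f \<alpha> \<beta> (u, w) \<le> TGV_energy \<Omega> f \<alpha> \<beta> (?u, ?w)"
    proof -
      have "(?u, ?w) \<in> BV \<Omega> \<times> BV \<Omega>" using BV by simp
      then have "\<not> TGV_energy \<Omega> f \<alpha> \<beta> (?u, ?w) < TGV_energy \<Omega> f \<alpha> \<beta> (u, w)"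
        using min unfolding is_arg_min_def by blast
      then show ?thesis by (simp only: not_less)
    qed
    have "(\<integral>x. (g x)\<^sup>2 \<partial>L) / 2 + \<alpha> * A + \<beta> * B
        \<le> (\<integral>x. (f x - ?u x)\<^sup>2 \<partial>L) / 2 + \<alpha> * (A + t * p) + \<beta> * (B + t * q)"
      using order_trans[OF lo up] unfolding TGV_energy_min ereal_less_eq .
    also have "(\<integral>x. (f x - ?u x)\<^sup>2 \<partial>L) = (\<integral>x. (g x - t * \<phi> x)\<^sup>2 \<partial>L)"
      by (simp add: g_def algebra_simps)
    also have "\<dots> = (\<integral>x. (g x)\<^sup>2 \<partial>L) - 2 * t * I + t\<^sup>2 * S"
      unfolding I_def S_def by (rule integral_sq_expand[OF g ess_bounded_BV[OF \<phi>]])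
    finally have "t * I \<le> t * (t / 2 * S + (\<alpha> * p + \<beta> * q))"
      by (simp add: power2_eq_square field_simps)
    then show ?thesis using t by simp
  qed
  have "I \<le> \<alpha> * p + \<beta> * q"
  proof (rule tendsto_lowerbound)
    show "((\<lambda>t. t / 2 * S + (\<alpha> * p + \<beta> * q)) \<longlongrightarrow> \<alpha> * p + \<beta> * q) (at_right 0)"
      by (auto intro!: tendsto_eq_intros)
    show "\<forall>\<^sub>F t in at_right 0. I \<le> t / 2 * S + (\<alpha> * p + \<beta> * q)"
    proof -
      have "\<forall>\<^sub>F t in at_right 0. t \<in> {0<..<1::real}" by (rule eventually_at_right_real) simp
      then show ?thesis by eventually_elim (use key in auto)
    qed
  qed simp
  then show ?thesis by (simp add: I_def)
qed

lemma residual_le: "v \<in> test_functions \<Omega> \<Longrightarrow> \<forall>x\<in>\<Omega>. \<bar>v x\<bar> \<le> 1 \<Longrightarrow> residual u w v \<le> A"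
  using A radon_le_iff[of "residual u w" A] by simp

lemma weak_deriv_w_le: "v \<in> test_functions \<Omega> \<Longrightarrow> \<forall>x\<in>\<Omega>. \<bar>v x\<bar> \<le> 1 \<Longrightarrow> weak_deriv \<Omega> w v \<le> B"
  using B radon_le_iff[of "weak_deriv \<Omega> w" B] by simp

text \<open>The pair of a primitive and its derivative leaves \<open>Du - w\<close> fixed, so only
  the last penalty changes: \<open>p = 0\<close>.\<close>

lemma pairing_primitive_le:
  assumes \<psi>: "\<psi> \<in> BV \<Omega>"
    and q: "\<And>v. \<lbrakk>v \<in> test_functions \<Omega>; \<forall>x\<in>\<Omega>. \<bar>v x\<bar> \<le> 1\<rbrakk> \<Longrightarrow> weak_deriv \<Omega> \<psi> v \<le> q"
  shows "(\<integral>x. g x * primitive L \<psi> x \<partial>L) \<le> \<beta> * q"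
proof -
  have "(\<integral>x. g x * primitive L \<psi> x \<partial>L) \<le> \<alpha> * 0 + \<beta> * q"
  proof (rule first_variation[OF primitive_BV[OF BV_integrable[OF \<psi>]] \<psi>])
    fix t v assume t: "0 < t" "t < (1::real)" and v: "v \<in> test_functions \<Omega>" "\<forall>x\<in>\<Omega>. \<bar>v x\<bar> \<le> 1"
    show "residual u w v + t * residual (primitive L \<psi>) \<psi> v \<le> A + t * 0"
      using residual_le[OF v] primitive_L_weak_deriv[OF BV_integrable[OF \<psi>] v(1)]
      by (simp add: dist_diff_def)
    show "weak_deriv \<Omega> w v + t * weak_deriv \<Omega> \<psi> v \<le> B + t * q"
      using weak_deriv_w_le[OF v] q[OF v] t by (intro add_mono mult_left_mono) auto
  qed
  then show ?thesis by simp
qed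

lemma pairing_primitive_abs:
  assumes \<psi>: "\<psi> \<in> BV \<Omega>"
    and q: "\<And>v. \<lbrakk>v \<in> test_functions \<Omega>; \<forall>x\<in>\<Omega>. \<bar>v x\<bar> \<le> 1\<rbrakk> \<Longrightarrow> \<bar>weak_deriv \<Omega> \<psi> v\<bar> \<le> q"
  shows "\<bar>\<integral>x. g x * primitive L \<psi> x \<partial>L\<bar> \<le> \<beta> * q"
proof -
  have "(\<integral>x. g x * primitive L \<psi> x \<partial>L) \<le> \<beta> * q"
    using q by (intro pairing_primitive_le \<psi>) force
  moreover have "(\<integral>x. g x * primitive L (\<lambda>x. - \<psi> x) x \<partial>L) \<le> \<beta> * q"
    using q by (intro pairing_primitive_le BV_uminus \<psi>) (force simp: weak_deriv_uminus)
  ultimately show ?thesis by (simp add: primitive_uminus)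
qed

text \<open>Adding a constant to \<open>u\<close> changes neither penalty, and both signs of the
  constant are admissible.\<close>

lemma g_mean: "(\<integral>x. g x \<partial>L) = 0"
proof -
  have "(\<integral>x. g x * s \<partial>L) \<le> 0" for s
  proof -
    have "(\<integral>x. g x * s \<partial>L) \<le> \<alpha> * 0 + \<beta> * 0"
    proof (rule first_variation[OF const_BV const_BV[of 0]])
      fix t v assume t: "0 < t" "t < (1::real)" and v: "v \<in> test_functions \<Omega>" "\<forall>x\<in>\<Omega>. \<bar>v x\<bar> \<le> 1"
      show "residual u w v + t * residual (\<lambda>_. s) (\<lambda>_. 0) v \<le> A + t * 0"
        using residual_le[OF v] const_weak_deriv[OF v(1), of s] by (simp add: dist_diff_def dist_of_def)
      show "weak_deriv \<Omega> w v + t * weak_deriv \<Omega> (\<lambda>_. 0) v \<le> B + t * 0"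
        using weak_deriv_w_le[OF v] const_weak_deriv[OF v(1), of 0] by simp
    qed
    then show ?thesis by simp
  qed
  from this[of 1] this[of "- 1"] show ?thesis by simp
qed

lemma bounded_mult_g:
  assumes "k \<in> borel_measurable borel" "\<And>x. x \<in> \<Omega> \<Longrightarrow> \<bar>k x\<bar> \<le> C"
  shows "integrable L (\<lambda>x. g x * k x)"
  using assms by (intro integrable_mult_bounded[OF gi, of _ C] borel_measurable_L AE_I2) auto

text \<open>The pair \<open>(x - a, 1)\<close> changes neither penalty, and the term with
  \<open>a\<close> drops out by \<open>g_mean\<close>.\<close>

lemma g_moment: "(\<integral>x. g x * x \<partial>L) = 0"
proof -
  have "\<bar>\<integral>x. g x * primitive L (\<lambda>_. 1) x \<partial>L\<bar> \<le> \<beta> * 0"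
    by (rule pairing_primitive_abs[OF const_BV]) (simp add: const_weak_deriv)
  then have "(\<integral>x. g x * x - a * g x \<partial>L) = 0"
    using L_cong[of "\<lambda>x. g x * primitive L (\<lambda>_. 1) x" "\<lambda>x. g x * x - a * g x"]
    by (simp add: primitive_const algebra_simps)
  moreover have "integrable L (\<lambda>x. g x * x)"
    by (rule bounded_mult_g[of _ "\<bar>a\<bar> + \<bar>b\<bar>"]) (auto simp: \<Omega>)
  ultimately show ?thesis using gi g_mean by simp
qed

text \<open>The weak derivative of the step is evaluation at \<open>c\<close>, at most 1 in modulus
  on admissible test functions, so \<open>q = 1\<close>.\<close>

lemma g_ramp: "c \<in> \<Omega> \<Longrightarrow> \<bar>\<integral>x. g x * max 0 (x - c) \<partial>L\<bar> \<le> \<beta>"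
proof -
  assume c: "c \<in> \<Omega>"
  have "\<bar>\<integral>x. g x * primitive L (indicator {c..}) x \<partial>L\<bar> \<le> \<beta> * 1"
    by (rule pairing_primitive_abs[OF step_BV[OF c]]) (use c in \<open>simp add: step_weak_deriv\<close>)
  then show ?thesis
    using L_cong[of "\<lambda>x. g x * primitive L (indicator {c..}) x" "\<lambda>x. g x * max 0 (x - c)"] c
    by (simp add: primitive_step)
qed

section \<open>The dual function and its derivative\<close>

definition G where "G = primitive L g"

text \<open>Cauchy's formula for the second antiderivative of \<open>g\<close> that vanishes to
  first order at \<open>a\<close>.\<close>

definition V where "V x = (\<integral>y. g y * max 0 (x - y) \<partial>L)"

lemma ramp_integrable: "integrable L (\<lambda>y. g y * max 0 (x - y))"
  by (rule bounded_mult_g[of _ "\<bar>x\<bar> + \<bar>a\<bar> + \<bar>b\<bar>"]) (auto simp: \<Omega>)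

lemma ind_integrable: "integrable L (\<lambda>y. g y * indicator {..x} y)"
  by (rule bounded_mult_g[of _ 1]) (auto simp: indicator_def)

lemma lin_integral: "(\<integral>y. g y * (x - y) \<partial>L) = 0" "integrable L (\<lambda>y. g y * (x - y))"
proof -
  have i: "integrable L (\<lambda>y. g y * y)"
    by (rule bounded_mult_g[of _ "\<bar>a\<bar> + \<bar>b\<bar>"]) (auto simp: \<Omega>)
  have e: "g y * (x - y) = x * g y - g y * y" for y by (simp add: algebra_simps)
  show "(\<integral>y. g y * (x - y) \<partial>L) = 0" "integrable L (\<lambda>y. g y * (x - y))"
    unfolding e using i gi g_mean g_moment by simp_all
qed

text \<open>Left of the interval the kernel vanishes; right of it the kernel is
  \<open>x - y\<close>, which the two moment conditions annihilate.\<close>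

lemma V_outside: "x \<notin> \<Omega> \<Longrightarrow> V x = 0"
proof (cases "x \<le> a")
  case True
  then have "V x = (\<integral>y. 0 \<partial>L)"
    unfolding V_def by (intro L_cong) (auto simp: \<Omega>)
  then show ?thesis by simp
next
  case False
  assume "x \<notin> \<Omega>"
  with False have "V x = (\<integral>y. g y * (x - y) \<partial>L)"
    unfolding V_def by (intro L_cong) (auto simp: \<Omega>)
  then show ?thesis by (simp add: lin_integral)
qed

text \<open>\<open>max 0 (x - y)\<close> and \<open>max 0 (y - x)\<close> differ by the affine
  function \<open>x - y\<close>, which integrates to 0 against \<open>g\<close>. So
  \<open>g_ramp\<close> applies to the mirrored kernel.\<close>

lemma V_bound: "\<bar>V x\<bar> \<le> \<beta>"
proof (cases "x \<in> \<Omega>")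
  case True
  have i: "integrable L (\<lambda>y. g y * max 0 (y - x))"
    by (rule bounded_mult_g[of _ "\<bar>x\<bar> + \<bar>a\<bar> + \<bar>b\<bar>"]) (auto simp: \<Omega>)
  have "V x = (\<integral>y. g y * max 0 (y - x) + g y * (x - y) \<partial>L)"
    unfolding V_def by (intro L_cong) (auto simp: max_def algebra_simps)
  also have "\<dots> = (\<integral>y. g y * max 0 (y - x) \<partial>L)"
    using i lin_integral[of x] by simp
  finally show ?thesis using g_ramp[OF True] by simp
qed (use V_outside \<beta> in simp)

text \<open>The Young inequality \<open>\<bar>g\<bar> \<le> 1 / (2k) + k g\<^sup>2 / 2\<close> replaces the Cauchy-Schwarz inequality.\<close>

lemma G_modulus:
  assumes "x \<le> y" "k > 0"
  shows "\<bar>G y - G x\<bar> \<le> (y - x) / (2 * k) + k / 2 * (\<integral>z. (g z)\<^sup>2 \<partial>L)"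
proof -
  have gg: "integrable L (\<lambda>z. (g z)\<^sup>2)"
    using ess_bounded_mult_integrable[OF gi g] by (simp add: power2_eq_square)
  let ?i = "\<lambda>z. indicator {x<..y} z / (2 * k) + k / 2 * (g z)\<^sup>2 :: real"
  have ii: "integrable L (indicator {x<..y} :: real \<Rightarrow> real)"
    by (rule bounded_integrable[OF L.finite_measure_axioms borel_measurable_L, of _ 1])
       (auto simp: indicator_def)
  have G: "G y - G x = (\<integral>z. g z * indicator {..y} z - g z * indicator {..x} z \<partial>L)"
    unfolding G_def primitive_def using ind_integrable by simp
  have "\<bar>G y - G x\<bar> \<le> (\<integral>z. ?i z \<partial>L)"
    unfolding G
  proof (rule order_trans[OF integral_abs_bound integral_mono])
    show "integrable L (\<lambda>z. \<bar>g z * indicator {..y} z - g z * indicator {..x} z\<bar>)"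
      using ind_integrable by simp
    show "integrable L ?i" using gg ii by simp
    fix z
    have "0 \<le> (1 - k * \<bar>g z\<bar>)\<^sup>2 / (2 * k)" using assms by simp
    also have "\<dots> = 1 / (2 * k) - \<bar>g z\<bar> + k / 2 * (g z)\<^sup>2"
      using assms by (simp add: power2_eq_square field_simps)
    finally have "\<bar>g z\<bar> \<le> 1 / (2 * k) + k / 2 * (g z)\<^sup>2" by simp
    then show "\<bar>g z * indicator {..y} z - g z * indicator {..x} z\<bar> \<le> ?i z"
      using assms by (auto simp: indicator_def)
  qed
  also have "\<dots> = measure L ({x<..y} \<inter> \<Omega>) / (2 * k) + k / 2 * (\<integral>z. (g z)\<^sup>2 \<partial>L)"
    using gg ii by simp
  also have "\<dots> \<le> (y - x) / (2 * k) + k / 2 * (\<integral>z. (g z)\<^sup>2 \<partial>L)"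
  proof (intro add_right_mono divide_right_mono)
    have "measure L ({x<..y} \<inter> \<Omega>) = measure lebesgue ({x<..y} \<inter> \<Omega>)"
      by (rule measure_restrict_space) auto
    also have "\<dots> \<le> measure lebesgue {x<..y}"
      by (rule measure_mono_fmeasurable) (auto simp: \<Omega> intro!: bounded_set_imp_lmeasurable)
    finally show "measure L ({x<..y} \<inter> \<Omega>) \<le> y - x" using assms by simp
  qed (use assms in simp)
  finally show ?thesis .
qed

end

subsection \<open>Vanishing of the residual\<close>

context minimiser
begin

text \<open>Serves twice: with \<open>r = 1\<close> for the Lipschitz bound of \<open>G\<close>, and
  with \<open>r = \<bar>y - x\<bar>\<close> for the quadratic Taylor remainder of
  \<open>V\<close>.\<close>

lemma g_window:
  assumes C: "AE z in L. \<bar>g z\<bar> \<le> C" "C \<ge> 0" and k: "k \<in> borel_measurable borel"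
    "\<And>z. \<bar>k z\<bar> \<le> r * indicator {x..y} z" and xy: "x \<le> y" "r \<ge> 0"
  shows "\<bar>\<integral>z. g z * k z \<partial>L\<bar> \<le> C * r * (y - x)"
proof -
  have kr: "\<bar>k z\<bar> \<le> r" for z using k(2)[of z] xy(2) by (cases "z \<in> {x..y}") auto
  have gk: "integrable L (\<lambda>z. g z * k z)" by (rule bounded_mult_g[OF k(1) kr])
  have ii: "integrable L (indicator {x..y} :: real \<Rightarrow> real)"
    by (rule bounded_integrable[OF L.finite_measure_axioms borel_measurable_L, of _ 1])
       (auto simp: indicator_def)
  have "\<bar>\<integral>z. g z * k z \<partial>L\<bar> \<le> (\<integral>z. \<bar>g z * k z\<bar> \<partial>L)" by (rule integral_abs_bound)
  also have "\<dots> \<le> (\<integral>z. C * r * indicator {x..y} z \<partial>L)"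
  proof (rule integral_mono_AE)
    show "AE z in L. \<bar>g z * k z\<bar> \<le> C * r * indicator {x..y} z"
      using C(1)
    proof eventually_elim
      case (elim z)
      have "\<bar>g z\<bar> * \<bar>k z\<bar> \<le> C * (r * indicator {x..y} z)"
        using elim k(2)[of z] C(2) by (intro mult_mono) auto
      then show ?case by (simp add: abs_mult)
    qed
  qed (use gk ii in auto)
  also have "\<dots> = C * r * measure L ({x..y} \<inter> \<Omega>)" by simp
  also have "\<dots> \<le> C * r * (y - x)"
  proof (intro mult_left_mono)
    have "measure L ({x..y} \<inter> \<Omega>) = measure lebesgue ({x..y} \<inter> \<Omega>)"
      by (rule measure_restrict_space) auto
    also have "\<dots> \<le> measure lebesgue {x..y}"
      by (rule measure_mono_fmeasurable) (auto simp: \<Omega>)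
    finally show "measure L ({x..y} \<inter> \<Omega>) \<le> y - x" using xy by simp
  qed (use C xy in simp)
  finally show ?thesis .
qed

lemma G_continuous: "continuous_on UNIV G"
  and V_deriv: "(V has_real_derivative G x) (at x)"
proof -
  obtain C0 where C0: "AE z in L. \<bar>g z\<bar> \<le> C0" using g by (auto simp: ess_bounded_def)
  define C where "C = \<bar>C0\<bar>"
  have C: "AE z in L. \<bar>g z\<bar> \<le> C" "C \<ge> 0"
    using C0 by (auto simp: C_def elim: eventually_mono)
  have G_le: "\<bar>G y - G x\<bar> \<le> C * \<bar>y - x\<bar>" if "x \<le> y" for x y
  proof -
    have "G y - G x = (\<integral>z. g z * (indicator {..y} z - indicator {..x} z) \<partial>L)"
      unfolding G_def primitive_def right_diff_distrib using ind_integrable by simp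
    also have "\<bar>\<dots>\<bar> \<le> C * 1 * (y - x)"
      by (rule g_window[OF C]) (use that in \<open>auto simp: indicator_def\<close>)
    finally show ?thesis using that by simp
  qed
  have "C-lipschitz_on UNIV G"
    unfolding lipschitz_on_def dist_real_def
    using G_le C(2) by (metis abs_minus_commute linear)
  then show "continuous_on UNIV G" by (rule lipschitz_on_continuous_on)
  have est: "\<bar>V y - V x - (y - x) * G x\<bar> \<le> C * \<bar>y - x\<bar> * \<bar>y - x\<bar>" for y
  proof -
    \<comment> \<open>The first-order Taylor remainder of the ramp \<open>max 0 (x - z)\<close> in
      the variable \<open>x\<close>. It vanishes unless \<open>z\<close> lies between
      \<open>x\<close> and \<open>y\<close>, and is at most \<open>\<bar>y - x\<bar>\<close> in
      modulus there.\<close>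
    let ?k = "\<lambda>z. max 0 (y - z) - max 0 (x - z) - (y - x) * indicator {..x} z"
    have "V y - V x - (y - x) * G x
        = (\<integral>z. g z * max 0 (y - z) - g z * max 0 (x - z) - (y - x) * (g z * indicator {..x} z) \<partial>L)"
      unfolding V_def G_def primitive_def using ramp_integrable ind_integrable by simp
    also have "\<dots> = (\<integral>z. g z * ?k z \<partial>L)" by (simp add: algebra_simps)
    also have "\<bar>\<dots>\<bar> \<le> C * \<bar>y - x\<bar> * (max x y - min x y)"
      by (rule g_window[OF C]) (auto simp: indicator_def max_def min_def abs_le_iff)
    finally show ?thesis by (simp add: max_def min_def split: if_splits)
  qed
  have "((\<lambda>y. (V y - V x) / (y - x) - G x) \<longlongrightarrow> 0) (at x)"
  proof (rule Lim_null_comparison)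
    show "((\<lambda>y. C * \<bar>y - x\<bar>) \<longlongrightarrow> 0) (at x)" by (auto intro!: tendsto_eq_intros)
    show "\<forall>\<^sub>F y in at x. norm ((V y - V x) / (y - x) - G x) \<le> C * \<bar>y - x\<bar>"
      unfolding eventually_at_filter
    proof (intro always_eventually allI impI)
      fix y assume y: "y \<noteq> x"
      have "(V y - V x) / (y - x) - G x = (V y - V x - (y - x) * G x) / (y - x)"
        using y by (simp add: field_simps)
      also have "norm \<dots> \<le> C * \<bar>y - x\<bar> * \<bar>y - x\<bar> / \<bar>y - x\<bar>"
        using divide_right_mono[OF est[of y], of "\<bar>y - x\<bar>"] by simp
      finally show "norm ((V y - V x) / (y - x) - G x) \<le> C * \<bar>y - x\<bar>" using y by simp
    qed
  qed
  then show "(V has_real_derivative G x) (at x)"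
    by (simp add: has_field_derivative_iff LIM_zero_iff)
qed

lemma energy_bound: "(\<integral>x. (g x)\<^sup>2 \<partial>L) \<le> (\<integral>x. (f x)\<^sup>2 \<partial>L)"
proof -
  have "B \<ge> 0" using radon_nonneg[of "weak_deriv \<Omega> w", OF homog_zero[OF homog_weak_deriv]] B by simp
  then have "\<alpha> * A \<ge> 0" "\<beta> * B \<ge> 0" using \<alpha> \<beta> A_nonneg by simp_all
  moreover have "(\<integral>x. (g x)\<^sup>2 \<partial>L) / 2 + \<alpha> * A + \<beta> * B \<le> (\<integral>x. (f x)\<^sup>2 \<partial>L) / 2"
    using TGV_min_le[OF f \<alpha> \<beta> min] unfolding TGV_energy_min ereal_less_eq .
  ultimately show ?thesis by linarith
qed

text \<open>Interpolation: \<open>\<bar>V\<bar> \<le> \<beta>\<close> and \<open>V'' = g\<close> is bounded in \<open>L\<^sup>2\<close>, so \<open>V' = G\<close> is small when \<open>\<beta>\<close> is.\<close>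

lemma G_bound:
  assumes S: "(\<integral>x. (f x)\<^sup>2 \<partial>L) \<le> S" and small: "\<beta> < \<alpha> ^ 3 / (128 * (S + 1))"
  shows "\<bar>G x\<bar> \<le> \<alpha> / 2"
proof (rule ccontr)
  assume "\<not> ?thesis"
  then have Gx: "\<bar>G x\<bar> > \<alpha> / 2" by simp
  have "(\<integral>x. (f x)\<^sup>2 \<partial>L) \<ge> 0" by simp
  then have S1: "S + 1 > 0" "S \<ge> 0" using S by linarith+
  \<comment> \<open>\<open>k\<close> makes the energy term of \<open>G_modulus\<close> at most
    \<open>\<alpha> / 8\<close>, and \<open>h\<close> makes the length term at most
    \<open>\<alpha> / 8\<close>; so \<open>G\<close> differs from \<open>G x\<close> by at most
    \<open>\<alpha> / 4\<close> up to \<open>x + h\<close>. The 1 in \<open>S + 1\<close> covers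
    \<open>S = 0\<close>.\<close>
  define k where "k = \<alpha> / (4 * (S + 1))"
  define h where "h = k * \<alpha> / 4"
  have k: "k > 0" "h > 0" using \<alpha> S1 by (simp_all add: k_def h_def)
  have kS: "k / 2 * S \<le> \<alpha> / 8"
  proof -
    have "k * (S + 1) = \<alpha> / 4" using S1 by (simp add: k_def field_simps)
    then have "k * S \<le> \<alpha> / 4" using k by (simp add: algebra_simps)
    then show ?thesis by (simp add: mult.commute)
  qed
  \<comment> \<open>A slope of modulus at least \<open>\<alpha> / 4\<close> over the length
    \<open>h\<close> must fit into the range \<open>[- \<beta>, \<beta>]\<close> of
    \<open>V\<close>, which the smallness of \<beta> forbids.\<close>
  have "\<exists>z>x. z < x + h \<and> V (x + h) - V x = (x + h - x) * G z"
    by (rule MVT2) (use k V_deriv in auto)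
  then obtain z where z: "x < z" "z < x + h" "V (x + h) - V x = h * G z" by auto
  have "\<bar>G z - G x\<bar> \<le> (z - x) / (2 * k) + k / 2 * (\<integral>z. (g z)\<^sup>2 \<partial>L)"
    using z k by (intro G_modulus) auto
  also have "(z - x) / (2 * k) \<le> h / (2 * k)" using z k by (intro divide_right_mono) auto
  also have "h / (2 * k) = \<alpha> / 8" using k by (simp add: h_def)
  also have "k / 2 * (\<integral>z. (g z)\<^sup>2 \<partial>L) \<le> k / 2 * S"
    using energy_bound S k by (intro mult_left_mono) auto
  finally have "\<bar>G z - G x\<bar> \<le> \<alpha> / 4" using kS by linarith
  then have "\<bar>G z\<bar> \<ge> \<alpha> / 4" using Gx by linarith
  then have "h * (\<alpha> / 4) \<le> \<bar>V (x + h) - V x\<bar>"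
    unfolding z(3) using k by (simp add: abs_mult)
  also have "\<dots> \<le> 2 * \<beta>" using V_bound[of "x + h"] V_bound[of x] by linarith
  finally have "h * \<alpha> / 8 \<le> \<beta>" by simp
  moreover have "h * \<alpha> / 8 = \<alpha> ^ 3 / (128 * (S + 1))"
    by (simp add: h_def k_def power3_eq_cube)
  ultimately show False using small by simp
qed

text \<open>One sequence serves both orders: \<open>deriv (v n)\<close>, of size about
  \<open>K\<close>, is tested against first derivatives, and \<open>v n\<close>, of size about
  \<beta>, against second ones.\<close>

lemma dual_approx:
  assumes K: "\<And>x. \<bar>G x\<bar> \<le> K"
  shows "\<exists>v. (\<forall>n. v n \<in> test_functions \<Omega>)
    \<and> (\<forall>n x. \<bar>v n x\<bar> \<le> \<beta> + 1 / (real n + 1))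
    \<and> (\<forall>n x. \<bar>deriv (v n) x\<bar> \<le> K + (K + 1) / (real n + 1))
    \<and> (\<forall>\<phi>\<in>BV \<Omega>. (\<lambda>n. weak_deriv \<Omega> \<phi> (deriv (v n))) \<longlonglongrightarrow> - (\<integral>x. g x * \<phi> x \<partial>L))"
proof -
  have K0: "K \<ge> 0" using K[of 0] by linarith
  obtain v :: "nat \<Rightarrow> real \<Rightarrow> real" where v: "\<And>n. v n \<in> test_functions \<Omega>"
    "\<And>n x. \<bar>v n x\<bar> \<le> \<beta> + 1 / (real n + 1)"
    "\<And>n x. \<bar>deriv (v n) x\<bar> \<le> K + (K + 1) / (real n + 1)"
    "\<And>x. (\<lambda>n. deriv (v n) x) \<longlonglongrightarrow> G x"
    using test_approx[OF V_deriv G_continuous V_outside V_bound K] by metis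
  have C: "\<bar>deriv (v n) x\<bar> \<le> K + (K + 1)" for n x
  proof -
    have "(K + 1) / (real n + 1) \<le> (K + 1) / 1" using K0 by (intro divide_left_mono) auto
    then show ?thesis using v(3)[of n x] by simp
  qed
  have "(\<lambda>n. weak_deriv \<Omega> \<phi> (deriv (v n))) \<longlonglongrightarrow> - (\<integral>x. g x * \<phi> x \<partial>L)" if "\<phi> \<in> BV \<Omega>" for \<phi>
    by (rule BV_pairing_limit[OF that gi g_mean test_deriv[OF v(1)] C]) (use v(4) in \<open>simp add: G_def\<close>)
  with v(1-3) show ?thesis by (intro exI[of _ v]) simp
qed

lemma A_zero:
  assumes K: "\<And>x. \<bar>G x\<bar> \<le> \<alpha> / 2"
  shows "A = 0"
proof -
  \<comment> \<open>The direction from \<open>u\<close> to the primitive of \<open>w\<close>. Its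
    weak derivative is minus the residual, so a step \<open>t\<close> scales the residual by
    \<open>1 - t\<close>.\<close>
  let ?\<phi> = "\<lambda>x. 1 * primitive L w x + (- 1) * u x"
  note wi = BV_integrable[OF w] and ui = BV_integrable[OF u]
  have \<phi>: "?\<phi> \<in> BV \<Omega>" by (rule BV_lincomb[OF primitive_BV[OF wi] u])
  have D: "weak_deriv \<Omega> ?\<phi> v = - residual u w v" if "v \<in> test_functions \<Omega>" for v
    unfolding weak_deriv_lincomb[OF BV_integrable[OF primitive_BV[OF wi]] ui that]
      primitive_L_weak_deriv[OF wi that] by (simp add: dist_diff_def)
  obtain v :: "nat \<Rightarrow> real \<Rightarrow> real" where v: "\<And>n. v n \<in> test_functions \<Omega>"
    "\<And>n x. \<bar>deriv (v n) x\<bar> \<le> \<alpha> / 2 + (\<alpha> / 2 + 1) / (real n + 1)"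
    "\<And>\<phi>. \<phi> \<in> BV \<Omega> \<Longrightarrow> (\<lambda>n. weak_deriv \<Omega> \<phi> (deriv (v n))) \<longlonglongrightarrow> - (\<integral>x. g x * \<phi> x \<partial>L)"
    using dual_approx[OF K] by blast
  have "- (\<integral>x. g x * ?\<phi> x \<partial>L) \<le> \<alpha> / 2 * A"
  proof (rule LIMSEQ_le[OF v(3)[OF \<phi>]])
    show "(\<lambda>n. (\<alpha> / 2 + (\<alpha> / 2 + 1) / (real n + 1)) * A) \<longlonglongrightarrow> \<alpha> / 2 * A" by real_asymp
    have "weak_deriv \<Omega> ?\<phi> (deriv (v n)) \<le> (\<alpha> / 2 + (\<alpha> / 2 + 1) / (real n + 1)) * A" for n
    proof -
      have "\<bar>residual u w (deriv (v n))\<bar> \<le> (\<alpha> / 2 + (\<alpha> / 2 + 1) / (real n + 1)) * A"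
      proof (rule radon_bound[OF homog_residual _ test_deriv[OF v(1)] v(2)])
        have "(\<alpha> / 2 + 1) / (real n + 1) \<ge> 0" using \<alpha> by simp
        then show "0 < \<alpha> / 2 + (\<alpha> / 2 + 1) / (real n + 1)" using \<alpha> by (intro add_pos_nonneg) simp
      qed (simp add: A)
      then show ?thesis unfolding D[OF test_deriv[OF v(1)]] by linarith
    qed
    then show "\<exists>N. \<forall>n\<ge>N. weak_deriv \<Omega> ?\<phi> (deriv (v n)) \<le> (\<alpha> / 2 + (\<alpha> / 2 + 1) / (real n + 1)) * A"
      by blast
  qed
  \<comment> \<open>\<open>w\<close> stays fixed, so \<open>q = 0\<close>, and the shrinking
    residual gives \<open>p = - A\<close>. Together with the bound above,
    \<open>\<alpha> * A \<le> \<alpha> / 2 * A\<close>.\<close>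
  moreover have "(\<integral>x. g x * ?\<phi> x \<partial>L) \<le> \<alpha> * (- A) + \<beta> * 0"
  proof (rule first_variation[OF \<phi> const_BV[of 0]])
    fix t v assume t: "0 < t" "t < (1::real)" and v: "v \<in> test_functions \<Omega>" "\<forall>x\<in>\<Omega>. \<bar>v x\<bar> \<le> 1"
    have "residual ?\<phi> (\<lambda>_. 0) v = - residual u w v"
      using D[OF v(1)] by (simp add: dist_diff_def dist_of_def)
    moreover have "(1 - t) * residual u w v \<le> (1 - t) * A"
      using residual_le[OF v] t by (intro mult_left_mono) auto
    ultimately show "residual u w v + t * residual ?\<phi> (\<lambda>_. 0) v \<le> A + t * - A"
      by (simp add: algebra_simps)
    show "weak_deriv \<Omega> w v + t * weak_deriv \<Omega> (\<lambda>_. 0) v \<le> B + t * 0"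
      using weak_deriv_w_le[OF v] const_weak_deriv[OF v(1), of 0] by simp
  qed
  ultimately have "\<alpha> * A \<le> 0" by argo
  then show ?thesis using \<alpha> A_nonneg by (simp add: mult_le_0_iff)
qed

section \<open>The second-order problem\<close>

lemma weak_deriv_u:
  assumes "A = 0" "v \<in> test_functions \<Omega>"
  shows "weak_deriv \<Omega> u v = dist_of \<Omega> w v"
proof -
  obtain C where C: "C > 0" "\<And>x. \<bar>v x\<bar> \<le> C" using test_bounded[OF assms(2)] by blast
  have "\<bar>residual u w v\<bar> \<le> C * 0"
    using A assms(1) by (intro radon_bound[OF homog_residual _ assms(2) C(2,1)]) simp
  then show ?thesis by (simp add: dist_diff_def)
qed

text \<open>Shrinking \<open>(u, w)\<close> by \<open>1 - t\<close> keeps \<open>Du = w\<close> and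
  lowers the norm of \<open>Dw\<close> by \<open>t * B\<close>, so \<open>p = 0\<close> and
  \<open>q = - B\<close>.\<close>

lemma pairing_u: "A = 0 \<Longrightarrow> \<beta> * B \<le> (\<integral>x. g x * u x \<partial>L)"
proof -
  assume A0: "A = 0"
  have "(\<integral>x. g x * - u x \<partial>L) \<le> \<alpha> * 0 + \<beta> * (- B)"
  proof (rule first_variation[OF BV_uminus[OF u] BV_uminus[OF w]])
    fix t v assume t: "0 < t" "t < (1::real)" and v: "v \<in> test_functions \<Omega>" "\<forall>x\<in>\<Omega>. \<bar>v x\<bar> \<le> 1"
    show "residual u w v + t * residual (\<lambda>x. - u x) (\<lambda>x. - w x) v \<le> A + t * 0"
      using weak_deriv_u[OF A0 v(1)] A0
      by (simp add: dist_diff_def weak_deriv_uminus) (simp add: dist_of_def)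
    have "(1 - t) * weak_deriv \<Omega> w v \<le> (1 - t) * B"
      using weak_deriv_w_le[OF v] t by (intro mult_left_mono) auto
    then show "weak_deriv \<Omega> w v + t * weak_deriv \<Omega> (\<lambda>x. - w x) v \<le> B + t * - B"
      by (simp add: weak_deriv_uminus algebra_simps)
  qed
  then show ?thesis by simp
qed

text \<open>The second derivative of \<open>v\<close> at \<open>z n\<close> is
  \<open>- weak_deriv \<Omega> v (deriv (z n))\<close>, which tends to the pairing, while its
  modulus is at most \<open>(\<beta> + 1 / (n + 1)) * R\<close>.\<close>

lemma pairing_TV2:
  assumes v: "v \<in> BV \<Omega>" and R: "radon_norm \<Omega> (dist_deriv (weak_deriv \<Omega> v)) = ereal R"
  shows "(\<integral>x. g x * v x \<partial>L) \<le> \<beta> * R"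
proof -
  \<comment> \<open>\<open>\<bar>V\<bar> \<le> \<beta>\<close> carries this estimate;
    \<open>dual_approx\<close> asks for some bound on \<open>G\<close>, and the L^1 norm of
    \<open>g\<close> provides one.\<close>
  obtain C0 where C0: "\<And>x. \<bar>G x\<bar> \<le> C0"
  proof -
    have "\<bar>G x\<bar> \<le> (\<integral>y. \<bar>g y\<bar> \<partial>L)" for x
      unfolding G_def by (rule primitive_integrable(2)[OF L.finite_measure_axioms id_measurable_L gi])
    then show thesis by (rule that)
  qed
  obtain z :: "nat \<Rightarrow> real \<Rightarrow> real" where z: "\<And>n. z n \<in> test_functions \<Omega>"
    "\<And>n x. \<bar>z n x\<bar> \<le> \<beta> + 1 / (real n + 1)"
    "\<And>\<phi>. \<phi> \<in> BV \<Omega> \<Longrightarrow> (\<lambda>n. weak_deriv \<Omega> \<phi> (deriv (z n))) \<longlonglongrightarrow> - (\<integral>x. g x * \<phi> x \<partial>L)"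
    using dual_approx[OF C0] by blast
  have "- (\<beta> * R) \<le> - (\<integral>x. g x * v x \<partial>L)"
  proof (rule LIMSEQ_le[OF _ z(3)[OF v]])
    show "(\<lambda>n. - ((\<beta> + 1 / (real n + 1)) * R)) \<longlonglongrightarrow> - (\<beta> * R)" by real_asymp
    have "- ((\<beta> + 1 / (real n + 1)) * R) \<le> weak_deriv \<Omega> v (deriv (z n))" for n
    proof -
      have "\<bar>dist_deriv (weak_deriv \<Omega> v) (z n)\<bar> \<le> (\<beta> + 1 / (real n + 1)) * R"
        using \<beta> R z(2)
        by (intro radon_bound[OF homog_dist_deriv[OF homog_weak_deriv] _ z(1)]) (auto intro!: add_pos_pos)
      then show ?thesis by (simp add: dist_deriv_def)
    qed
    then show "\<exists>N. \<forall>n\<ge>N. - ((\<beta> + 1 / (real n + 1)) * R) \<le> weak_deriv \<Omega> v (deriv (z n))"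
      by blast
  qed
  then show ?thesis by simp
qed

lemma TV2_energy_u: "A = 0 \<Longrightarrow> TV2_energy \<Omega> f \<beta> u = ereal ((\<integral>x. (g x)\<^sup>2 \<partial>L) / 2 + \<beta> * B)"
proof -
  assume A0: "A = 0"
  have "radon_norm \<Omega> (dist_deriv (weak_deriv \<Omega> u)) = radon_norm \<Omega> (weak_deriv \<Omega> w)"
    unfolding radon_norm_def
    by (intro SUP_cong refl)
       (auto simp: dist_deriv_def weak_deriv_u[OF A0] test_deriv weak_deriv_def[of _ w])
  then show ?thesis
    using sq_L2_norm_eq[OF g] by (simp add: TV2_energy_def B g_def[abs_def])
qed

text \<open>Expanding the square around \<open>g\<close> leaves the cross term, absorbed by
  \<open>pairing_TV2\<close> and \<open>pairing_u\<close>, and the squared distance. Keeping that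
  distance yields uniqueness along with minimality.\<close>

lemma TV2_energy_ge:
  assumes A0: "A = 0" and v: "v \<in> BV \<Omega>"
  shows "TV2_energy \<Omega> f \<beta> u + ereal ((\<integral>x. (v x - u x)\<^sup>2 \<partial>L) / 2) \<le> TV2_energy \<Omega> f \<beta> v"
proof -
  let ?T = "radon_norm \<Omega> (dist_deriv (weak_deriv \<Omega> v))"
  have T0: "?T \<ge> 0"
    using radon_nonneg[of "dist_deriv (weak_deriv \<Omega> v)", OF homog_zero[OF homog_dist_deriv[OF homog_weak_deriv]]] .
  note ev = ess_bounded_BV[OF v] and eu = ess_bounded_BV[OF u]
  have sq: "sq_L2_norm \<Omega> (\<lambda>x. f x - v x) = ereal (\<integral>x. (f x - v x)\<^sup>2 \<partial>L)"
    by (intro sq_L2_norm_eq ess_bounded_diff f ev)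
  show ?thesis
  proof (cases ?T)
    case (real R)
    have "(\<integral>x. (f x - v x)\<^sup>2 \<partial>L) = (\<integral>x. (g x - 1 * (v x - u x))\<^sup>2 \<partial>L)"
      by (simp add: g_def)
    also have "\<dots> = (\<integral>x. (g x)\<^sup>2 \<partial>L) - 2 * 1 * (\<integral>x. g x * (v x - u x) \<partial>L)
        + 1\<^sup>2 * (\<integral>x. (v x - u x)\<^sup>2 \<partial>L)"
      by (rule integral_sq_expand[OF g ess_bounded_diff[OF ev eu]])
    also have "(\<integral>x. g x * (v x - u x) \<partial>L) = (\<integral>x. g x * v x \<partial>L) - (\<integral>x. g x * u x \<partial>L)"
      unfolding right_diff_distrib
      using ess_bounded_mult_integrable[OF gi ev] ess_bounded_mult_integrable[OF gi eu] by simp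
    finally have "(\<integral>x. (f x - v x)\<^sup>2 \<partial>L) = (\<integral>x. (g x)\<^sup>2 \<partial>L)
        - 2 * ((\<integral>x. g x * v x \<partial>L) - (\<integral>x. g x * u x \<partial>L)) + (\<integral>x. (v x - u x)\<^sup>2 \<partial>L)"
      by (simp only: power_one mult_1 mult_1_right)
    then have "(\<integral>x. (g x)\<^sup>2 \<partial>L) / 2 + \<beta> * B + (\<integral>x. (v x - u x)\<^sup>2 \<partial>L) / 2
        \<le> (\<integral>x. (f x - v x)\<^sup>2 \<partial>L) / 2 + \<beta> * R"
      using pairing_TV2[OF v real] pairing_u[OF A0] by argo
    then show ?thesis unfolding TV2_energy_u[OF A0] by (simp add: TV2_energy_def sq real)
  next
    case PInf
    then show ?thesis using \<beta> by (simp add: TV2_energy_def sq)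
  qed (use T0 in simp)
qed

end

theorem proposition2:
  fixes a b \<alpha> :: real and f :: "real \<Rightarrow> real" and \<Omega> :: "real set"
  assumes "a < b" and "\<Omega> = {a<..<b}"
    and "f \<in> L_infty \<Omega> \<inter> BV \<Omega>"
    and "\<alpha> > 0"
  shows "\<exists>\<beta>\<^sub>0>0. \<forall>\<beta> u w. 0 < \<beta> \<and> \<beta> < \<beta>\<^sub>0 \<and>
           is_arg_min (TGV_energy \<Omega> f \<alpha> \<beta>) (\<lambda>p. p \<in> BV \<Omega> \<times> BV \<Omega>) (u, w) \<longrightarrow>
           radon_norm \<Omega> (singular_part \<Omega> u) = 0 \<and>
           (AE x in lebesgue_on \<Omega>. w x = ac_density \<Omega> u x) \<and>
           is_arg_min (TV2_energy \<Omega> f \<beta>) (\<lambda>v. v \<in> BV \<Omega>) u \<and>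
           (\<forall>v. is_arg_min (TV2_energy \<Omega> f \<beta>) (\<lambda>v. v \<in> BV \<Omega>) v \<longrightarrow>
                (AE x in lebesgue_on \<Omega>. v x = u x))"
proof -
  interpret open_interval a b \<Omega> using assms by unfold_locales
  define S where "S = (\<integral>x. (f x)\<^sup>2 \<partial>L)"
  have S: "S + 1 > 0" unfolding S_def by (simp add: add_nonneg_pos)
  have f: "ess_bounded f" using assms(3) by (auto simp: L_infty_def ess_bounded_def)
  show ?thesis
  proof (intro exI conjI allI impI; (elim conjE)?)
    \<comment> \<open>The smallness hypothesis of \<open>G_bound\<close>; it depends on \<alpha> and
      the L^2 norm of \<open>f\<close> alone.\<close>
    show "\<alpha> ^ 3 / (128 * (S + 1)) > 0" using assms(4) S by simp
    fix \<beta> u w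
    assume small: "0 < \<beta>" "\<beta> < \<alpha> ^ 3 / (128 * (S + 1))"
      and min: "is_arg_min (TGV_energy \<Omega> f \<alpha> \<beta>) (\<lambda>p. p \<in> BV \<Omega> \<times> BV \<Omega>) (u, w)"
    obtain A B where AB: "radon_norm \<Omega> (residual u w) = ereal A" "radon_norm \<Omega> (weak_deriv \<Omega> w) = ereal B"
      using TGV_min_finite[OF f assms(4) small(1) min] by blast
    interpret minimiser a b \<Omega> f u w \<alpha> \<beta> A B
      using f assms(4) small(1) min AB by unfold_locales
    have A0: "A = 0" by (rule A_zero[OF G_bound[OF _ small(2)]]) (simp add: S_def)
    note Du = BV_integrable[OF w] weak_deriv_u[OF A0]
    show "AE x in L. w x = ac_density \<Omega> u x" by (rule ac_density_AE[OF Du])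
    have "radon_norm \<Omega> (singular_part \<Omega> u) \<le> ereal 0"
      unfolding radon_le_iff using singular_part_zero[OF Du] by simp
    moreover have "0 \<le> radon_norm \<Omega> (singular_part \<Omega> u)"
      using radon_nonneg[of "singular_part \<Omega> u", OF singular_part_zero[OF Du test_zero]] .
    ultimately show "radon_norm \<Omega> (singular_part \<Omega> u) = 0" by (simp add: zero_ereal_def antisym)
    have le: "TV2_energy \<Omega> f \<beta> u \<le> TV2_energy \<Omega> f \<beta> v" if "v \<in> BV \<Omega>" for v
    proof -
      have "TV2_energy \<Omega> f \<beta> u + 0 \<le> TV2_energy \<Omega> f \<beta> u + ereal ((\<integral>x. (v x - u x)\<^sup>2 \<partial>L) / 2)"
        by (intro add_left_mono) simp
      then show ?thesis using TV2_energy_ge[OF A0 that] by simp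
    qed
    show "is_arg_min (TV2_energy \<Omega> f \<beta>) (\<lambda>v. v \<in> BV \<Omega>) u"
      unfolding is_arg_min_def using u le by (auto simp: not_less)
    fix v assume v: "is_arg_min (TV2_energy \<Omega> f \<beta>) (\<lambda>v. v \<in> BV \<Omega>) v"
    then have vBV: "v \<in> BV \<Omega>" and "TV2_energy \<Omega> f \<beta> v \<le> TV2_energy \<Omega> f \<beta> u"
      using u by (auto simp: is_arg_min_def not_less)
    \<comment> \<open>The energy of \<open>u\<close> is finite, so it cancels and only the squared
      distance remains.\<close>
    with TV2_energy_ge[OF A0 vBV] have "(\<integral>x. (v x - u x)\<^sup>2 \<partial>L) \<le> 0"
      unfolding TV2_energy_u[OF A0] by (cases "TV2_energy \<Omega> f \<beta> v") auto
    moreover have "integrable L (\<lambda>x. (v x - u x)\<^sup>2)"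
    proof -
      have "ess_bounded (\<lambda>x. v x - u x)" by (intro ess_bounded_diff ess_bounded_BV vBV u)
      then show ?thesis
        using ess_bounded_mult_integrable[OF ess_bounded_integrable] by (simp add: power2_eq_square)
    qed
    ultimately have "AE x in L. (v x - u x)\<^sup>2 = 0"
      by (subst integral_nonneg_eq_0_iff_AE[symmetric]) (auto intro: antisym)
    then show "AE x in L. v x = u x" by eventually_elim simp
  qed
qed

end
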